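(* Let $n$ be an odd prime, let $A$ be a cyclic division algebra over $\mathbb{Q}$ of degree $n$ (so of dimension $n^2$ over $\mathbb{Q}$) with a canonical generation $(\sigma, Z, S)$, $Z=\mathbb{Q}(\eta)$, where $\eta$ is the associated Gaussian period, and let $\mathfrak{m}$ be a maximal order of $A$ associated with this canonical generation. Suppose that 1. $\sigma \equiv 1 \pmod 2$, and 2. $N_{\mathbb{Q}(\eta)/\mathbb{Q}}(\eta) \equiv 1 \pmod 2$. Then for every integer $r\ge 2$, every matrix $C \in M_r(\mathfrak{m})$ is a (finite) sum of squares of matrices in $M_r(\mathfrak{m})$.
   Context: Cyclic algebra. Let $Z/\mathbb{Q}$ be a cyclic field extension of degree $n$, let $S$ be a generator of its Galois group (write $z^S$ for the image of $z$ under $S$), and let $\sigma \in \mathbb{Q}$, $\sigma\neq 0$. The cyclic algebra $(\sigma, Z, S)$ is the $\mathbb{Q}$-algebra $\bigoplus_{i=0}^{n-1} u^i Z$ of dimension $n^2$ over $\mathbb{Q}$, with multiplication determined by $zu = u z^S$ for $z\in Z$ and $u^n = \sigma$. A cyclic generation of $A$ is a presentation $A = (\sigma, Z, S)$. Canonical generation. Let $A$ be a cyclic division algebra of odd prime degree $n$ over $\mathbb{Q}$, and let $q_1,\dots,q_s$ ($s\ge 2$) be the distinct rational primes at which $A$ does not split. A canonical generation of $A$ is a cyclic generation $A=(\sigma, Z, S)$ such that $\sigma = q_1 q_2\cdots q_s$ and, for some rational prime $p$: $p\equiv 1 \pmod n$; $p \nmid \sigma$; each $q_i$ is not an $n$-th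 power modulo $p$; $\sigma$ is an $n$-th power modulo $p$; $Z$ is the unique cyclic field of degree $n$ over $\mathbb{Q}$ of conductor $p$ (discriminant $p^{n-1}$); and $S$ is a generator of $\mathrm{Gal}(Z/\mathbb{Q})$. Associated Gaussian period and maximal order. Given such a canonical generation, write $p = hn+1$, let $g$ be a primitive root modulo $p$ and $\xi$ a primitive $p$-th root of unity. Put $\eta = \sum_{r=0}^{h-1} \xi^{g^{nr}}$ (the Gaussian period), so $Z = \mathbb{Q}(\eta)$, and the conjugates $\eta, \eta^S, \dots, \eta^{S^{n-1}}$ form a normal $\mathbb{Z}$-basis of the ring of integers of $Z$. Put $\beta = \prod_{r=0}^{h-1}(1-\xi^{g^{nr}}) \in Z$ and $\alpha = \beta^{n-1}$. Let $\lambda$ be a rational integer with $\lambda^n \equiv \sigma \pmod p$, and define $y\in A$ by $py = (\lambda - u)\alpha$. The set $I(\lambda)$ of all $\mathbb{Z}$-linear combinations of the elements $y^i \eta^{S^k}$, $0\le i,k\le n-1$, is a maximal order in $A$ (a theorem of R. Hull). A maximal order associated with the canonical generation is any $\mathfrak{m}= I(\lambda)$ of this form. $M_r(\mathfrak{m})$ denotes the ring of $r\times r$ matrices over $\mathfrak{m}$. *)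

theory Defs
  imports
    "HOL-Analysis.Analysis"
    "HOL-Number_Theory.Number_Theory"
    "HOL-Algebra.QuotRing"
    "Jordan_Normal_Form.Matrix"
begin

section \<open>Cyclic number fields inside the complex numbers\<close>

definition complex_subfield :: "complex set \<Rightarrow> bool" where
  "complex_subfield Z \<longleftrightarrow> 0 \<in> Z \<and> 1 \<in> Z \<and>
     (\<forall>x\<in>Z. \<forall>y\<in>Z. x + y \<in> Z \<and> x - y \<in> Z \<and> x * y \<in> Z) \<and> (\<forall>x\<in>Z. inverse x \<in> Z)"

definition generated_subfield :: "complex set \<Rightarrow> complex set" where
  "generated_subfield X = \<Inter> {K. complex_subfield K \<and> X \<subseteq> K}"

definition cyclotomic_subfield :: "nat \<Rightarrow> complex set" where
  "cyclotomic_subfield m = generated_subfield {cis (2 * pi / real m)}"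

(* vector_space.dim is 0 for infinite-dimensional spaces, so this is the true degree only when
   it is positive. *)
definition rat_degree :: "complex set \<Rightarrow> nat" where
  "rat_degree Z = vector_space.dim (\<lambda>(r::rat) (z::complex). of_rat r * z) Z"

(* Field automorphisms of Z fix the rationals automatically; taking them extensional makes
   equality of automorphisms coincide with equality on Z. *)
definition galois_group :: "complex set \<Rightarrow> (complex \<Rightarrow> complex) set" where
  "galois_group Z = {\<tau> \<in> extensional Z. bij_betw \<tau> Z Z \<and>
     (\<forall>x\<in>Z. \<forall>y\<in>Z. \<tau> (x + y) = \<tau> x + \<tau> y \<and> \<tau> (x * y) = \<tau> x * \<tau> y)}"

(* Natural-number exponents suffice since the groups considered are finite. *)
definition galois_generator :: "complex set \<Rightarrow> (complex \<Rightarrow> complex) \<Rightarrow> bool" where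
  "galois_generator Z S \<longleftrightarrow> S \<in> galois_group Z \<and>
     (\<forall>\<tau>\<in>galois_group Z. \<exists>k::nat. \<forall>z\<in>Z. \<tau> z = (S ^^ k) z)"

definition cyclic_number_field :: "nat \<Rightarrow> complex set \<Rightarrow> bool" where
  "cyclic_number_field n Z \<longleftrightarrow> complex_subfield Z \<and> n > 0 \<and> rat_degree Z = n \<and>
     {z \<in> Z. \<forall>\<tau>\<in>galois_group Z. \<tau> z = z} = \<rat> \<and> (\<exists>S. galois_generator Z S)"

(* Conductor of an abelian number field: the least f such that the field lies in the f-th
   cyclotomic field. *)
definition has_conductor :: "complex set \<Rightarrow> nat \<Rightarrow> bool" where
  "has_conductor Z f \<longleftrightarrow> f > 0 \<and> Z \<subseteq> cyclotomic_subfield f \<and>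
     (\<forall>m. 0 < m \<and> m < f \<longrightarrow> \<not> Z \<subseteq> cyclotomic_subfield m)"

(* The norm from Z to the rationals, for Z Galois over the rationals. *)
definition galois_norm :: "complex set \<Rightarrow> complex \<Rightarrow> complex" where
  "galois_norm Z z = (\<Prod>\<tau>\<in>galois_group Z. \<tau> z)"


section \<open>Cyclic algebras\<close>

(* A division ring of characteristic 0 is a rational algebra in exactly one way; this is the
   structure map (of_rat is only available for commutative fields). *)
definition rat_emb :: "rat \<Rightarrow> 'a::division_ring" where
  "rat_emb r = of_int (fst (quotient_of r)) / of_int (snd (quotient_of r))"

(* The algebra 'a is the cyclic algebra (\<sigma>, Z, S), where emb identifies Z with a subfield of 'a;
   the last clause says that 'a is the direct sum of the u^i Z, each a free right Z-module on u^i. *)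
definition cyclic_generation ::
  "nat \<Rightarrow> rat \<Rightarrow> complex set \<Rightarrow> (complex \<Rightarrow> complex) \<Rightarrow> (complex \<Rightarrow> 'a::division_ring) \<Rightarrow> 'a \<Rightarrow> bool"
  where
  "cyclic_generation n \<sigma> Z S emb u \<longleftrightarrow>
     cyclic_number_field n Z \<and> galois_generator Z S \<and> \<sigma> \<noteq> 0 \<and>
     emb 1 = 1 \<and>
     (\<forall>x\<in>Z. \<forall>y\<in>Z. emb (x + y) = emb x + emb y \<and> emb (x * y) = emb x * emb y) \<and>
     (\<forall>z\<in>Z. emb z * u = u * emb (S z)) \<and>
     u ^ n = rat_emb \<sigma> \<and>
     (\<forall>a. \<exists>!c. c \<in> {..<n} \<rightarrow>\<^sub>E Z \<and> a = (\<Sum>i<n. u ^ i * emb (c i)))"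


section \<open>Splitting at a rational prime\<close>

definition padic_norm :: "nat \<Rightarrow> rat \<Rightarrow> real" where
  "padic_norm q r = (if r = 0 then 0 else
     real q powi (int (multiplicity (int q) (snd (quotient_of r)))
                - int (multiplicity (int q) (fst (quotient_of r)))))"

definition padic_cauchy :: "nat \<Rightarrow> (nat \<Rightarrow> rat) \<Rightarrow> bool" where
  "padic_cauchy q x \<longleftrightarrow> (\<forall>e>0. \<exists>N. \<forall>i\<ge>N. \<forall>j\<ge>N. padic_norm q (x i - x j) < e)"

definition padic_cauchy_ring :: "nat \<Rightarrow> (nat \<Rightarrow> rat) ring" where
  "padic_cauchy_ring q =
     \<lparr> carrier = {x. padic_cauchy q x},
       mult = (\<lambda>x y i. x i * y i), one = (\<lambda>i. 1),
       zero = (\<lambda>i. 0), add = (\<lambda>x y i. x i + y i) \<rparr>"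

definition padic_null :: "nat \<Rightarrow> (nat \<Rightarrow> rat) set" where
  "padic_null q = {x. (\<lambda>i. padic_norm q (x i)) \<longlonglongrightarrow> 0}"

(* The field of q-adic numbers, as the completion of the rationals: Cauchy sequences modulo
   null sequences. *)
definition padic_field :: "nat \<Rightarrow> (nat \<Rightarrow> rat) set ring" where
  "padic_field q = padic_cauchy_ring q Quot padic_null q"

definition mat_ring :: "nat \<Rightarrow> ('c, 'x) ring_scheme \<Rightarrow> 'c mat ring" where
  "mat_ring n K =
     \<lparr> carrier = {M \<in> carrier_mat n n. elements_mat M \<subseteq> carrier K},
       mult = (\<lambda>M N. mat n n (\<lambda>(i, j). \<Oplus>\<^bsub>K\<^esub>k\<in>{..<n}. M $$ (i, k) \<otimes>\<^bsub>K\<^esub> N $$ (k, j))),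
       one = mat n n (\<lambda>(i, j). if i = j then \<one>\<^bsub>K\<^esub> else \<zero>\<^bsub>K\<^esub>),
       zero = mat n n (\<lambda>(i, j). \<zero>\<^bsub>K\<^esub>),
       add = (\<lambda>M N. mat n n (\<lambda>(i, j). M $$ (i, j) \<oplus>\<^bsub>K\<^esub> N $$ (i, j))) \<rparr>"

definition rat_basis :: "nat \<Rightarrow> (nat \<Rightarrow> 'a::division_ring) \<Rightarrow> bool" where
  "rat_basis N b \<longleftrightarrow>
     (\<forall>a. \<exists>!c. c \<in> {..<N} \<rightarrow>\<^sub>E (UNIV :: rat set) \<and> a = (\<Sum>t<N. rat_emb (c t) * b t))"

(* For a field K of characteristic 0: the scalar extension of 'a to K is isomorphic, as a
   K-algebra, to the n-by-n matrices over K.  A K-algebra map out of the scalar extension is the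
   K-linear extension of a ring homomorphism f out of 'a, and it is bijective iff f sends a
   rational basis b of 'a to a K-basis of the matrix algebra. *)
definition splits_over :: "'a::division_ring itself \<Rightarrow> nat \<Rightarrow> ('c, 'x) ring_scheme \<Rightarrow> bool" where
  "splits_over T n K \<longleftrightarrow>
     (\<exists>(f :: 'a \<Rightarrow> 'c mat) N b.
        (\<forall>a. f a \<in> carrier (mat_ring n K)) \<and>
        f 1 = \<one>\<^bsub>mat_ring n K\<^esub> \<and>
        (\<forall>a a'. f (a + a') = f a \<oplus>\<^bsub>mat_ring n K\<^esub> f a' \<and>
                f (a * a') = f a \<otimes>\<^bsub>mat_ring n K\<^esub> f a') \<and>
        rat_basis N b \<and>
        (\<forall>M \<in> carrier (mat_ring n K). \<exists>!c. c \<in> {..<N} \<rightarrow>\<^sub>E carrier K \<and>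
           M = mat n n (\<lambda>(i, j). \<Oplus>\<^bsub>K\<^esub>t\<in>{..<N}. c t \<otimes>\<^bsub>K\<^esub> f (b t) $$ (i, j))))"

definition nonsplit_primes :: "'a::division_ring itself \<Rightarrow> nat \<Rightarrow> nat set" where
  "nonsplit_primes T n = {q. Factorial_Ring.prime q \<and> \<not> splits_over T n (padic_field q)}"


section \<open>Canonical generations and associated maximal orders\<close>

definition canonical_generation ::
  "nat \<Rightarrow> nat \<Rightarrow> int \<Rightarrow> complex set \<Rightarrow> (complex \<Rightarrow> complex) \<Rightarrow>
     (complex \<Rightarrow> 'a::division_ring) \<Rightarrow> 'a \<Rightarrow> bool"
  where
  "canonical_generation n p \<sigma> Z S emb u \<longleftrightarrow>
     cyclic_generation n (of_int \<sigma>) Z S emb u \<and>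
     finite (nonsplit_primes TYPE('a) n) \<and> card (nonsplit_primes TYPE('a) n) \<ge> 2 \<and>
     \<sigma> = int (\<Prod>(nonsplit_primes TYPE('a) n)) \<and>
     Factorial_Ring.prime p \<and> [p = 1] (mod n) \<and> \<not> int p dvd \<sigma> \<and>
     (\<forall>q\<in>nonsplit_primes TYPE('a) n. \<not> (\<exists>x::int. [x ^ n = int q] (mod int p))) \<and>
     (\<exists>x::int. [x ^ n = \<sigma>] (mod int p)) \<and>
     has_conductor Z p"

definition is_primitive_root_of_unity :: "nat \<Rightarrow> complex \<Rightarrow> bool" where
  "is_primitive_root_of_unity m \<xi> \<longleftrightarrow> m > 0 \<and> \<xi> ^ m = 1 \<and> (\<forall>k. 0 < k \<and> k < m \<longrightarrow> \<xi> ^ k \<noteq> 1)"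

definition gaussian_period :: "nat \<Rightarrow> nat \<Rightarrow> nat \<Rightarrow> complex \<Rightarrow> complex" where
  "gaussian_period n p g \<xi> = (\<Sum>r<(p - 1) div n. \<xi> ^ (g ^ (n * r)))"

definition period_product :: "nat \<Rightarrow> nat \<Rightarrow> nat \<Rightarrow> complex \<Rightarrow> complex" where
  "period_product n p g \<xi> = (\<Prod>r<(p - 1) div n. 1 - \<xi> ^ (g ^ (n * r)))"

(* m is the order I(l) attached to a canonical generation and to the choice of g and \<xi>;
   that I(l) is a maximal order is a theorem of Hull, not part of the definition. *)
definition associated_maximal_order ::
  "nat \<Rightarrow> nat \<Rightarrow> int \<Rightarrow> (complex \<Rightarrow> complex) \<Rightarrow> (complex \<Rightarrow> 'a::division_ring) \<Rightarrow> 'a \<Rightarrow>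
     nat \<Rightarrow> complex \<Rightarrow> 'a set \<Rightarrow> bool"
  where
  "associated_maximal_order n p \<sigma> S emb u g \<xi> m \<longleftrightarrow>
     (\<exists>(l::int) y.
        [l ^ n = \<sigma>] (mod int p) \<and>
        of_nat p * y = (of_int l - u) * emb (period_product n p g \<xi> ^ (n - 1)) \<and>
        m = {\<Sum>i<n. \<Sum>k<n. of_int (c i k) * (y ^ i * emb ((S ^^ k) (gaussian_period n p g \<xi>)))
             | c :: nat \<Rightarrow> nat \<Rightarrow> int. True})"


section \<open>Sums of squares of matrices\<close>

definition mats_over :: "nat \<Rightarrow> 'a set \<Rightarrow> 'a mat set" where
  "mats_over r m = {C \<in> carrier_mat r r. elements_mat C \<subseteq> m}"

definition sum_of_squares_mat :: "nat \<Rightarrow> 'a::semiring_1 set \<Rightarrow> 'a mat \<Rightarrow> bool" where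
  "sum_of_squares_mat r m C \<longleftrightarrow>
     (\<exists>Xs. set Xs \<subseteq> mats_over r m \<and> C = foldr (\<lambda>X B. X * X + B) Xs (0\<^sub>m r r))"

end

theory Submission
  imports Defs "Berlekamp_Zassenhaus.Factor_Bound"
begin

text \<open>
  An additive subgroup \<open>P\<close> of the order \<open>M\<close> that contains all squares contains \<open>2 M\<close> and all
  commutators. In \<open>M\<^sub>r\<close> for \<open>r \<ge> 2\<close>, the matrices \<open>a E\<^sub>i\<^sub>j\<close> with \<open>i \<noteq> j\<close> are sums of squares, and the
  elements \<open>a\<close> for which both \<open>a E\<^sub>i\<^sub>i\<close> and \<open>- a E\<^sub>i\<^sub>i\<close> are sums of squares form such a group \<open>P\<close>. So it
  suffices to prove \<open>P = M\<close>.

  As \<open>p\<close> is odd, \<open>p x \<in> P\<close> implies \<open>x \<in> P\<close>. Since \<open>p\<^sup>i y\<^sup>i\<close> lies in the sum of the \<open>u\<^sup>j OZ\<close>, where \<open>OZ\<close>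
  is the ring spanned by the Gaussian periods, only the elements \<open>u\<^sup>j z\<close> with \<open>z \<in> OZ\<close> matter. For
  \<open>j = 0\<close>, squaring permutes the periods modulo \<open>2 OZ\<close>. For \<open>0 < j < n\<close>, the commutators
  \<open>[u\<^sup>j z, w] = u\<^sup>j z (w - S\<^sup>j w)\<close> fill \<open>u\<^sup>j J\<close> for the ideal \<open>J\<close> generated by the differences of
  conjugates, and \<open>p \<in> J\<close>.

  That \<open>M\<close> is closed under multiplication is the part of Hull's theorem that is needed. It rests on
  the total ramification of \<open>p\<close> in \<open>Z\<close>: \<open>z - S z\<close> is divisible by \<open>\<beta>\<close> for \<open>z \<in> OZ\<close>, and with
  \<open>\<beta>' = p / \<alpha>\<close> the polynomial \<open>\<Prod>\<^bsub>j<n\<^esub> (S\<^sup>j \<beta>' X - \<lambda>)\<close> is integral, is divisible by \<open>p\<close> up to its constant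
  term, has leading coefficient \<open>p\<close>, and takes the value \<open>-\<sigma>\<close> at \<open>y\<close>.
\<close>

hide_const (open) module.smult comm_monoid_mult_class.coprime Divisibility.prime up_ring.monom up_ring.coeff UnivPoly.deg

section \<open>Prime cyclotomic polynomials\<close>

lemma primitive_root_power_eq_1_iff:
  assumes "is_primitive_root_of_unity m \<xi>"
  shows "\<xi> ^ k = 1 \<longleftrightarrow> m dvd k"
proof -
  have m: "m > 0" "\<xi> ^ m = 1" "\<And>k. 0 < k \<Longrightarrow> k < m \<Longrightarrow> \<xi> ^ k \<noteq> 1"
    using assms unfolding is_primitive_root_of_unity_def by auto
  have "\<xi> ^ k = (\<xi> ^ m) ^ (k div m) * \<xi> ^ (k mod m)"
    by (metis mult_div_mod_eq power_add power_mult)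
  then have "\<xi> ^ k = \<xi> ^ (k mod m)" using m by simp
  then show ?thesis using m(3)[of "k mod m"] m(1) by (cases "k mod m = 0") auto
qed

lemma primitive_root_power_eq_iff:
  assumes "is_primitive_root_of_unity m \<xi>"
  shows "\<xi> ^ i = \<xi> ^ j \<longleftrightarrow> [i = j] (mod m)"
proof -
  have nz: "\<xi> \<noteq> 0" using assms unfolding is_primitive_root_of_unity_def
    by (metis power_0_left zero_neq_one neq0_conv)
  have le: "\<xi> ^ i = \<xi> ^ j \<longleftrightarrow> [i = j] (mod m)" if "i \<le> j" for i j
  proof -
    have "\<xi> ^ j = \<xi> ^ i * \<xi> ^ (j - i)" using that by (simp flip: power_add)
    then have "\<xi> ^ i = \<xi> ^ j \<longleftrightarrow> \<xi> ^ (j - i) = 1" using nz by auto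
    also have "\<dots> \<longleftrightarrow> [j = i] (mod m)"
      using primitive_root_power_eq_1_iff[OF assms] cong_altdef_nat[OF that] by simp
    finally show ?thesis by (simp add: cong_sym_eq)
  qed
  show ?thesis using le[of i j] le[of j i] cong_sym_eq by (metis nat_le_linear)
qed

lemma coprime_prime_less:
  fixes p k :: nat
  assumes "Factorial_Ring.prime p" "0 < k" "k < p"
  shows "coprime k p"
proof -
  have "\<not> p dvd k" using assms nat_dvd_not_less by blast
  then show ?thesis using prime_imp_coprime_nat[OF assms(1)] by (simp add: algebraic_semidom_class.coprime_commute)
qed

text \<open>Primality of \<open>p\<close> makes every smaller positive exponent \<open>k\<close>
  coprime to it, so a Bezout relation turns \<open>z ^ k = 1\<close> into
  \<open>z = 1\<close>.\<close>

lemma primitive_root_of_unity_prime: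
  assumes "Factorial_Ring.prime p" "z ^ p = 1" "z \<noteq> 1"
  shows "is_primitive_root_of_unity p z"
  unfolding is_primitive_root_of_unity_def
proof (intro conjI allI impI)
  show "p > 0" using assms(1) by (simp add: prime_gt_0_nat)
  fix k assume k: "0 < k \<and> k < p"
  show "z ^ k \<noteq> 1"
  proof
    assume zk: "z ^ k = 1"
    have "coprime k p" using k assms(1) coprime_prime_less by blast
    moreover obtain x y where "k * x = p * y + gcd k p" using k bezout_nat[of k p] by blast
    ultimately have "k * x = p * y + 1" by (simp only: coprime_imp_gcd_eq_1)
    then have "(z ^ k) ^ x = (z ^ p) ^ y * z" by (simp flip: power_mult)
    then show False using zk assms by simp
  qed
qed (use assms in auto)

lemma primitive_root_power:
  assumes "Factorial_Ring.prime p" "is_primitive_root_of_unity p \<xi>" "\<not> p dvd a"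
  shows "is_primitive_root_of_unity p (\<xi> ^ a)"
proof (rule primitive_root_of_unity_prime[OF assms(1)])
  show "(\<xi> ^ a) ^ p = 1" using primitive_root_power_eq_1_iff[OF assms(2)]
    by (simp flip: power_mult)
  show "\<xi> ^ a \<noteq> 1" using primitive_root_power_eq_1_iff[OF assms(2)] assms(3) by simp
qed

text \<open>Orthogonality of characters, from a geometric sum; it filters out the coefficients of a
  polynomial at exponents divisible by \<open>m\<close>.\<close>

lemma sum_powers_primitive_root:
  assumes "is_primitive_root_of_unity m \<xi>"
  shows "(\<Sum>b<m. (\<xi> ^ b) ^ i) = (if m dvd i then of_nat m else 0)"
proof (cases "m dvd i")
  case True
  then have "\<xi> ^ i = 1" using primitive_root_power_eq_1_iff[OF assms] by simp
  then have "(\<xi> ^ b) ^ i = 1" for b by (metis power_mult mult.commute power_one)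
  then show ?thesis using True by simp
next
  case False
  then have ne: "\<xi> ^ i \<noteq> 1" using primitive_root_power_eq_1_iff[OF assms] by simp
  have "(\<xi> ^ i) ^ m = 1" using primitive_root_power_eq_1_iff[OF assms] by (simp flip: power_mult)
  then have "(\<Sum>b<m. (\<xi> ^ i) ^ b) = 0" using geometric_sum[OF ne, of m] by simp
  then show ?thesis using False by (simp flip: power_mult add: mult.commute)
qed

text \<open>Summing \<open>\<Prod>\<^bsub>0<a<p\<^esub> f(X\<^sup>a)\<close> over all \<open>p\<close>-th roots of unity gives a multiple of \<open>p\<close>, and every
  summand except \<open>f(1)\<^sup>p\<^sup>-\<^sup>1\<close> vanishes.\<close>

lemma prime_dvd_poly_1:
  fixes f :: "int poly"
  assumes p: "Factorial_Ring.prime p" and xi: "is_primitive_root_of_unity p \<xi>"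
    and f: "poly (of_int_poly f) \<xi> = 0"
  shows "int p dvd poly f 1"
proof -
  define G where "G = (\<Prod>a\<in>{1..<p}. pcompose f (monom 1 a))"
  have G: "poly (of_int_poly G) z = (\<Prod>a\<in>{1..<p}. poly (of_int_poly f) (z ^ a))" for z :: complex
    unfolding G_def
    by (simp add: of_int_poly_hom.hom_prod poly_prod of_int_hom.map_poly_pcompose poly_pcompose poly_monom)
  have zero: "poly (of_int_poly G) (\<xi> ^ b) = 0" if b: "b \<in> {1..<p}" for b
  proof -
    \<comment> \<open>Some \<open>a\<close> below \<open>p\<close> is inverse to \<open>b\<close>
      modulo \<open>p\<close>, and the factor of \<open>G\<close> with that index takes the value of
      \<open>f\<close> at \<xi>, namely 0.\<close>
    have "coprime b p" using b p coprime_prime_less by auto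
    from cong_solve_coprime_nat[OF this] obtain a0 where a0: "[b * a0 = 1] (mod p)" by (auto simp: cong_def)
    define a where "a = a0 mod p"
    have ba: "[b * a = 1] (mod p)" using a0 unfolding a_def cong_def by (simp add: mod_simps)
    have "a \<noteq> 0" using ba p by (intro notI) (auto simp: cong_def prime_gt_1_nat)
    moreover have "a < p" using p unfolding a_def by (simp add: prime_gt_0_nat)
    ultimately have a: "a \<in> {1..<p}" by auto
    have "(\<xi> ^ b) ^ a = \<xi> ^ 1"
      using ba primitive_root_power_eq_iff[OF xi] by (simp only: flip: power_mult)
    then show ?thesis unfolding G using f a by (intro prod_zero bexI[of _ a]) auto
  qed
  define s where "s = (\<Sum>i\<le>degree G. if p dvd i then coeff G i else 0)"
  have p0: "p > 0" using p by (simp add: prime_gt_0_nat)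
  have "(\<Sum>b<p. poly (of_int_poly G) (\<xi> ^ b)) = 
      (\<Sum>b<p. \<Sum>i\<le>degree G. of_int (coeff G i) * (\<xi> ^ b) ^ i)"
    by (simp add: poly_altdef)
  also have "\<dots> = (\<Sum>i\<le>degree G. of_int (coeff G i) * (\<Sum>b<p. (\<xi> ^ b) ^ i))"
    by (subst sum.swap) (simp only: sum_distrib_left)
  also have "\<dots> = (\<Sum>i\<le>degree G. of_int (int p * (if p dvd i then coeff G i else 0)))"
    by (intro sum.cong refl) (simp add: sum_powers_primitive_root[OF xi])
  also have "\<dots> = of_int (int p * s)"
    unfolding s_def sum_distrib_left of_int_sum ..
  finally have "(\<Sum>b<p. poly (of_int_poly G) (\<xi> ^ b)) = of_int (int p * s)" .
  moreover have "{..<p} = insert 0 {1..<p}" using p0 by auto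
  ultimately have "poly (of_int_poly G) 1 + (\<Sum>b\<in>{1..<p}. poly (of_int_poly G) (\<xi> ^ b)) = of_int (int p * s)"
    by simp
  then have "poly (of_int_poly G) (1::complex) = of_int (int p * s)" using zero by simp
  then have "of_int (poly f 1 ^ (p - 1)) = (of_int (int p * s) :: complex)"
    unfolding G by simp
  then have "poly f 1 ^ (p - 1) = int p * s" by (simp only: of_int_eq_iff)
  then have "int p dvd poly f 1 ^ (p - 1)" by simp
  moreover have "Factorial_Ring.prime (int p)" using p by simp
  ultimately show ?thesis by (rule prime_dvd_power[rotated])
qed

text \<open>For prime \<open>p\<close> this is the \<open>p\<close>-th cyclotomic polynomial
  \<open>(X^p - 1) / (X - 1)\<close>. The explicit sum shows its value \<open>p\<close> at 1, on
  which irreducibility rests.\<close>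

definition Phi :: "nat \<Rightarrow> int poly" where
  "Phi p = (\<Sum>i<p. monom 1 i)"

lemma poly_Phi: "poly (of_int_poly (Phi p)) (z :: 'a :: comm_ring_1) = (\<Sum>i<p. z ^ i)"
  by (simp add: Phi_def of_int_poly_hom.hom_sum poly_sum poly_monom)

lemma poly_Phi_1: "poly (Phi p) 1 = int p"
  by (simp add: Phi_def poly_sum poly_monom)

lemma coeff_Phi: "coeff (Phi p) i = (if i < p then 1 else 0)"
  by (simp add: Phi_def coeff_sum)

lemma degree_Phi: "p > 0 \<Longrightarrow> degree (Phi p) = p - 1"
  by (intro antisym degree_le le_degree) (auto simp: coeff_Phi)

lemma Phi_root_iff:
  assumes "Factorial_Ring.prime p"
  shows "poly (of_int_poly (Phi p)) z = 0 \<longleftrightarrow> is_primitive_root_of_unity p z"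
proof
  assume z: "poly (of_int_poly (Phi p)) z = 0"
  have "z \<noteq> 1"
  proof
    assume "z = 1"
    then have "of_nat p = (0::complex)" using z by (simp add: poly_Phi_1)
    then show False using assms by simp
  qed
  moreover from this have "z ^ p = 1"
    using z geometric_sum[of z p] by (simp add: poly_Phi)
  ultimately show "is_primitive_root_of_unity p z"
    using primitive_root_of_unity_prime assms by blast
next
  assume z: "is_primitive_root_of_unity p z"
  then have "z \<noteq> 1" using assms prime_gt_1_nat[of p] primitive_root_power_eq_1_iff[OF z, of 1] by simp
  moreover have "z ^ p = 1" using z by (simp add: is_primitive_root_of_unity_def)
  ultimately show "poly (of_int_poly (Phi p)) z = 0"
    using geometric_sum[of z p] by (simp add: poly_Phi)
qed

text \<open>Each nonconstant factor has a primitive root of unity as a complex root, so its value at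
  1 is a multiple of \<open>p\<close>; two such factors would make \<open>p^2\<close> divide the
  value \<open>p\<close> of \<open>Phi p\<close> at 1.\<close>

lemma irreducible_Phi:
  assumes p: "Factorial_Ring.prime p" and gh: "Phi p = g * h" "degree g > 0"
  shows "degree h = 0"
proof (rule ccontr)
  assume "degree h \<noteq> 0"
  have dvd: "int p dvd poly q 1" if q: "q dvd Phi p" "degree q > 0" for q
  proof -
    obtain z :: complex where z: "poly (of_int_poly q) z = 0"
      using q fundamental_theorem_of_algebra[of "of_int_poly q :: complex poly"]
      by (auto simp: constant_degree)
    obtain r where "Phi p = q * r" using q by auto
    then have "poly (of_int_poly (Phi p)) z = 0" using z by (simp add: of_int_poly_hom.hom_mult)
    then have "is_primitive_root_of_unity p z" using Phi_root_iff[OF p] by simp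
    from prime_dvd_poly_1[OF p this z] show ?thesis .
  qed
  have "int p * int p dvd poly g 1 * poly h 1"
    using dvd[of g] dvd[of h] gh \<open>degree h \<noteq> 0\<close> by (intro mult_dvd_mono) auto
  also have "poly g 1 * poly h 1 = int p * 1" using gh(1) poly_Phi_1[of p] by (metis poly_mult mult_1_right)
  finally have "int p dvd 1" using p by (simp del: of_nat_mult add: prime_gt_0_nat)
  then show False using p by (auto simp: prime_gt_1_nat)
qed

text \<open>Gauss's lemma carries a rational factorisation to an integral one with the same
  degrees.\<close>

lemma irreducible_Phi_rat:
  fixes g h :: "rat poly"
  assumes p: "Factorial_Ring.prime p" and gh: "of_int_poly (Phi p) = g * h" "degree g > 0"
  shows "degree h = 0"
proof -
  from rat_to_int_factor[OF gh(1)] obtain g' h'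
    where "Phi p = g' * h'" "degree g' = degree g" "degree h' = degree h" by blast
  then show ?thesis using irreducible_Phi[OF p, of g' h'] gh by simp
qed

interpretation of_rat_poly_hom: map_poly_idom_hom "of_rat :: rat \<Rightarrow> complex" ..

abbreviation qeval :: "rat poly \<Rightarrow> complex \<Rightarrow> complex" where
  "qeval f z \<equiv> poly (map_poly of_rat f) z"

lemma qeval_of_int_poly: "qeval (of_int_poly f) z = poly (of_int_poly f) z"
  by (simp add: map_poly_map_poly o_def)

lemma Phi_bezout:
  fixes f :: "rat poly"
  assumes p: "Factorial_Ring.prime p" and xi: "is_primitive_root_of_unity p \<xi>"
    and f: "\<not> of_int_poly (Phi p) dvd f"
  shows "\<exists>a b. a * of_int_poly (Phi p) + b * f = 1"
proof -
  let ?P = "of_int_poly (Phi p) :: rat poly"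
  define d where "d = gcd ?P f"
  obtain a b where ab: "a * ?P + b * f = d" unfolding d_def using bezout_coefficients_fst_snd by blast
  have "d dvd ?P" "d dvd f" unfolding d_def by auto
  then obtain h where h: "?P = d * h" by auto
  have "Phi p \<noteq> 0" using coeff_Phi[of p 0] prime_gt_0_nat[OF p] by auto
  then have P0: "?P \<noteq> 0" by simp
  have deg_d: "degree d = 0"
  proof (rule ccontr)
    assume "degree d \<noteq> 0"
    then have "degree h = 0" using irreducible_Phi_rat[OF p h] by simp
    moreover have "h \<noteq> 0" using h P0 by auto
    ultimately have "is_unit h" by (simp add: is_unit_iff_degree)
    then obtain k where k: "1 = h * k" unfolding dvd_def by blast
    obtain l where l: "f = d * l" using \<open>d dvd f\<close> unfolding dvd_def by blast
    have "d * h * (k * l) = d * (h * k) * l" by (simp only: ac_simps)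
    then have "f = ?P * (k * l)" unfolding h l by (simp flip: k)
    then show False using f unfolding dvd_def by blast
  qed
  have "d \<noteq> 0" using P0 d_def by simp
  moreover obtain c where c: "d = [:c:]" using deg_d by (rule degree_eq_zeroE)
  ultimately have c0: "c \<noteq> 0" by simp
  have "smult (inverse c) a * ?P + smult (inverse c) b * f = smult (inverse c) d"
    unfolding ab[symmetric] by (simp only: smult_add_right mult_smult_left)
  also have "\<dots> = 1" unfolding c one_pCons using c0 by simp
  finally show ?thesis by blast
qed

text \<open>\<open>Phi p\<close> is the minimal polynomial of every primitive \<open>p\<close>-th
  root of unity. The right-hand side does not mention \<xi>, so a rational polynomial vanishing at
  one primitive root vanishes at all of them.\<close>

lemma Phi_dvd_iff:
  assumes p: "Factorial_Ring.prime p" and xi: "is_primitive_root_of_unity p \<xi>"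
  shows "qeval f \<xi> = 0 \<longleftrightarrow> of_int_poly (Phi p) dvd f"
proof -
  have P: "qeval (of_int_poly (Phi p)) \<xi> = 0"
    using Phi_root_iff[OF p] xi by (simp add: qeval_of_int_poly)
  have "qeval f \<xi> = 0" if dvd: "of_int_poly (Phi p) dvd f"
  proof -
    obtain k where "f = of_int_poly (Phi p) * k" using dvd unfolding dvd_def by blast
    then have "qeval f \<xi> = qeval (of_int_poly (Phi p)) \<xi> * qeval k \<xi>"
      by (simp only: of_rat_poly_hom.hom_mult poly_mult)
    then show ?thesis unfolding P by simp
  qed
  moreover have "of_int_poly (Phi p) dvd f" if f: "qeval f \<xi> = 0"
  proof (rule ccontr)
    assume "\<not> of_int_poly (Phi p) dvd f"
    from Phi_bezout[OF p xi this] obtain a b where ab: "a * of_int_poly (Phi p) + b * f = 1" by blast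
    have "qeval (a * of_int_poly (Phi p) + b * f) \<xi> = 0"
      by (simp only: of_rat_poly_hom.hom_mult of_rat_poly_hom.hom_add poly_add poly_mult f P) simp
    then show False unfolding ab by simp
  qed
  ultimately show ?thesis by blast
qed

section \<open>Gaussian periods\<close>

lemma sum_shift_periodic:
  fixes f :: "nat \<Rightarrow> 'a::ab_group_add"
  assumes "\<And>k. f (k + q) = f k"
  shows "(\<Sum>k<q. f (k + j)) = (\<Sum>k<q. f k)"
proof (induction j)
  case (Suc j)
  have "(\<Sum>k<q. f (Suc k + j)) + f j = (\<Sum>k<Suc q. f (k + j))"
    unfolding sum.lessThan_Suc_shift by (simp add: add.commute)
  also have "\<dots> = (\<Sum>k<q. f (k + j)) + f j"
    using assms[of j] by (simp add: add.commute)
  finally show ?case using Suc by simp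
qed simp

lemma prod_shift_periodic:
  fixes f :: "nat \<Rightarrow> 'a::comm_monoid_mult"
  assumes "\<And>k. f (k + q) = f k"
  shows "(\<Prod>k<q. f (k + j)) = (\<Prod>k<q. f k)"
proof (induction j)
  case (Suc j)
  have "(\<Prod>k<q. f (k + Suc j)) = (\<Prod>k<q. f (k + j))"
  proof (cases q)
    case q: (Suc q')
    have "(\<Prod>k<q. f (k + j)) = f j * (\<Prod>k<q'. f (Suc k + j))"
      unfolding q prod.lessThan_Suc_shift by simp
    also have "f j = f (q' + Suc j)" using assms[of j] q by (simp add: add.commute)
    also have "\<dots> * (\<Prod>k<q'. f (Suc k + j)) = (\<Prod>k<q. f (k + Suc j))"
      unfolding q by (simp add: mult.commute)
    finally show ?thesis by simp
  qed simp
  then show ?case using Suc by simp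
qed simp

lemma sum_periodic_blocks:
  fixes f :: "nat \<Rightarrow> 'a::comm_monoid_add"
  shows "(\<Sum>k<n * h. f k) = (\<Sum>i<n. \<Sum>r<h. f (i + n * r))"
proof -
  have block: "(\<Sum>k\<in>{r * n..<r * n + n}. f k) = (\<Sum>i<n. f (i + n * r))" for r
    using sum.shift_bounds_nat_ivl[of f 0 "r * n" n]
    by (simp add: atLeast0LessThan add.commute mult.commute)
  have "(\<Sum>k<h * n. f k) = (\<Sum>r<h. \<Sum>k\<in>{r * n..<r * n + n}. f k)"
    by (rule sum.nat_group[symmetric])
  also have "\<dots> = (\<Sum>r<h. \<Sum>i<n. f (i + n * r))" by (simp only: block)
  also have "\<dots> = (\<Sum>i<n. \<Sum>r<h. f (i + n * r))" by (rule sum.swap)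
  finally show ?thesis by (simp add: mult.commute)
qed

lemma prod_periodic_blocks:
  fixes f :: "nat \<Rightarrow> 'a::comm_monoid_mult"
  shows "(\<Prod>k<n * h. f k) = (\<Prod>i<n. \<Prod>r<h. f (i + n * r))"
proof -
  have block: "(\<Prod>k\<in>{r * n..<r * n + n}. f k) = (\<Prod>i<n. f (i + n * r))" for r
    using prod.shift_bounds_nat_ivl[of f 0 "r * n" n]
    by (simp add: atLeast0LessThan add.commute mult.commute)
  have "(\<Prod>k<h * n. f k) = (\<Prod>r<h. \<Prod>k\<in>{r * n..<r * n + n}. f k)"
    by (rule prod.nat_group[symmetric])
  also have "\<dots> = (\<Prod>r<h. \<Prod>i<n. f (i + n * r))" by (simp only: block)
  also have "\<dots> = (\<Prod>i<n. \<Prod>r<h. f (i + n * r))" by (rule prod.swap)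
  finally show ?thesis by (simp add: mult.commute)
qed

text \<open>The cross terms \<open>a r * a t\<close> and \<open>a t * a r\<close> coincide, so
  modulo 2 only the squares remain.\<close>

lemma square_sum:
  fixes a :: "nat \<Rightarrow> 'a::comm_ring_1"
  shows "(\<Sum>r<h. a r)\<^sup>2 = (\<Sum>r<h. (a r)\<^sup>2) + 2 * (\<Sum>t<h. \<Sum>r<t. a r * a t)"
proof (induction h)
  case (Suc h)
  have "(\<Sum>r<Suc h. a r)\<^sup>2 = (\<Sum>r<h. a r)\<^sup>2 + (a h)\<^sup>2 + 2 * ((\<Sum>r<h. a r) * a h)"
    by (simp add: power2_sum algebra_simps)
  then show ?case unfolding Suc
    by (simp only: sum.lessThan_Suc sum_distrib_right[of a _ "a h"]) (simp add: algebra_simps)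
qed simp

section \<open>The cyclotomic field and its Galois action\<close>

locale gaussian_periods =
  fixes p g n :: nat and \<xi> :: complex
  assumes prime_p: "Factorial_Ring.prime p" and root: "is_primitive_root_of_unity p \<xi>"
    and primroot: "residue_primroot p g"
    and n_dvd: "n dvd p - 1"
begin

definition h :: nat where "h = (p - 1) div n"

lemma nh: "n * h = p - 1" unfolding h_def using n_dvd by simp

lemma p_gt_1: "p > 1" using prime_p by (rule prime_gt_1_nat)

lemma nh_pos: "n > 0" "h > 0" using nh p_gt_1 by (auto intro: ccontr)

lemma g_bij: "bij_betw (\<lambda>k. g ^ k mod p) {..<p - 1} {1..<p}"
proof -
  have "bij_betw (\<lambda>k. g ^ k mod p) {..<totient p} (totatives p)"
    using residue_primroot_is_generator[OF p_gt_1 primroot] .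
  moreover have "totient p = p - 1" using prime_p by (simp add: totient_prime)
  moreover have "totatives p = {1..<p}"
    using prime_p by (simp only: totatives_prime) auto
  ultimately show ?thesis by simp
qed

lemma not_dvd_g_power: "\<not> p dvd g ^ k"
proof -
  have "coprime p g" using primroot by (simp add: residue_primroot_def)
  then have "coprime p (g ^ k)" by simp
  then show ?thesis using p_gt_1 by (metis coprime_absorb_left nat_neq_iff is_unit_gcd nat_dvd_1_iff_1)
qed

lemma g_power_eq_iff: "[g ^ i = g ^ j] (mod p) \<longleftrightarrow> [i = j] (mod (p - 1))"
proof -
  have "totient p = p - 1" using prime_p by (simp add: totient_prime)
  moreover have "ord p g = totient p" "coprime p g" using primroot by (auto simp: residue_primroot_def)
  ultimately show ?thesis using order_divides_expdiff[of p g i j] by simp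
qed

lemma g_power_surj: "\<not> p dvd i \<Longrightarrow> \<exists>k<p - 1. [g ^ k = i] (mod p)"
proof -
  assume "\<not> p dvd i"
  then have "i mod p \<in> {1..<p}" using p_gt_1 by (auto simp: dvd_eq_mod_eq_0 Suc_le_eq)
  then have "i mod p \<in> (\<lambda>k. g ^ k mod p) ` {..<p - 1}" using g_bij by (simp only: bij_betw_def)
  then show ?thesis by (auto simp: cong_def)
qed

text \<open>\<open>K\<close> and \<open>ZX\<close> are Q(\<xi>) and Z[\<xi>], taken as images of
  polynomial evaluation so that statements about elements can be proved on polynomials.\<close>

definition K :: "complex set" where "K = range (\<lambda>f. qeval f \<xi>)"

definition ZX :: "complex set" where "ZX = range (\<lambda>f. poly (of_int_poly f) \<xi>)"

text \<open>The automorphism of Q(\<xi>) that raises \<xi> to the power \<open>g ^ k\<close>. The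
  chosen polynomial represents \<open>x\<close>; \<open>gal_qeval\<close> shows that the choice does
  not matter.\<close>

definition gal :: "nat \<Rightarrow> complex \<Rightarrow> complex" where
  "gal k x = qeval (SOME f. qeval f \<xi> = x) (\<xi> ^ (g ^ k))"

text \<open>Numbering the conjugates of \<xi> by the exponent of \<open>g\<close> makes the Galois
  action additive in the index, see \<open>gal_e\<close>.\<close>

definition e :: "nat \<Rightarrow> complex" where "e k = \<xi> ^ (g ^ k)"

lemma e_root: "is_primitive_root_of_unity p (e k)"
  unfolding e_def by (rule primitive_root_power[OF prime_p root not_dvd_g_power])

text \<open>Two polynomials with the same value at \<xi> differ by a multiple of
  \<open>Phi p\<close>, which also vanishes at the conjugate \<open>e k\<close>.\<close>

lemma gal_qeval: "gal k (qeval f \<xi>) = qeval f (e k)"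
proof -
  define f' where "f' = (SOME f'. qeval f' \<xi> = qeval f \<xi>)"
  have "qeval f' \<xi> = qeval f \<xi>" unfolding f'_def by (rule someI) simp
  then have "qeval (f' - f) \<xi> = 0" by (simp only: of_rat_poly_hom.hom_minus poly_diff) simp
  then have "of_int_poly (Phi p) dvd f' - f" using Phi_dvd_iff[OF prime_p root] by blast
  then have "qeval (f' - f) (e k) = 0" using Phi_dvd_iff[OF prime_p e_root] by blast
  then have "qeval f' (e k) = qeval f (e k)" by (simp only: of_rat_poly_hom.hom_minus poly_diff) simp
  then show ?thesis unfolding gal_def f'_def e_def .
qed

lemma gal_ieval: "gal k (poly (of_int_poly f) \<xi>) = poly (of_int_poly f) (e k)"
  using gal_qeval[of k "of_int_poly f"] by (simp only: qeval_of_int_poly)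

lemma ZX_K: "x \<in> ZX \<Longrightarrow> x \<in> K"
proof -
  assume "x \<in> ZX"
  then obtain f where "x = poly (of_int_poly f) \<xi>" unfolding ZX_def by auto
  then have "x = qeval (of_int_poly f) \<xi>" by (simp only: qeval_of_int_poly)
  then show ?thesis unfolding K_def by blast
qed

lemma K_cases: assumes "x \<in> K" obtains f where "x = qeval f \<xi>"
  using assms unfolding K_def by auto

lemma ZX_cases: assumes "x \<in> ZX" obtains f where "x = poly (of_int_poly f) \<xi>"
  using assms unfolding ZX_def by auto

lemma K_I: "qeval f \<xi> \<in> K" unfolding K_def by auto

lemma ZX_I: "poly (of_int_poly f) \<xi> \<in> ZX" unfolding ZX_def by auto

lemma K_add: assumes "x \<in> K" "y \<in> K" shows "x + y \<in> K"
proof -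
  obtain f f' where "x = qeval f \<xi>" "y = qeval f' \<xi>"
    using K_cases[OF assms(1)] K_cases[OF assms(2)] by metis
  then have "x + y = qeval (f + f') \<xi>"
    by (simp only: of_rat_poly_hom.hom_add poly_add)
  then show ?thesis by (simp only: K_I)
qed

lemma K_diff: assumes "x \<in> K" "y \<in> K" shows "x - y \<in> K"
proof -
  obtain f f' where "x = qeval f \<xi>" "y = qeval f' \<xi>"
    using K_cases[OF assms(1)] K_cases[OF assms(2)] by metis
  then have "x - y = qeval (f - f') \<xi>"
    by (simp only: of_rat_poly_hom.hom_minus poly_diff)
  then show ?thesis by (simp only: K_I)
qed

lemma K_mult: assumes "x \<in> K" "y \<in> K" shows "x * y \<in> K"
proof -
  obtain f f' where "x = qeval f \<xi>" "y = qeval f' \<xi>"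
    using K_cases[OF assms(1)] K_cases[OF assms(2)] by metis
  then have "x * y = qeval (f * f') \<xi>"
    by (simp only: of_rat_poly_hom.hom_mult poly_mult)
  then show ?thesis by (simp only: K_I)
qed

lemma ZX_add: assumes "x \<in> ZX" "y \<in> ZX" shows "x + y \<in> ZX"
proof -
  obtain f f' where "x = poly (of_int_poly f) \<xi>" "y = poly (of_int_poly f') \<xi>"
    using ZX_cases[OF assms(1)] ZX_cases[OF assms(2)] by metis
  then have "x + y = poly (of_int_poly (f + f')) \<xi>"
    by (simp only: of_int_poly_hom.hom_add poly_add)
  then show ?thesis by (simp only: ZX_I)
qed

lemma ZX_diff: assumes "x \<in> ZX" "y \<in> ZX" shows "x - y \<in> ZX"
proof -
  obtain f f' where "x = poly (of_int_poly f) \<xi>" "y = poly (of_int_poly f') \<xi>"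
    using ZX_cases[OF assms(1)] ZX_cases[OF assms(2)] by metis
  then have "x - y = poly (of_int_poly (f - f')) \<xi>"
    by (simp only: of_int_poly_hom.hom_minus poly_diff)
  then show ?thesis by (simp only: ZX_I)
qed

lemma ZX_mult: assumes "x \<in> ZX" "y \<in> ZX" shows "x * y \<in> ZX"
proof -
  obtain f f' where "x = poly (of_int_poly f) \<xi>" "y = poly (of_int_poly f') \<xi>"
    using ZX_cases[OF assms(1)] ZX_cases[OF assms(2)] by metis
  then have "x * y = poly (of_int_poly (f * f')) \<xi>"
    by (simp only: of_int_poly_hom.hom_mult poly_mult)
  then show ?thesis by (simp only: ZX_I)
qed

lemma gal_add: assumes "x \<in> K" "y \<in> K" shows "gal k (x + y) = gal k x + gal k y"
proof -
  obtain f f' where f: "x = qeval f \<xi>" "y = qeval f' \<xi>" using K_cases[OF assms(1)] K_cases[OF assms(2)] by metis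
  have "x + y = qeval (f + f') \<xi>" by (simp only: f of_rat_poly_hom.hom_add poly_add)
  then have "gal k (x + y) = qeval (f + f') (e k)" by (simp only: gal_qeval)
  also have "\<dots> = gal k x + gal k y" by (simp only: f gal_qeval of_rat_poly_hom.hom_add poly_add)
  finally show ?thesis .
qed

lemma gal_diff: "x \<in> K \<Longrightarrow> y \<in> K \<Longrightarrow> gal k (x - y) = gal k x - gal k y"
  using gal_add[of "x - y" y k] K_diff by simp

lemma gal_mult: assumes "x \<in> K" "y \<in> K" shows "gal k (x * y) = gal k x * gal k y"
proof -
  obtain f f' where f: "x = qeval f \<xi>" "y = qeval f' \<xi>" using K_cases[OF assms(1)] K_cases[OF assms(2)] by metis
  have "x * y = qeval (f * f') \<xi>" by (simp only: f of_rat_poly_hom.hom_mult poly_mult)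
  then have "gal k (x * y) = qeval (f * f') (e k)" by (simp only: gal_qeval)
  also have "\<dots> = gal k x * gal k y" by (simp only: f gal_qeval of_rat_poly_hom.hom_mult poly_mult)
  finally show ?thesis .
qed

lemma rat_K: "of_rat r \<in> K" and gal_rat: "gal k (of_rat r) = of_rat r"
proof -
  show "of_rat r \<in> K" using K_I[of "[:r:]"] by (simp add: of_rat_hom.map_poly_pCons_hom)
  show "gal k (of_rat r) = of_rat r" using gal_qeval[of k "[:r:]"] by (simp add: of_rat_hom.map_poly_pCons_hom)
qed

lemma int_ZX: "of_int i \<in> ZX"
  using ZX_I[of "[:i:]"] by (simp add: of_int_hom.map_poly_pCons_hom)

lemma gal_int: "gal k (of_int i) = of_int i"
  using gal_rat[of k "of_int i"] by simp

lemma ZX_0: "0 \<in> ZX" and ZX_1: "1 \<in> ZX" using int_ZX[of 0] int_ZX[of 1] by auto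

lemma xi_ZX: "\<xi> \<in> ZX" using ZX_I[of "[:0, 1:]"] by simp

lemma ZX_power: "x \<in> ZX \<Longrightarrow> x ^ k \<in> ZX"
  by (induction k) (auto intro: ZX_1 ZX_mult)

lemma ZX_sum: "(\<And>i. i \<in> A \<Longrightarrow> f i \<in> ZX) \<Longrightarrow> sum f A \<in> ZX"
  by (induction A rule: infinite_finite_induct) (auto intro: ZX_0 ZX_add)

lemma ZX_prod: "(\<And>i. i \<in> A \<Longrightarrow> f i \<in> ZX) \<Longrightarrow> prod f A \<in> ZX"
  by (induction A rule: infinite_finite_induct) (auto intro: ZX_1 ZX_mult)

lemma K_sum: "(\<And>i. i \<in> A \<Longrightarrow> f i \<in> K) \<Longrightarrow> sum f A \<in> K"
  by (induction A rule: infinite_finite_induct) (auto intro: ZX_K ZX_0 K_add)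

lemma gal_sum: "(\<And>i. i \<in> A \<Longrightarrow> f i \<in> K) \<Longrightarrow> gal k (sum f A) = (\<Sum>i\<in>A. gal k (f i))"
  using gal_int[of k 0]
  by (induction A rule: infinite_finite_induct) (auto simp: gal_add K_sum)

lemma K_prod: "(\<And>i. i \<in> A \<Longrightarrow> f i \<in> K) \<Longrightarrow> prod f A \<in> K"
  by (induction A rule: infinite_finite_induct) (auto intro: ZX_K ZX_1 K_mult)

lemma gal_prod: "(\<And>i. i \<in> A \<Longrightarrow> f i \<in> K) \<Longrightarrow> gal k (prod f A) = (\<Prod>i\<in>A. gal k (f i))"
  using gal_int[of k 1]
  by (induction A rule: infinite_finite_induct) (auto simp: gal_mult K_prod)

lemma gal_power: "x \<in> K \<Longrightarrow> gal k (x ^ i) = gal k x ^ i"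
  using gal_prod[of "{..<i}" "\<lambda>_. x" k] by simp

lemma e_ZX: "e k \<in> ZX" unfolding e_def by (rule ZX_power[OF xi_ZX])

lemma e_0: "e 0 = \<xi>" by (simp add: e_def)

lemma gal_e: "gal j (e k) = e (j + k)"
proof -
  have xi: "gal j \<xi> = e j" using gal_ieval[of j "[:0, 1:]"] by simp
  have "gal j (e k) = e j ^ (g ^ k)" using gal_power[OF ZX_K[OF xi_ZX]] xi by (simp add: e_def)
  then show ?thesis by (simp add: e_def power_add flip: power_mult)
qed

lemma gal_ZX: "x \<in> ZX \<Longrightarrow> gal k x \<in> ZX"
proof (elim ZX_cases)
  fix f assume "x = poly (of_int_poly f) \<xi>"
  then have "gal k x = poly (of_int_poly (pcompose f (monom 1 (g ^ k)))) \<xi>"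
    by (simp add: gal_ieval of_int_hom.map_poly_pcompose poly_pcompose poly_monom e_def)
  then show ?thesis by (simp only: ZX_I)
qed

lemma gal_gal: "x \<in> K \<Longrightarrow> gal i (gal j x) = gal (i + j) x"
proof (elim K_cases)
  fix f assume x: "x = qeval f \<xi>"
  then have "gal j x = qeval (pcompose f (monom 1 (g ^ j))) \<xi>"
    by (simp add: gal_qeval of_rat_hom.map_poly_pcompose poly_pcompose poly_monom e_def)
  then have "gal i (gal j x) = qeval (pcompose f (monom 1 (g ^ j))) (e i)" by (simp only: gal_qeval)
  also have "\<dots> = qeval f (e (i + j))"
    by (simp add: of_rat_hom.map_poly_pcompose poly_pcompose poly_monom e_def power_add power_mult)
  finally show ?thesis using x by (simp only: gal_qeval)
qed

lemma gal_0: "x \<in> K \<Longrightarrow> gal 0 x = x"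
  by (elim K_cases) (simp only: gal_qeval e_0)

lemma e_cong: "[i = j] (mod (p - 1)) \<Longrightarrow> e i = e j"
  unfolding e_def primitive_root_power_eq_iff[OF root] g_power_eq_iff .

lemma e_period: "e (k + (p - 1)) = e k"
  by (rule e_cong) (simp add: cong_def)

lemma gal_cong: "x \<in> K \<Longrightarrow> [i = j] (mod (p - 1)) \<Longrightarrow> gal i x = gal j x"
  by (elim K_cases) (simp only: gal_qeval e_cong)

lemma gal_inj: "x \<in> K \<Longrightarrow> y \<in> K \<Longrightarrow> gal k x = gal k y \<Longrightarrow> x = y"
proof -
  assume xy: "x \<in> K" "y \<in> K" "gal k x = gal k y"
  \<comment> \<open>Indices are natural numbers counted modulo \<open>p - 1\<close>, so
    \<open>k * (p - 2)\<close> stands for \<open>- k\<close>, and \<open>gal\<close> at this index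
    inverts \<open>gal k\<close>.\<close>
  have "[k * (p - 2) + k = 0] (mod (p - 1))"
  proof -
    have "p - 1 = Suc (p - 2)" using p_gt_1 by simp
    then have "k * (p - 2) + k = (p - 1) * k" by (simp only: mult_Suc mult_Suc_right ac_simps)
    then show ?thesis by (simp add: cong_0_iff)
  qed
  then have "gal (k * (p - 2)) (gal k z) = z" if "z \<in> K" for z
    using that gal_cong gal_0 by (simp add: gal_gal)
  then show ?thesis using xy by metis
qed

lemma inverse_K: "x \<in> K \<Longrightarrow> inverse x \<in> K"
proof (cases "x = 0")
  case True then show ?thesis using ZX_K[OF ZX_0] by simp
next
  case False
  assume "x \<in> K"
  then obtain f where f: "x = qeval f \<xi>" by (rule K_cases)
  then have "\<not> of_int_poly (Phi p) dvd f" using False Phi_dvd_iff[OF prime_p root] by blast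
  from Phi_bezout[OF prime_p root this] obtain a b where ab: "a * of_int_poly (Phi p) + b * f = 1" by blast
  have P: "qeval (of_int_poly (Phi p)) \<xi> = 0"
    using Phi_root_iff[OF prime_p] root by (simp only: qeval_of_int_poly)
  have "qeval (a * of_int_poly (Phi p) + b * f) \<xi> = qeval b \<xi> * x"
    by (simp only: of_rat_poly_hom.hom_mult of_rat_poly_hom.hom_add poly_add poly_mult P f) simp
  then have "1 = qeval b \<xi> * x" by (simp only: ab of_rat_poly_hom.hom_one) simp
  then have "inverse x = qeval b \<xi>" using False by (simp add: field_simps)
  then show ?thesis by (simp only: K_I)
qed

lemma complex_subfield_K: "complex_subfield K"
  unfolding complex_subfield_def
  using ZX_K[OF ZX_0] ZX_K[OF ZX_1] by (auto intro: K_add K_diff K_mult inverse_K)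

text \<open>The powers of \<xi> already exhaust the \<open>p\<close> solutions of
  \<open>x ^ p = 1\<close>, so the standard root of unity is among them.\<close>

lemma cyclotomic_subfield_K: "cyclotomic_subfield p \<subseteq> K"
proof -
  define z where "z = cis (2 * pi / real p)"
  have "real p * (2 * pi / real p) = 2 * pi" using p_gt_1 by simp
  then have zp: "z ^ p = 1" unfolding z_def by (simp only: Complex.DeMoivre cis_2pi)
  have "(\<lambda>i. \<xi> ^ i) ` {..<p} = {x. x ^ p = 1}"
  proof (rule card_subset_eq)
    show "finite {x::complex. x ^ p = 1}" using p_gt_1 by (intro finite_roots_unity) auto
    show "(\<lambda>i. \<xi> ^ i) ` {..<p} \<subseteq> {x. x ^ p = 1}"
      using primitive_root_power_eq_1_iff[OF root] by (auto simp flip: power_mult)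
    have "inj_on (\<lambda>i. \<xi> ^ i) {..<p}"
      using primitive_root_power_eq_iff[OF root] by (auto simp: inj_on_def cong_def)
    then show "card ((\<lambda>i. \<xi> ^ i) ` {..<p}) = card {x::complex. x ^ p = 1}"
      using p_gt_1 by (simp add: card_image card_roots_unity_eq)
  qed
  then obtain i where "z = \<xi> ^ i" using zp by blast
  then have "z \<in> K" using ZX_K[OF ZX_power[OF xi_ZX]] by simp
  then show ?thesis unfolding cyclotomic_subfield_def generated_subfield_def z_def[symmetric]
    using complex_subfield_K by auto
qed

text \<open>Both values are read off from \<open>Phi p\<close>: its vanishing at \<xi> gives the
  sum, and its value \<open>p\<close> at 1 gives the product once it is split into linear
  factors.\<close>

lemma sum_e: "(\<Sum>k<p - 1. e k) = -1"
  and prod_1_minus_e: "(\<Prod>k<p - 1. 1 - e k) = of_nat p"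
proof -
  have e: "e k = \<xi> ^ (g ^ k mod p)" for k
    unfolding e_def primitive_root_power_eq_iff[OF root] by (simp add: cong_def)
  have split: "{..<p} = insert 0 {1..<p}" using p_gt_1 by auto
  have P: "poly (of_int_poly (Phi p)) \<xi> = 0" using Phi_root_iff[OF prime_p] root by blast
  have "(\<Sum>k<p - 1. e k) = (\<Sum>i\<in>{1..<p}. \<xi> ^ i)"
    unfolding e using g_bij by (rule sum.reindex_bij_betw)
  also have "\<dots> = -1" using P unfolding poly_Phi split by (simp add: add_eq_0_iff)
  finally show "(\<Sum>k<p - 1. e k) = -1" .
  define Q where "Q = (\<Prod>i\<in>{1..<p}. [:- (\<xi> ^ i), 1:])"
  define D where "D = of_int_poly (Phi p) - Q"
  have degQ: "degree Q = p - 1" unfolding Q_def by (subst degree_prod_eq_sum_degree) auto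
  have leadQ: "lead_coeff Q = 1" unfolding Q_def by (simp add: lead_coeff_prod)
  have degP: "degree (of_int_poly (Phi p) :: complex poly) = p - 1"
    using p_gt_1 by (simp add: degree_Phi)
  \<comment> \<open>\<open>Phi p\<close> and \<open>Q\<close> are monic of degree
    \<open>p - 1\<close>, so their difference has smaller degree; a nonzero difference could not
    have the \<open>p - 1\<close> common roots.\<close>
  have "D = 0"
  proof (rule ccontr)
    assume D: "D \<noteq> 0"
    have "degree D \<le> p - 1" unfolding D_def using degQ degP by (metis degree_diff_le order_refl)
    moreover have "coeff D (p - 1) = 0"
      unfolding D_def using leadQ degQ p_gt_1 by (simp add: coeff_Phi)
    ultimately have deg: "degree D < p - 1" using D
      by (metis leading_coeff_0_iff order_le_less)
    have "(\<lambda>i. \<xi> ^ i) ` {1..<p} \<subseteq> {z. poly D z = 0}"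
    proof clarify
      fix i assume i: "i \<in> {1..<p}"
      then have "\<not> p dvd i" by (auto dest: dvd_imp_le)
      then have "poly (of_int_poly (Phi p)) (\<xi> ^ i) = 0"
        using Phi_root_iff[OF prime_p] primitive_root_power[OF prime_p root] by blast
      moreover have "poly Q (\<xi> ^ i) = 0" unfolding Q_def poly_prod
        using i by (intro prod_zero bexI[of _ i]) auto
      ultimately show "poly D (\<xi> ^ i) = 0" unfolding D_def by (simp only: poly_diff) simp
    qed
    then have "card ((\<lambda>i. \<xi> ^ i) ` {1..<p}) \<le> card {z. poly D z = 0}"
      using D by (intro card_mono poly_roots_finite)
    moreover have "inj_on (\<lambda>i. \<xi> ^ i) {1..<p}"
      using primitive_root_power_eq_iff[OF root] by (auto simp: inj_on_def cong_def)
    ultimately have "p - 1 \<le> degree D" using card_poly_roots_bound[OF D] by (simp add: card_image)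
    then show False using deg by simp
  qed
  then have "poly (of_int_poly (Phi p)) 1 = poly Q 1" unfolding D_def by simp
  then have "of_nat p = (\<Prod>i\<in>{1..<p}. 1 - \<xi> ^ i)"
    unfolding Q_def poly_prod poly_Phi by simp
  also have "\<dots> = (\<Prod>k<p - 1. 1 - e k)"
    unfolding e using g_bij by (rule prod.reindex_bij_betw[symmetric])
  finally show "(\<Prod>k<p - 1. 1 - e k) = of_nat p" by simp
qed

section \<open>Coordinates with respect to the conjugates of \<xi>\<close>

lemma power_xi_eq_e: "\<not> p dvd i \<Longrightarrow> \<exists>k<p - 1. \<xi> ^ i = e k"
  using g_power_surj unfolding e_def primitive_root_power_eq_iff[OF root] by (metis cong_sym)

text \<open>Every power of \<xi> is some \<open>e k\<close>, except 1, which is minus the sum of all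
  \<open>e k\<close>; this is where \<open>-1\<close> has to lie in \<open>C\<close>. A general
  \<open>C\<close> covers integral and rational coordinates at once.\<close>

lemma coords:
  fixes F :: "complex poly"
  assumes C: "0 \<in> C" "1 \<in> C" "\<And>x y. x \<in> C \<Longrightarrow> y \<in> C \<Longrightarrow> x + y \<in> C"
    "\<And>x y. x \<in> C \<Longrightarrow> y \<in> C \<Longrightarrow> x * y \<in> C" "-1 \<in> C"
    and F: "\<And>i. coeff F i \<in> C"
  shows "\<exists>c. (\<forall>k. c k \<in> C) \<and> poly F \<xi> = (\<Sum>k<p - 1. c k * e k)"
proof -
  define sp where "sp x \<longleftrightarrow> (\<exists>c. (\<forall>k. c k \<in> C) \<and> x = (\<Sum>k<p - 1. c k * e k))" for x
  have add: "sp (x + y)" if xy: "sp x" "sp y" for x y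
  proof -
    obtain c c' where "\<forall>k. c k \<in> C" "x = (\<Sum>k<p - 1. c k * e k)"
      "\<forall>k. c' k \<in> C" "y = (\<Sum>k<p - 1. c' k * e k)" using xy unfolding sp_def by blast
    then show ?thesis unfolding sp_def using C(3)
      by (intro exI[of _ "\<lambda>k. c k + c' k"]) (auto simp: distrib_right sum.distrib)
  qed
  have scale: "sp (a * x)" if ax: "a \<in> C" "sp x" for a x
  proof -
    obtain c where "\<forall>k. c k \<in> C" "x = (\<Sum>k<p - 1. c k * e k)" using ax unfolding sp_def by blast
    then show ?thesis unfolding sp_def using C(4) ax(1)
      by (intro exI[of _ "\<lambda>k. a * c k"]) (auto simp: sum_distrib_left mult.assoc)
  qed
  have power: "sp (\<xi> ^ i)" for i
  proof (cases "p dvd i")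
    case True
    then have "\<xi> ^ i = 1" using primitive_root_power_eq_1_iff[OF root] by simp
    then have "\<xi> ^ i = (\<Sum>k<p - 1. -1 * e k)" using sum_e by (simp add: sum_negf)
    then show ?thesis unfolding sp_def using C(5) by (intro exI[of _ "\<lambda>_. -1"]) auto
  next
    case False
    then obtain k where k: "k < p - 1" "\<xi> ^ i = e k" using power_xi_eq_e by blast
    have "(\<Sum>j<p - 1. (if j = k then 1 else 0) * e j) = (\<Sum>j<p - 1. if j = k then e j else 0)"
      by (intro sum.cong) auto
    also have "\<dots> = e k" using k(1) by (simp add: sum.delta)
    finally show ?thesis unfolding sp_def using C(1,2) k(2)
      by (intro exI[of _ "\<lambda>j. if j = k then 1 else 0"]) auto
  qed
  have sum: "sp (\<Sum>i\<in>A. coeff F i * \<xi> ^ i)" for A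
  proof (induction A rule: infinite_finite_induct)
    case (insert i A)
    then show ?case using add[OF scale[OF F power]] by simp
  qed (use scale[OF C(1) power[of 0]] in auto)
  show ?thesis using sum[of "{..degree F}"] unfolding sp_def by (simp only: poly_altdef)
qed

lemma ZX_coords: "x \<in> ZX \<Longrightarrow> \<exists>c. (\<forall>k. c k \<in> \<int>) \<and> x = (\<Sum>k<p - 1. c k * e k)"
  by (elim ZX_cases) (simp only:, rule coords, auto)

lemma K_coords: "x \<in> K \<Longrightarrow> \<exists>c. (\<forall>k. c k \<in> \<rat>) \<and> x = (\<Sum>k<p - 1. c k * e k)"
  by (elim K_cases) (simp only:, rule coords, auto)

lemma e_independent:
  assumes c: "\<And>k. c k \<in> \<rat>" and zero: "(\<Sum>k<p - 1. c k * e k) = 0" and k: "k < p - 1"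
  shows "c k = 0"
proof -
  have "\<forall>k. \<exists>r. c k = of_rat r" using c by (auto elim!: Rats_cases)
  from choice[OF this] obtain r where r: "\<And>k. c k = of_rat (r k)" by blast
  \<comment> \<open>The exponents in the \<open>e k\<close>, reduced modulo \<open>p\<close>,
    permute 1 up to \<open>p - 1\<close>. Lowering each by one divides the relation by \<xi> and
    leaves a polynomial of degree at most \<open>p - 2\<close>, too small for a nonzero multiple of
    \<open>Phi p\<close>.\<close>
  define G where "G k = g ^ k mod p - 1" for k
  have G1: "Suc (G k) = g ^ k mod p" for k
    using not_dvd_g_power[of k] unfolding G_def by (simp add: dvd_eq_mod_eq_0)
  have e: "e k = \<xi> ^ (Suc (G k))" for k
    unfolding e_def primitive_root_power_eq_iff[OF root] G1 by (simp add: cong_def)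
  have inj: "G i = G j \<longleftrightarrow> i = j" if "i < p - 1" "j < p - 1" for i j
    using bij_betw_imp_inj_on[OF g_bij] that G1 by (metis inj_onD lessThan_iff)
  define f where "f = (\<Sum>k<p - 1. monom (r k) (G k))"
  have cf: "coeff f (G j) = r j" if "j < p - 1" for j
  proof -
    have "coeff f (G j) = (\<Sum>k<p - 1. if k = j then r k else 0)"
      unfolding f_def coeff_sum coeff_monom using inj that by (intro sum.cong) auto
    then show ?thesis using that by simp
  qed
  have "\<xi> * qeval f \<xi> = (\<Sum>k<p - 1. c k * e k)"
    unfolding f_def of_rat_poly_hom.hom_sum poly_sum sum_distrib_left
    by (intro sum.cong refl) (simp add: e r of_rat_hom.map_poly_hom_monom poly_monom)
  moreover have "\<xi> \<noteq> 0"
  proof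
    assume "\<xi> = 0"
    then show False using root p_gt_1 unfolding is_primitive_root_of_unity_def by (simp add: power_0_left)
  qed
  ultimately have "qeval f \<xi> = 0" using zero by simp
  then have dvd: "of_int_poly (Phi p) dvd f" using Phi_dvd_iff[OF prime_p root] by blast
  have "f = 0"
  proof (rule ccontr)
    assume "f \<noteq> 0"
    then have "degree (of_int_poly (Phi p) :: rat poly) \<le> degree f" using dvd dvd_imp_degree_le by blast
    then have 1: "p - 1 \<le> degree f" using p_gt_1 by (simp add: degree_Phi)
    have Gp: "G k \<le> p - 2" for k
    proof -
      have "Suc (G k) < p" unfolding G1 using p_gt_1 by simp
      then show ?thesis by simp
    qed
    have "degree f \<le> p - 2"
      unfolding f_def using Gp by (intro degree_sum_le) (auto intro: order_trans[OF degree_monom_le])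
    then show False using 1 p_gt_1 by simp
  qed
  then show ?thesis using cf[OF k] r by simp
qed

lemma c_e_K: "c \<in> \<rat> \<Longrightarrow> c * e k \<in> K"
  by (auto elim!: Rats_cases intro: K_mult rat_K ZX_K e_ZX)

lemma gal_coords:
  assumes c: "\<And>k. c k \<in> \<rat>"
  shows "gal j (\<Sum>k\<in>A. c k * e (f k)) = (\<Sum>k\<in>A. c k * e (j + f k))"
proof -
  have "gal j (c k * e i) = c k * e (j + i)" for k i
    using c[of k] by (auto elim!: Rats_cases simp: gal_mult rat_K ZX_K e_ZX gal_rat gal_e)
  then show ?thesis using c by (simp add: gal_sum c_e_K)
qed

text \<open>\<open>gal j\<close> moves the coordinate at \<open>k\<close> to \<open>k + j\<close>,
  and coordinates are unique. The function \<open>c\<close> is taken periodic because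
  \<open>k + j\<close> may leave the index range.\<close>

lemma fixed_coords:
  assumes c: "\<And>k. c k \<in> \<rat>" and per: "\<And>k. c (k + (p - 1)) = c k"
    and fixed: "gal j (\<Sum>k<p - 1. c k * e k) = (\<Sum>k<p - 1. c k * e k)"
  shows "c (k + j) = c k"
proof -
  let ?q = "p - 1"
  define d where "d k = c k - c (k + j)" for k
  have dQ: "d k \<in> \<rat>" for k unfolding d_def using c by auto
  have dper: "d (k + ?q) = d k" for k
    unfolding d_def using per[of k] per[of "k + j"] by (simp add: ac_simps)
  have "(\<Sum>k<?q. c k * e (j + k)) = (\<Sum>k<?q. c k * e k)"
    using fixed unfolding gal_coords[OF c] .
  also have "\<dots> = (\<Sum>k<?q. c (k + j) * e (k + j))"
    by (rule sum_shift_periodic[symmetric]) (simp only: per e_period)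
  finally have "(\<Sum>k<?q. d k * e (j + k)) = 0"
    unfolding d_def by (simp add: left_diff_distrib sum_subtractf add.commute)
  \<comment> \<open>The automorphism with index \<open>- j\<close>, written
    \<open>j * (p - 2)\<close>, brings the indices back to the range in which the \<open>e k\<close>
    are known to be independent.\<close>
  then have "gal (j * (p - 2)) (\<Sum>k<?q. d k * e (j + k)) = 0" using gal_int[of _ 0] by simp
  moreover have "e (j * (p - 2) + (j + k)) = e k" for k
  proof (rule e_cong)
    have "p - 1 = Suc (p - 2)" using p_gt_1 by simp
    then have eq: "j * (p - 2) + (j + k) = (p - 1) * j + k" by (simp only: mult_Suc mult_Suc_right ac_simps)
    show "[j * (p - 2) + (j + k) = k] (mod p - 1)" unfolding eq cong_def by (rule mod_mult_self4)
  qed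
  ultimately have "(\<Sum>k<?q. d k * e k) = 0" unfolding gal_coords[OF dQ] by simp
  then have d0: "d k = 0" if "k < ?q" for k by (rule e_independent[OF dQ _ that])
  have dmod: "d (k + ?q * i) = d k" for k i
  proof (induction i)
    case (Suc i)
    then show ?case using dper[of "k + ?q * i"] by (simp add: ac_simps)
  qed simp
  have "d k = d (k mod ?q)" using dmod[of "k mod ?q" "k div ?q"] by simp
  also have "\<dots> = 0" using p_gt_1 by (intro d0) simp
  finally show ?thesis unfolding d_def by simp
qed

section \<open>Gaussian periods and the fixed ring\<close>

definition eta :: "nat \<Rightarrow> complex" where "eta i = (\<Sum>r<h. e (i + n * r))"

definition beta :: "nat \<Rightarrow> complex" where "beta i = (\<Prod>r<h. 1 - e (i + n * r))"

text \<open>\<open>gal n\<close> generates the subgroup of index \<open>n\<close> in the Galois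
  group, so this is the part of Z[\<xi>] in the subfield of degree \<open>n\<close>, its ring of
  integers.\<close>

definition OZ :: "complex set" where "OZ = {x \<in> ZX. gal n x = x}"

lemma fixed_periods:
  assumes C: "C \<subseteq> \<rat>" "\<And>k. c k \<in> C" and x: "x = (\<Sum>k<p - 1. c k * e k)" "gal n x = x"
  shows "\<exists>c'. (\<forall>i. c' i \<in> C) \<and> x = (\<Sum>i<n. c' i * eta i)"
proof -
  \<comment> \<open>The values of \<open>c\<close> beyond \<open>p - 2\<close> are arbitrary; a
    periodic extension replaces them before periodicity with step \<open>n\<close> is
    derived.\<close>
  define c' where "c' k = c (k mod (p - 1))" for k
  have c'C: "c' k \<in> C" for k unfolding c'_def using C(2) by blast
  have x': "x = (\<Sum>k<p - 1. c' k * e k)" unfolding x(1) c'_def by (intro sum.cong) auto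
  have per: "c' (k + n) = c' k" for k
  proof (rule fixed_coords)
    show "c' k \<in> \<rat>" for k using c'C C(1) by blast
    show "c' (k + (p - 1)) = c' k" for k unfolding c'_def by simp
  qed (rule x(2)[unfolded x'])
  have c'n: "c' (i + n * r) = c' i" for i r
  proof (induction r)
    case (Suc r)
    then show ?case using per[of "i + n * r"] by (simp only: mult_Suc_right ac_simps)
  qed simp
  have "x = (\<Sum>k<n * h. c' k * e k)" unfolding x' nh ..
  also have "\<dots> = (\<Sum>i<n. c' i * eta i)"
    unfolding sum_periodic_blocks c'n eta_def sum_distrib_left ..
  finally show ?thesis using c'C by blast
qed

lemma OZ_periods: "x \<in> OZ \<Longrightarrow> \<exists>c. (\<forall>i. c i \<in> \<int>) \<and> x = (\<Sum>i<n. c i * eta i)"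
proof -
  assume x: "x \<in> OZ"
  then obtain c where "\<forall>k. c k \<in> \<int>" "x = (\<Sum>k<p - 1. c k * e k)"
    using ZX_coords unfolding OZ_def by blast
  then show ?thesis using x Ints_subset_Rats unfolding OZ_def by (intro fixed_periods[of \<int> c]) auto
qed

lemma K_fixed_periods: "x \<in> K \<Longrightarrow> gal n x = x \<Longrightarrow> \<exists>c. (\<forall>i. c i \<in> \<rat>) \<and> x = (\<Sum>i<n. c i * eta i)"
proof -
  assume x: "x \<in> K" "gal n x = x"
  then obtain c where "\<forall>k. c k \<in> \<rat>" "x = (\<Sum>k<p - 1. c k * e k)" using K_coords by blast
  then show ?thesis using x by (intro fixed_periods[of \<rat> c]) auto
qed

lemma eta_period: "eta (i + n) = eta i"
proof -
  have "eta (i + n) = (\<Sum>r<h. e (i + n * (r + 1)))" unfolding eta_def by (simp add: algebra_simps)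
  also have "\<dots> = eta i" unfolding eta_def
    by (rule sum_shift_periodic) (simp only: distrib_left nh e_period add.assoc[symmetric])
  finally show ?thesis .
qed

lemma beta_period: "beta (i + n) = beta i"
proof -
  have "beta (i + n) = (\<Prod>r<h. 1 - e (i + n * (r + 1)))" unfolding beta_def by (simp add: algebra_simps)
  also have "\<dots> = beta i" unfolding beta_def
    by (rule prod_shift_periodic) (simp only: distrib_left nh e_period add.assoc[symmetric])
  finally show ?thesis .
qed

lemma gal_eta: "gal j (eta i) = eta (j + i)"
  unfolding eta_def by (simp add: gal_sum ZX_K e_ZX gal_e add.assoc)

lemma one_minus_e_ZX: "1 - e k \<in> ZX" by (intro ZX_diff ZX_1 e_ZX)

lemma gal_1_minus_e: "gal j (1 - e k) = 1 - e (j + k)"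
  using gal_int[of j 1] by (simp add: gal_diff ZX_K ZX_1 e_ZX gal_e)

lemma gal_beta: "gal j (beta i) = beta (j + i)"
  unfolding beta_def by (simp add: gal_prod ZX_K one_minus_e_ZX gal_1_minus_e add.assoc)

lemma eta_OZ: "eta i \<in> OZ"
  unfolding OZ_def using eta_period[of i] by (auto simp: gal_eta add.commute) (auto simp: eta_def intro: ZX_sum e_ZX)

lemma beta_OZ: "beta i \<in> OZ"
  unfolding OZ_def using beta_period[of i] by (auto simp: gal_beta add.commute) (auto simp: beta_def intro: ZX_prod one_minus_e_ZX)

lemma OZ_ZX: "x \<in> OZ \<Longrightarrow> x \<in> ZX" and OZ_K: "x \<in> OZ \<Longrightarrow> x \<in> K"
  unfolding OZ_def using ZX_K by auto

lemma OZ_add: "x \<in> OZ \<Longrightarrow> y \<in> OZ \<Longrightarrow> x + y \<in> OZ"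
  unfolding OZ_def by (auto simp: ZX_add gal_add ZX_K)

lemma OZ_diff: "x \<in> OZ \<Longrightarrow> y \<in> OZ \<Longrightarrow> x - y \<in> OZ"
  unfolding OZ_def by (auto simp: ZX_diff gal_diff ZX_K)

lemma OZ_mult: "x \<in> OZ \<Longrightarrow> y \<in> OZ \<Longrightarrow> x * y \<in> OZ"
  unfolding OZ_def by (auto simp: ZX_mult gal_mult ZX_K)

lemma OZ_int: "of_int i \<in> OZ" unfolding OZ_def by (auto simp: int_ZX gal_int)

lemma OZ_0: "0 \<in> OZ" and OZ_1: "1 \<in> OZ" using OZ_int[of 0] OZ_int[of 1] by auto

lemma OZ_sum: "(\<And>i. i \<in> A \<Longrightarrow> f i \<in> OZ) \<Longrightarrow> sum f A \<in> OZ"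
  by (induction A rule: infinite_finite_induct) (auto intro: OZ_0 OZ_add)

lemma OZ_prod: "(\<And>i. i \<in> A \<Longrightarrow> f i \<in> OZ) \<Longrightarrow> prod f A \<in> OZ"
  by (induction A rule: infinite_finite_induct) (auto intro: OZ_1 OZ_mult)

lemma OZ_power: "x \<in> OZ \<Longrightarrow> x ^ k \<in> OZ"
  by (induction k) (auto intro: OZ_1 OZ_mult)

lemma gal_OZ: "x \<in> OZ \<Longrightarrow> gal j x \<in> OZ"
  unfolding OZ_def using gal_gal[of x n j] gal_gal[of x j n] by (auto simp: gal_ZX ZX_K add.commute)

text \<open>The coordinates of the two periods are indicators of different residue classes modulo
  \<open>n\<close>. It follows later that \<open>gal 1\<close> moves the periods.\<close>

lemma eta_0_neq_1: assumes "n > 1" shows "eta 0 \<noteq> eta 1"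
proof
  assume eq: "eta 0 = eta 1"
  have eta: "eta i = (\<Sum>k<p - 1. (if k mod n = i then 1 else 0) * e k)" if "i < n" for i
  proof -
    have "(\<Sum>k<p - 1. (if k mod n = i then 1 else 0) * e k)
        = (\<Sum>j<n. \<Sum>r<h. (if (j + n * r) mod n = i then 1 else 0) * e (j + n * r))"
      unfolding nh[symmetric] by (rule sum_periodic_blocks)
    also have "\<dots> = (\<Sum>j<n. if j = i then eta j else 0)"
      unfolding eta_def by (intro sum.cong refl) auto
    also have "\<dots> = eta i" using that by simp
    finally show ?thesis by simp
  qed
  define c :: "nat \<Rightarrow> complex" where "c k = (if k mod n = 0 then 1 else 0) - (if k mod n = 1 then 1 else 0)" for k
  have "(\<Sum>k<p - 1. c k * e k) = eta 0 - eta 1"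
    using assms by (simp only: c_def left_diff_distrib sum_subtractf eta[of 0] eta[of 1] nh_pos(1))
  then have zero: "(\<Sum>k<p - 1. c k * e k) = 0" using eq by simp
  have "c 0 = 0"
  proof (rule e_independent[OF _ zero])
    show "c k \<in> \<rat>" for k unfolding c_def by simp
  qed (use p_gt_1 in simp)
  then show False unfolding c_def using assms by simp
qed

text \<open>Invariance under the shift by one makes all coordinates equal, and the
  \<open>e k\<close> sum to -1.\<close>

lemma gal_1_fixed_Ints: assumes "x \<in> ZX" "gal 1 x = x" shows "x \<in> \<int>"
proof -
  obtain c where c: "\<forall>k. c k \<in> \<int>" "x = (\<Sum>k<p - 1. c k * e k)"
    using ZX_coords assms(1) by blast
  define c' where "c' k = c (k mod (p - 1))" for k
  have c'C: "c' k \<in> \<int>" for k unfolding c'_def using c(1) by blast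
  have x': "x = (\<Sum>k<p - 1. c' k * e k)" unfolding c(2) c'_def by (intro sum.cong) auto
  have per: "c' (k + 1) = c' k" for k
  proof (rule fixed_coords)
    show "c' k \<in> \<rat>" for k using c'C Ints_subset_Rats by blast
    show "c' (k + (p - 1)) = c' k" for k unfolding c'_def by simp
  qed (rule assms(2)[unfolded x'])
  have const: "c' k = c' 0" for k
  proof (induction k)
    case (Suc k)
    then show ?case using per[of k] by simp
  qed simp
  have "x = (\<Sum>k<p - 1. c' 0 * e k)" unfolding x' by (intro sum.cong refl, subst const) (rule refl)
  then have "x = c' 0 * (\<Sum>k<p - 1. e k)" by (simp only: sum_distrib_left)
  then show ?thesis using sum_e c'C[of 0] by simp
qed

section \<open>Total ramification of \<open>p\<close>\<close>

definition pi_dvd :: "complex \<Rightarrow> bool" where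
  "pi_dvd x \<longleftrightarrow> (\<exists>w\<in>ZX. x = (1 - \<xi>) * w)"

lemma pi_dvd_add: "pi_dvd x \<Longrightarrow> pi_dvd y \<Longrightarrow> pi_dvd (x + y)"
  unfolding pi_dvd_def by (metis ZX_add distrib_left)

lemma pi_dvd_mult: "pi_dvd x \<Longrightarrow> y \<in> ZX \<Longrightarrow> pi_dvd (x * y)"
  unfolding pi_dvd_def by (metis ZX_mult mult.assoc)

lemma one_minus_xi_power: "\<exists>w\<in>ZX. 1 - \<xi> ^ k = (1 - \<xi>) * w"
  using ZX_sum[of "{..<k}" "\<lambda>i. \<xi> ^ i"] ZX_power[OF xi_ZX] one_diff_power_eq[of \<xi> k] by blast

lemma pi_dvd_p: "pi_dvd (of_nat p)"
proof -
  have "0 \<in> {..<p - 1}" using p_gt_1 by simp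
  then have "(\<Prod>k<p - 1. 1 - e k) = (1 - e 0) * (\<Prod>k\<in>{..<p - 1} - {0}. 1 - e k)"
    by (intro prod.remove) auto
  then show ?thesis unfolding pi_dvd_def prod_1_minus_e e_0
    using ZX_prod[of "{..<p - 1} - {0}" "\<lambda>k. 1 - e k"] one_minus_e_ZX by blast
qed

text \<open>The residue ring of Z[\<xi>] modulo \<open>1 - \<xi>\<close> is the field with
  \<open>p\<close> elements and \<xi> reduces to 1, so reduction is evaluation of a representing
  polynomial at 1.\<close>

lemma pi_dvd_ieval: "pi_dvd (poly (of_int_poly f) \<xi>) \<longleftrightarrow> int p dvd poly f 1"
proof
  assume "pi_dvd (poly (of_int_poly f) \<xi>)"
  then obtain k where k: "poly (of_int_poly f) \<xi> = (1 - \<xi>) * poly (of_int_poly k) \<xi>"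
    unfolding pi_dvd_def ZX_def by blast
  have lin: "of_int_poly [:1, -1:] = ([:1, -1:] :: complex poly)"
    by (simp add: of_int_hom.map_poly_pCons_hom)
  have "poly (of_int_poly (f - [:1, -1:] * k)) \<xi> = 0"
    by (simp only: of_int_poly_hom.hom_minus of_int_poly_hom.hom_mult poly_diff poly_mult k lin) simp
  from prime_dvd_poly_1[OF prime_p root this] show "int p dvd poly f 1" by simp
next
  assume "int p dvd poly f 1"
  then obtain c where c: "poly f 1 = int p * c" by blast
  have "poly (f - [:poly f 1:]) 1 = 0" by simp
  then obtain q where q: "f - [:poly f 1:] = [:-1, 1:] * q"
    unfolding poly_eq_0_iff_dvd dvd_def by blast
  have lin: "of_int_poly [:-1, 1:] = ([:-1, 1:] :: complex poly)"
    "of_int_poly [:poly f 1:] = ([:of_int (poly f 1):] :: complex poly)"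
    by (simp_all add: of_int_hom.map_poly_pCons_hom)
  have "poly (of_int_poly (f - [:poly f 1:])) \<xi> = poly (of_int_poly ([:-1, 1:] * q)) \<xi>"
    unfolding q ..
  then have "poly (of_int_poly f) \<xi> - of_int (poly f 1) = (\<xi> - 1) * poly (of_int_poly q) \<xi>"
    by (simp only: of_int_poly_hom.hom_minus of_int_poly_hom.hom_mult poly_diff poly_mult lin) simp
  then have eq: "poly (of_int_poly f) \<xi> = of_nat p * of_int c + (1 - \<xi>) * (- poly (of_int_poly q) \<xi>)"
    unfolding c by (simp add: algebra_simps)
  have "- poly (of_int_poly q) \<xi> \<in> ZX" using ZX_diff[OF ZX_0 ZX_I] by simp
  then have "pi_dvd ((1 - \<xi>) * (- poly (of_int_poly q) \<xi>))" unfolding pi_dvd_def by blast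
  then show "pi_dvd (poly (of_int_poly f) \<xi>)"
    unfolding eq by (rule pi_dvd_add[OF pi_dvd_mult[OF pi_dvd_p int_ZX]])
qed

lemma pi_dvd_int: "pi_dvd (of_int a) \<longleftrightarrow> int p dvd a"
  using pi_dvd_ieval[of "[:a:]"] by (simp add: of_int_hom.map_poly_pCons_hom)

lemma ieval_pcompose: "poly (of_int_poly (pcompose f (monom 1 j))) z = poly (of_int_poly f) (z ^ j)" for z :: complex
  by (simp add: of_int_hom.map_poly_pcompose poly_pcompose poly_monom)

text \<open>Replacing X by a power of X does not change the value of a polynomial at 1, so the
  Galois group acts trivially on the residue field.\<close>

lemma pi_dvd_diff_gal: "x \<in> ZX \<Longrightarrow> pi_dvd (x - gal k x)"
proof (elim ZX_cases)
  fix f assume x: "x = poly (of_int_poly f) \<xi>"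
  then have "gal k x = poly (of_int_poly (pcompose f (monom 1 (g ^ k)))) \<xi>"
    by (simp only: gal_ieval ieval_pcompose e_def)
  then have eq: "x - gal k x = poly (of_int_poly (f - pcompose f (monom 1 (g ^ k)))) \<xi>"
    unfolding x by (simp only: of_int_poly_hom.hom_minus poly_diff)
  show ?thesis unfolding eq pi_dvd_ieval by (simp add: poly_pcompose poly_monom)
qed

lemma xi_neq_1: "\<xi> \<noteq> 1"
  using primitive_root_power_eq_1_iff[OF root, of 1] p_gt_1 by auto

text \<open>If \<open>x = (1 - \<xi>)\<^sup>k w\<close> is invariant under \<open>\<xi> \<mapsto> \<xi>\<^sup>a\<close>, where \<open>a = g\<^sup>n\<close>, then \<open>w\<close> and \<open>a\<^sup>k w\<close> agree
  modulo \<open>1 - \<xi>\<close>, and \<open>a\<close> has order \<open>h\<close> modulo \<open>p\<close>.\<close>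

lemma OZ_pi_power:
  assumes x: "x \<in> OZ" "pi_dvd x" and k: "k \<ge> 1" "k \<le> h"
  shows "\<exists>w\<in>ZX. x = (1 - \<xi>) ^ k * w"
  using k
proof (induction k rule: dec_induct)
  case base
  show ?case using x(2) unfolding pi_dvd_def by simp
next
  case (step k)
  then obtain W where W: "x = (1 - \<xi>) ^ k * poly (of_int_poly W) \<xi>"
    by (auto elim!: ZX_cases)
  define a where "a = g ^ n"
  \<comment> \<open>\<open>s\<close> is the quotient \<open>(1 - X^a) / (1 - X)\<close>: at \<xi> it
    is the factor by which \<open>gal n\<close> changes \<open>1 - \<xi>\<close>, and its residue,
    the value at 1, is \<open>a\<close>.\<close>
  define s where "s = (\<Sum>i<a. monom (1::int) i)"
  have s: "poly (of_int_poly s) \<xi> = (\<Sum>i<a. \<xi> ^ i)"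
    unfolding s_def by (simp add: of_int_poly_hom.hom_sum poly_sum of_int_hom.map_poly_hom_monom poly_monom)
  have xi_a: "gal n (1 - \<xi>) = (1 - \<xi>) * poly (of_int_poly s) \<xi>"
    using gal_1_minus_e[of n 0] one_diff_power_eq[of \<xi> a] by (simp add: s e_0) (simp add: e_def a_def)
  have K: "1 - \<xi> \<in> K" "poly (of_int_poly W) \<xi> \<in> K"
    using one_minus_e_ZX[of 0] by (auto simp: e_0 ZX_K ZX_I)
  have "gal n x = (1 - \<xi>) ^ k * (poly (of_int_poly s) \<xi> ^ k * poly (of_int_poly W) (\<xi> ^ a))"
    unfolding W using gal_ieval[of n W]
    by (simp add: gal_mult K gal_power ZX_K ZX_power xi_a power_mult_distrib mult.assoc K_prod[of "{..<k}" "\<lambda>_. 1 - \<xi>", simplified])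
       (simp add: e_def a_def)
  moreover have "gal n x = x" using x(1) unfolding OZ_def by blast
  ultimately have "poly (of_int_poly s) \<xi> ^ k * poly (of_int_poly W) (\<xi> ^ a) = poly (of_int_poly W) \<xi>"
    using W xi_neq_1 by simp
  then have "poly (of_int_poly (s ^ k * pcompose W (monom 1 a) - W)) \<xi> = 0"
    by (simp only: of_int_poly_hom.hom_minus of_int_poly_hom.hom_mult of_int_poly_hom.hom_power
      poly_diff poly_mult poly_power ieval_pcompose) simp
  from prime_dvd_poly_1[OF prime_p root this]
  have "int p dvd poly s 1 ^ k * poly W 1 - poly W 1" by (simp add: poly_pcompose poly_monom)
  also have "poly s 1 = int a" unfolding s_def by (simp add: poly_sum poly_monom)
  also have "int a ^ k * poly W 1 - poly W 1 = (int a ^ k - 1) * poly W 1" by (simp add: algebra_simps)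
  finally have "int p dvd int a ^ k - 1 \<or> int p dvd poly W 1"
    using prime_p by (simp add: prime_dvd_mult_iff)
  moreover have "\<not> int p dvd int a ^ k - 1"
  proof
    assume "int p dvd int a ^ k - 1"
    then have "[int (a ^ k) = int 1] (mod int p)" by (simp add: cong_iff_dvd_diff)
    then have "[g ^ (n * k) = g ^ 0] (mod p)" unfolding a_def cong_int_iff by (simp add: power_mult)
    then have "p - 1 dvd n * k" unfolding g_power_eq_iff by (simp add: cong_0_iff)
    moreover have "0 < n * k" "n * k < n * h" using step.hyps step.prems nh_pos by auto
    ultimately show False unfolding nh using dvd_imp_le by fastforce
  qed
  ultimately have "pi_dvd (poly (of_int_poly W) \<xi>)" unfolding pi_dvd_ieval by blast
  then obtain w where w: "w \<in> ZX" "poly (of_int_poly W) \<xi> = (1 - \<xi>) * w" unfolding pi_dvd_def by blast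
  have "x = (1 - \<xi>) ^ Suc k * w" unfolding W w(2) by (simp only: power_Suc2 mult.assoc)
  then show ?case using w(1) by blast
qed

text \<open>\<xi> is itself a power of each conjugate \<open>e k\<close>, so \<open>1 - e k\<close>
  divides \<open>1 - \<xi>\<close>; \<open>beta j\<close> is a product of \<open>h\<close> such
  factors.\<close>

lemma beta_pi_power: "\<exists>v\<in>ZX. (1 - \<xi>) ^ h = beta j * v"
proof -
  have "\<exists>v\<in>ZX. 1 - \<xi> = (1 - e k) * v" for k
  proof -
    \<comment> \<open>The exponent \<open>m\<close> is inverse to \<open>g ^ k\<close> modulo
      \<open>p\<close>, so raising \<open>e k\<close> to it returns \<xi>.\<close>
    define m where "m = g ^ (k * (p - 2))"
    have "[k + k * (p - 2) = 0] (mod (p - 1))"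
    proof -
      have "p - 1 = Suc (p - 2)" using p_gt_1 by simp
      then have "k + k * (p - 2) = (p - 1) * k" by (simp only: mult_Suc mult_Suc_right ac_simps)
      then show ?thesis by (simp add: cong_0_iff)
    qed
    then have "e (k + k * (p - 2)) = e 0" by (rule e_cong)
    then have "e k ^ m = \<xi>" unfolding m_def e_def by (simp add: power_add flip: power_mult)
    then have "1 - \<xi> = (1 - e k) * (\<Sum>i<m. e k ^ i)" using one_diff_power_eq[of "e k" m] by simp
    moreover have "(\<Sum>i<m. e k ^ i) \<in> ZX" by (intro ZX_sum ZX_power e_ZX)
    ultimately show ?thesis by blast
  qed
  then have "\<forall>k. \<exists>v. v \<in> ZX \<and> 1 - \<xi> = (1 - e k) * v" by blast
  from choice[OF this] obtain v where v: "\<And>k. v k \<in> ZX" "\<And>k. 1 - \<xi> = (1 - e k) * v k" by blast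
  have "(1 - \<xi>) ^ h = (\<Prod>r<h. 1 - \<xi>)" by simp
  also have "\<dots> = (\<Prod>r<h. (1 - e (j + n * r)) * v (j + n * r))" using v(2) by (intro prod.cong refl)
  also have "\<dots> = beta j * (\<Prod>r<h. v (j + n * r))" unfolding beta_def by (rule prod.distrib)
  finally show ?thesis using ZX_prod[of "{..<h}" "\<lambda>r. v (j + n * r)"] v(1) by blast
qed

lemma beta_neq_0: "beta j \<noteq> 0"
  using beta_pi_power[of j] xi_neq_1 by auto

lemma pi_dvd_beta: "pi_dvd (beta j)"
proof -
  have "0 \<in> {..<h}" using nh_pos by simp
  then have "beta j = (1 - e (j + n * 0)) * (\<Prod>r\<in>{..<h} - {0}. 1 - e (j + n * r))"
    unfolding beta_def by (intro prod.remove) auto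
  moreover have "pi_dvd (1 - e k)" for k
    unfolding e_def using one_minus_xi_power[of "g ^ k"] unfolding pi_dvd_def by blast
  moreover have "(\<Prod>r\<in>{..<h} - {0}. 1 - e (j + n * r)) \<in> ZX" by (intro ZX_prod one_minus_e_ZX)
  ultimately show ?thesis by (simp only: pi_dvd_mult)
qed

text \<open>\<open>beta j\<close> generates the prime of \<open>OZ\<close> above \<open>p\<close>:
  divisibility by \<open>1 - \<xi>\<close> improves to its \<open>h\<close>-th power, hence to
  \<open>beta j\<close>, and the quotient is fixed by \<open>gal n\<close> because \<open>x\<close>
  and \<open>beta j\<close> are.\<close>

lemma OZ_div_beta:
  assumes "x \<in> OZ" "pi_dvd x" shows "\<exists>w\<in>OZ. x = beta j * w"
proof -
  obtain w where w: "w \<in> ZX" "x = (1 - \<xi>) ^ h * w" using OZ_pi_power[OF assms, of h] nh_pos by auto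
  obtain v where v: "v \<in> ZX" "(1 - \<xi>) ^ h = beta j * v" using beta_pi_power by blast
  have x: "x = beta j * (v * w)" unfolding w(2) v(2) by simp
  have vw: "v * w \<in> ZX" using v(1) w(1) by (rule ZX_mult)
  have "gal n x = beta j * gal n (v * w)"
    unfolding x using vw beta_OZ[of j] by (simp add: gal_mult ZX_K OZ_def)
  moreover have "gal n x = x" using assms(1) unfolding OZ_def by blast
  ultimately have "gal n (v * w) = v * w" using x beta_neq_0[of j] by simp
  then show ?thesis using x vw unfolding OZ_def by blast
qed

lemma prod_beta: "(\<Prod>j<n. beta j) = of_nat p"
proof -
  have "(\<Prod>j<n. beta j) = (\<Prod>k<n * h. 1 - e k)"
    unfolding beta_def by (rule prod_periodic_blocks[symmetric])
  then show ?thesis unfolding nh prod_1_minus_e .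
qed

section \<open>Sum, products and squares of periods\<close>

lemma sum_eta: "(\<Sum>i<n. eta i) = -1"
proof -
  have "(\<Sum>i<n. eta i) = (\<Sum>k<n * h. e k)"
    unfolding eta_def by (rule sum_periodic_blocks[symmetric])
  then show ?thesis unfolding nh sum_e .
qed

text \<open>A term of \<open>eta 0\<close> times a term of \<open>eta 1\<close> is never 1:
  otherwise \<open>g ^ (n * r)\<close> would be \<open>- g\<close> modulo \<open>p\<close> for some
  \<open>r\<close>, and squaring gives \<open>n dvd 2\<close>. All products are thus conjugates of
  \<xi>, and they group into \<open>h\<close> full periods.\<close>

lemma eta_0_mult_eta_1:
  assumes "odd n" "n > 1"
  shows "\<exists>l. eta 0 * eta 1 = (\<Sum>r<h. eta (l r))"
proof -
  have "\<exists>l. e (n * r) * e 1 = e l" for r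
  proof -
    have "\<not> p dvd g ^ (n * r) + g ^ 1"
    proof
      assume "p dvd g ^ (n * r) + g ^ 1"
      then have "int p dvd int (g ^ (n * r)) + int (g ^ 1)" by (metis of_nat_add int_dvd_int_iff)
      then have "int p dvd (int (g ^ (n * r)) + int (g ^ 1)) * (int (g ^ (n * r)) - int (g ^ 1))" by (rule dvd_mult2)
      also have "\<dots> = int (g ^ (2 * (n * r))) - int (g ^ 2)"
        by (simp add: algebra_simps power2_eq_square power_mult power_even_eq)
      finally have "[g ^ (2 * (n * r)) = g ^ 2] (mod p)"
        using cong_int_iff by (metis cong_iff_dvd_diff)
      then have "[2 * (n * r) = 2] (mod (p - 1))" unfolding g_power_eq_iff .
      then have "[2 * (n * r) = 2] (mod n)" using n_dvd by (rule cong_dvd_modulus_nat)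
      then have "[0 = 2] (mod n)" by (metis cong_0_iff cong_sym cong_trans dvd_triv_left mult.left_commute)
      then have "n dvd 2" using cong_0_iff cong_sym by blast
      then have "n \<le> 2" by (rule dvd_imp_le) simp
      then have "n = 2" using assms(2) by simp
      then show False using assms(1) by simp
    qed
    then show ?thesis using power_xi_eq_e unfolding e_def by (metis power_add)
  qed
  then have "\<forall>r. \<exists>l. e (n * r) * e 1 = e l" by blast
  from choice[OF this] obtain l where l: "\<And>r. e (n * r) * e 1 = e (l r)" by blast
  have inv: "gal (n * s) (eta 0) = eta 0" for s
  proof (induction s)
    case (Suc s)
    then show ?case using gal_gal[of "eta 0" n "n * s"] eta_OZ[of 0] OZ_K[OF eta_OZ[of 0]]
      unfolding OZ_def by (simp add: add.commute)
  qed (use gal_0 OZ_K eta_OZ in auto)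
  have "eta 0 * eta 1 = (\<Sum>s<h. eta 0 * e (1 + n * s))"
    unfolding eta_def[of 1] by (rule sum_distrib_left)
  also have "\<dots> = (\<Sum>s<h. gal (n * s) (eta 0 * e 1))"
    using inv by (simp add: gal_mult OZ_K eta_OZ ZX_K e_ZX gal_e add.commute)
  also have "\<dots> = (\<Sum>s<h. gal (n * s) (\<Sum>r<h. e (l r)))"
    unfolding eta_def[of 0] sum_distrib_right using l by simp
  also have "\<dots> = (\<Sum>s<h. \<Sum>r<h. e (l r + n * s))"
    by (simp add: gal_sum ZX_K e_ZX gal_e add.commute)
  also have "\<dots> = (\<Sum>r<h. eta (l r))" unfolding eta_def by (rule sum.swap)
  finally show ?thesis by blast
qed

text \<open>This is the Frobenius map modulo 2: as \<open>p\<close> is odd, doubling the exponents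
  permutes the conjugates of \<xi>, and the cross terms contribute an even amount.\<close>

lemma eta_square:
  assumes "p \<noteq> 2"
  shows "\<exists>l. \<exists>w\<in>OZ. eta k = (eta l)\<^sup>2 - 2 * w"
proof -
  have "odd p" using prime_p assms p_gt_1 by (simp add: prime_odd_nat)
  then obtain m where m: "p = 2 * m + 1" by (rule oddE)
  \<comment> \<open>With \<open>p = 2 * m + 1\<close>, the number \<open>m + 1\<close> is the
    inverse of 2 modulo \<open>p\<close>, so the product is half of \<open>g ^ k\<close>.\<close>
  have "\<not> p dvd g ^ k * (m + 1)"
  proof
    assume "p dvd g ^ k * (m + 1)"
    then have "p dvd m + 1" using prime_dvd_multD[OF prime_p] not_dvd_g_power[of k] by blast
    then have "p \<le> m + 1" by (rule dvd_imp_le) simp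
    then show False using m p_gt_1 by simp
  qed
  then obtain l where l: "[g ^ l = g ^ k * (m + 1)] (mod p)" using g_power_surj by blast
  then have "[g ^ l * 2 = g ^ k * (m + 1) * 2] (mod p)" by (rule cong_scalar_right)
  moreover have "g ^ k * (m + 1) * 2 = g ^ k + g ^ k * p" unfolding m by (simp add: algebra_simps)
  ultimately have "[g ^ l * 2 = g ^ k + g ^ k * p] (mod p)" by (simp only:)
  then have "[g ^ l * 2 = g ^ k] (mod p)" by (simp only: cong_def mod_mult_self1)
  then have sq: "(e l)\<^sup>2 = e k"
    unfolding e_def using primitive_root_power_eq_iff[OF root] by (simp only: flip: power_mult)
  have sq': "(e (l + n * r))\<^sup>2 = e (k + n * r)" for r
    using arg_cong[OF sq, of "gal (n * r)"] by (simp add: gal_power ZX_K e_ZX gal_e add.commute)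
  define w where "w = (\<Sum>t<h. \<Sum>r<t. e (l + n * r) * e (l + n * t))"
  have wZX: "w \<in> ZX" unfolding w_def by (intro ZX_sum ZX_mult e_ZX)
  have eq: "(eta l)\<^sup>2 = eta k + 2 * w"
    unfolding eta_def square_sum sq' w_def ..
  then have "of_int 2 * w = (eta l)\<^sup>2 - eta k" by simp
  moreover have "(eta l)\<^sup>2 - eta k \<in> OZ" by (intro OZ_diff OZ_power eta_OZ)
  ultimately have "gal n (of_int 2 * w) = of_int 2 * w" unfolding OZ_def by simp
  then have "gal n w = w" using wZX gal_int[of n 2] by (simp add: gal_mult ZX_K int_ZX[of 2, simplified])
  then have "w \<in> OZ" using wZX unfolding OZ_def by blast
  then show ?thesis using eq by (intro exI[of _ l] bexI[of _ w]) auto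
qed

end

section \<open>The cyclic field generated by the periods\<close>

lemma mult_mod_bij:
  fixes m n :: nat
  assumes "coprime m n" "n > 0"
  shows "bij_betw (\<lambda>i. m * i mod n) {..<n} {..<n}"
proof -
  have inj: "inj_on (\<lambda>i. m * i mod n) {..<n}"
  proof (rule inj_onI)
    fix i j assume ij: "i \<in> {..<n}" "j \<in> {..<n}" "m * i mod n = m * j mod n"
    then have "[m * i = m * j] (mod n)" by (simp add: cong_def)
    then have "[i = j] (mod n)" using cong_mult_lcancel_nat[OF assms(1)] by blast
    then show "i = j" using ij by (simp add: cong_def)
  qed
  moreover have "(\<lambda>i. m * i mod n) ` {..<n} \<subseteq> {..<n}" using assms(2) by auto
  ultimately show ?thesis unfolding bij_betw_def using endo_inj_surj[of "{..<n}"] by blast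
qed

text \<open>\<open>Z\<close> is an abstract cyclic field of degree \<open>n\<close> inside the
  cyclotomic one; that it contains the periods is proved in \<open>eta_Z\<close>. The identity
  \<open>S_n\<close> comes from the algebra through \<open>cyclic_generation_S_pow\<close>.\<close>

locale period_field = gaussian_periods +
  fixes Z :: "complex set" and S :: "complex \<Rightarrow> complex"
  assumes Z_subfield: "complex_subfield Z"
    and Z_degree: "rat_degree Z = n"
    and Z_fixed: "{z \<in> Z. \<forall>\<tau>\<in>galois_group Z. \<tau> z = z} = \<rat>"
    and S_generator: "galois_generator Z S"
    and Z_cyclotomic: "Z \<subseteq> cyclotomic_subfield p"
    and S_n: "\<And>z. z \<in> Z \<Longrightarrow> (S ^^ n) z = z"
    and prime_n: "Factorial_Ring.prime n" and odd_n: "odd n"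
begin

lemma n_gt_1: "n > 1" using prime_n by (rule prime_gt_1_nat)

lemma p_neq_2: "p \<noteq> 2"
proof
  assume "p = 2"
  then have "n dvd 1" using n_dvd by simp
  then show False using n_gt_1 by simp
qed

section \<open>Arithmetic of \<open>Z\<close> and the action of \<open>S\<close>\<close>

lemma Z_0: "0 \<in> Z" and Z_1: "1 \<in> Z"
  and Z_add: "x \<in> Z \<Longrightarrow> y \<in> Z \<Longrightarrow> x + y \<in> Z"
  and Z_diff: "x \<in> Z \<Longrightarrow> y \<in> Z \<Longrightarrow> x - y \<in> Z"
  and Z_mult: "x \<in> Z \<Longrightarrow> y \<in> Z \<Longrightarrow> x * y \<in> Z"
  and Z_inverse: "x \<in> Z \<Longrightarrow> inverse x \<in> Z"
  using Z_subfield unfolding complex_subfield_def by auto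

lemma Z_divide: "x \<in> Z \<Longrightarrow> y \<in> Z \<Longrightarrow> x / y \<in> Z"
  unfolding divide_inverse by (intro Z_mult Z_inverse)

lemma Z_K: "z \<in> Z \<Longrightarrow> z \<in> K"
  using Z_cyclotomic cyclotomic_subfield_K by blast

lemma Rats_Z: "x \<in> \<rat> \<Longrightarrow> x \<in> Z" using Z_fixed by blast

lemma Z_sum: "(\<And>i. i \<in> A \<Longrightarrow> f i \<in> Z) \<Longrightarrow> sum f A \<in> Z"
  by (induction A rule: infinite_finite_induct) (auto intro: Z_0 Z_add)

lemma Z_power: "x \<in> Z \<Longrightarrow> x ^ k \<in> Z"
  by (induction k) (auto intro: Z_1 Z_mult)

lemma S_galois: "S \<in> galois_group Z" using S_generator unfolding galois_generator_def by blast

lemma S_add: "x \<in> Z \<Longrightarrow> y \<in> Z \<Longrightarrow> S (x + y) = S x + S y"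
  and S_mult: "x \<in> Z \<Longrightarrow> y \<in> Z \<Longrightarrow> S (x * y) = S x * S y"
  using S_galois unfolding galois_group_def by auto

lemma S_Z: "z \<in> Z \<Longrightarrow> S z \<in> Z"
  using S_galois unfolding galois_group_def by (auto simp: bij_betw_def)

lemma S_Rats: "x \<in> \<rat> \<Longrightarrow> S x = x"
  using Z_fixed S_galois by blast

lemma S_0: "S 0 = 0" and S_1: "S 1 = 1" using S_Rats[of 0] S_Rats[of 1] by auto

lemma S_sum: "(\<And>i. i \<in> A \<Longrightarrow> f i \<in> Z) \<Longrightarrow> S (sum f A) = (\<Sum>i\<in>A. S (f i))"
  by (induction A rule: infinite_finite_induct) (auto simp: S_0 S_add Z_sum)

lemma S_pow_Z: "z \<in> Z \<Longrightarrow> (S ^^ k) z \<in> Z"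
  by (induction k) (auto intro: S_Z)

lemma S_pow_mult: "x \<in> Z \<Longrightarrow> y \<in> Z \<Longrightarrow> (S ^^ k) (x * y) = (S ^^ k) x * (S ^^ k) y"
  by (induction k) (auto simp: S_mult S_pow_Z)

lemma S_pow_Rats: "x \<in> \<rat> \<Longrightarrow> (S ^^ k) x = x"
  by (induction k) (auto simp: S_Rats)

lemma S_fixed_Rats: assumes "z \<in> Z" "S z = z" shows "z \<in> \<rat>"
proof -
  have "(S ^^ k) z = z" for k by (induction k) (use assms in auto)
  then have "\<forall>\<tau>\<in>galois_group Z. \<tau> z = z"
    using S_generator assms(1) unfolding galois_generator_def by metis
  then show ?thesis using Z_fixed assms(1) by blast
qed

lemma S_pow_period: "z \<in> Z \<Longrightarrow> (S ^^ (k + n)) z = (S ^^ k) z"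
  using S_n by (simp add: funpow_add)

lemma S_pow_cong: assumes "z \<in> Z" "[i = j] (mod n)" shows "(S ^^ i) z = (S ^^ j) z"
proof -
  have "(S ^^ (i + n * k)) z = (S ^^ i) z" for i k
  proof (induction k)
    case (Suc k)
    then show ?case using S_pow_period[OF assms(1), of "i + n * k"] by (simp only: mult_Suc_right ac_simps)
  qed simp
  from this[of "i mod n" "i div n"] this[of "j mod n" "j div n"]
  show ?thesis using assms(2) by (simp add: cong_def)
qed

text \<open>Since \<open>S\<close> is only an automorphism of \<open>Z\<close>, its coefficientwise action on polynomials over \<open>Z\<close>
  is expressed as a relation.\<close>

definition S_poly :: "complex poly \<Rightarrow> complex poly \<Rightarrow> bool" where
  "S_poly F G \<longleftrightarrow> (\<forall>i. coeff F i \<in> Z \<and> S (coeff F i) = coeff G i)"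

lemma S_poly_mult: assumes "S_poly F G" "S_poly F' G'" shows "S_poly (F * F') (G * G')"
proof -
  have *: "coeff F i \<in> Z" "S (coeff F i) = coeff G i" "coeff F' i \<in> Z" "S (coeff F' i) = coeff G' i" for i
    using assms unfolding S_poly_def by auto
  then show ?thesis unfolding S_poly_def coeff_mult
    by (simp add: Z_sum Z_mult S_sum S_mult)
qed

lemma S_poly_prod: "(\<And>i. i \<in> A \<Longrightarrow> S_poly (F i) (G i)) \<Longrightarrow> S_poly (prod F A) (prod G A)"
proof (induction A rule: infinite_finite_induct)
  case (insert a A)
  then show ?case by (simp add: S_poly_mult)
qed (auto simp: S_poly_def coeff_1 Z_0 Z_1 S_0 S_1)

lemma S_poly_linear: "a \<in> Z \<Longrightarrow> b \<in> Z \<Longrightarrow> S_poly [:a, b:] [:S a, S b:]"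
  unfolding S_poly_def by (auto simp: coeff_pCons Z_0 S_0 split: nat.split)

text \<open>Applying \<open>S\<close> replaces \<open>z\<close> by \<open>S z\<close>, which
  permutes the factors cyclically. The linear factor \<open>L\<close> is kept general: it is
  \<open>X - w\<close> in \<open>gal_1_Z\<close> and \<open>w X - l\<close> in
  \<open>norm_poly_beta'\<close>.\<close>

lemma norm_poly_invariant:
  assumes L: "\<And>w. w \<in> Z \<Longrightarrow> S_poly (L w) (L (S w))" and z: "z \<in> Z"
  shows "coeff (\<Prod>i<n. L ((S ^^ i) z)) k \<in> Z"
    and "S (coeff (\<Prod>i<n. L ((S ^^ i) z)) k) = coeff (\<Prod>i<n. L ((S ^^ i) z)) k"
proof -
  have "S_poly (\<Prod>i<n. L ((S ^^ i) z)) (\<Prod>i<n. L ((S ^^ (i + 1)) z))"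
    using S_poly_prod[of "{..<n}" "\<lambda>i. L ((S ^^ i) z)" "\<lambda>i. L (S ((S ^^ i) z))"] L S_pow_Z[OF z] by simp
  also have "(\<Prod>i<n. L ((S ^^ (i + 1)) z)) = (\<Prod>i<n. L ((S ^^ i) z))"
    by (rule prod_shift_periodic[of "\<lambda>i. L ((S ^^ i) z)"]) (simp only: S_pow_period[OF z])
  finally show "coeff (\<Prod>i<n. L ((S ^^ i) z)) k \<in> Z"
    "S (coeff (\<Prod>i<n. L ((S ^^ i) z)) k) = coeff (\<Prod>i<n. L ((S ^^ i) z)) k"
    unfolding S_poly_def by auto
qed

text \<open>A conjugate of \<open>z \<in> Z\<close> is again a root of \<open>\<Prod>\<^bsub>i<n\<^esub> (X - S\<^sup>i z) \<in> \<rat>[X]\<close>.\<close>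

lemma gal_1_Z: assumes z: "z \<in> Z" shows "gal 1 z \<in> Z"
proof -
  define F where "F = (\<Prod>i<n. [:- ((S ^^ i) z), 1:])"
  have L: "S_poly [:- w, 1:] [:- S w, 1:]" if "w \<in> Z" for w
  proof -
    have "S (- 1 * w) = - 1 * S w" using that S_Rats[of "-1"] Rats_Z[of "-1"] by (subst S_mult) auto
    then show ?thesis using S_poly_linear[of "- w" 1] that Z_diff[OF Z_0 that] Z_1 S_1 by simp
  qed
  have F: "coeff F k \<in> \<rat>" for k
    unfolding F_def using norm_poly_invariant[of "\<lambda>w. [:- w, 1:]", OF L z] by (rule S_fixed_Rats) auto
  have "poly F z = 0" unfolding F_def poly_prod using n_gt_1
    by (intro prod_zero bexI[of _ 0]) auto
  then have "gal 1 (\<Sum>k\<le>degree F. coeff F k * z ^ k) = 0"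
    unfolding poly_altdef using gal_int[of 1 0] by simp
  moreover have "gal 1 (coeff F k * z ^ k) = coeff F k * gal 1 z ^ k" "coeff F k * z ^ k \<in> K" for k
  proof -
    obtain r where r: "coeff F k = of_rat r" using F[of k] by (rule Rats_cases)
    show "gal 1 (coeff F k * z ^ k) = coeff F k * gal 1 z ^ k" "coeff F k * z ^ k \<in> K"
      unfolding r using Z_K[OF z] Z_K[OF Z_power[OF z]]
      by (simp_all add: gal_mult rat_K gal_rat gal_power K_mult)
  qed
  ultimately have "poly F (gal 1 z) = 0" unfolding poly_altdef by (simp add: gal_sum)
  then obtain i where "i < n" "gal 1 z = (S ^^ i) z" unfolding F_def poly_prod by auto
  then show ?thesis using S_pow_Z[OF z] by simp
qed

lemma gal_Z: "z \<in> Z \<Longrightarrow> gal j z \<in> Z"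
proof (induction j)
  case 0
  then show ?case using gal_0 Z_K by simp
next
  case (Suc j)
  then show ?case using gal_gal[of z 1 j] gal_1_Z Z_K by fastforce
qed

section \<open>Comparison of the cyclotomic automorphisms with \<open>S\<close>\<close>

lemma gal_1_galois: "restrict (gal 1) Z \<in> galois_group Z"
proof -
  have "bij_betw (gal 1) Z Z"
    unfolding bij_betw_def
  proof (intro conjI equalityI subsetI)
    show "inj_on (gal 1) Z" using gal_inj Z_K by (intro inj_onI) blast
    fix z assume z: "z \<in> Z"
    have "1 + (p - 2) = p - 1" using p_gt_1 by simp
    then have "[1 + (p - 2) = 0] (mod (p - 1))" by (simp only: cong_0_iff dvd_refl)
    then have "gal (1 + (p - 2)) z = gal 0 z" by (rule gal_cong[OF Z_K[OF z]])
    then have "gal 1 (gal (p - 2) z) = z" by (simp only: gal_gal[OF Z_K[OF z]] gal_0[OF Z_K[OF z]])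
    then show "z \<in> gal 1 ` Z" using gal_Z[OF z] by (metis imageI)
  qed (use gal_1_Z in auto)
  then have "bij_betw (restrict (gal 1) Z) Z Z"
    by (subst bij_betw_cong[of Z _ "gal 1"]) auto
  then show ?thesis unfolding galois_group_def
    using Z_add Z_mult by (auto simp: gal_add gal_mult Z_K)
qed

lemma ex_gal_1_eq_S_pow: "\<exists>k. \<forall>z\<in>Z. gal 1 z = (S ^^ k) z"
proof -
  obtain k where k: "\<forall>z\<in>Z. restrict (gal 1) Z z = (S ^^ k) z"
    using S_generator gal_1_galois unfolding galois_generator_def by blast
  then show ?thesis by (intro exI[of _ k]) auto
qed

text \<open>This exponent relates two generators of the Galois group of \<open>Z\<close>;
  \<open>coprime_gal_1_exp\<close> makes it invertible modulo \<open>n\<close>, so that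
  \<open>S\<close> is in turn some \<open>gal m\<close> on \<open>Z\<close>.\<close>

definition gal_1_exp :: nat where "gal_1_exp = (SOME k. \<forall>z\<in>Z. gal 1 z = (S ^^ k) z)"

lemma gal_1_eq: "z \<in> Z \<Longrightarrow> gal 1 z = (S ^^ gal_1_exp) z"
  using someI_ex[OF ex_gal_1_eq_S_pow] unfolding gal_1_exp_def by blast

lemma gal_eq_S_pow: "z \<in> Z \<Longrightarrow> gal j z = (S ^^ (gal_1_exp * j)) z"
proof (induction j)
  case 0
  then show ?case using gal_0 Z_K by simp
next
  case (Suc j)
  have "gal (Suc j) z = gal 1 (gal j z)" using gal_gal[OF Z_K[OF Suc.prems], of 1 j] by simp
  also have "\<dots> = (S ^^ gal_1_exp) (gal j z)" by (rule gal_1_eq[OF gal_Z[OF Suc.prems]])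
  also have "\<dots> = (S ^^ gal_1_exp) ((S ^^ (gal_1_exp * j)) z)" using Suc by simp
  finally show ?case by (simp add: funpow_add)
qed

lemma gal_n_Z: "z \<in> Z \<Longrightarrow> gal n z = z"
  unfolding gal_eq_S_pow using S_pow_cong[of z "gal_1_exp * n" 0] by (simp add: cong_def)

text \<open>A dimension count: \<open>Z\<close> has dimension \<open>n\<close> and lies in the fixed
  field of \<open>gal n\<close>, which the \<open>n\<close> periods span over the rationals. A
  period outside \<open>Z\<close> would extend a basis of \<open>Z\<close> to \<open>n + 1\<close>
  independent vectors in that span.\<close>

lemma eta_Z: "eta i \<in> Z"
proof (rule ccontr)
  assume eta: "eta i \<notin> Z"
  interpret V: vector_space "\<lambda>(r::rat) (z::complex). of_rat r * z"
    by unfold_locales (auto simp: algebra_simps of_rat_add of_rat_mult)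
  have dim: "V.dim Z = n" using Z_degree unfolding rat_degree_def .
  obtain B where B: "B \<subseteq> Z" "V.independent B" "Z \<subseteq> V.span B" "card B = V.dim Z"
    using V.basis_exists by blast
  have "V.subspace Z" by (rule V.subspaceI) (auto intro: Z_0 Z_add Z_mult Rats_Z[OF Rats_of_rat])
  then have "V.span B \<subseteq> Z" using B(1) V.span_minimal by blast
  then have nspan: "eta i \<notin> V.span B" using eta by blast
  then have ind: "V.independent (insert (eta i) B)" using B(2) V.independent_insertI by blast
  \<comment> \<open>An infinite set would have the default cardinality 0, which \<open>n > 0\<close>
    excludes.\<close>
  have finB: "finite B" using B(4) dim nh_pos by (metis card.infinite less_irrefl)
  let ?E = "eta ` {..<n}"
  have comb: "x \<in> V.span ?E" if cx: "\<forall>i. c i \<in> \<rat>" "x = (\<Sum>i<n. c i * eta i)" for c x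
    unfolding cx(2)
  proof (rule V.span_sum)
    fix i assume i: "i \<in> {..<n}"
    from cx(1) have "c i \<in> \<rat>" by blast
    then obtain r where r: "c i = of_rat r" by (rule Rats_cases)
    have "eta i \<in> V.span ?E" using i by (intro V.span_base) blast
    from V.span_scale[OF this, of r] show "c i * eta i \<in> V.span ?E" unfolding r .
  qed
  have "insert (eta i) B \<subseteq> V.span ?E"
  proof
    fix x assume "x \<in> insert (eta i) B"
    then have "x \<in> K \<and> gal n x = x"
      using B(1) Z_K gal_n_Z eta_OZ[of i] OZ_K unfolding OZ_def by auto
    then obtain c where "\<forall>i. c i \<in> \<rat>" "x = (\<Sum>i<n. c i * eta i)" using K_fixed_periods by blast
    then show "x \<in> V.span ?E" by (rule comb)
  qed
  then have "card (insert (eta i) B) \<le> card ?E" using V.independent_span_bound[OF _ ind] by blast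
  also have "\<dots> \<le> n" using card_image_le[of "{..<n}" eta] by simp
  finally have "card (insert (eta i) B) \<le> n" .
  moreover have "eta i \<notin> B" using nspan V.span_base by blast
  ultimately show False using finB B(4) dim by simp
qed

lemma OZ_Z: "x \<in> OZ \<Longrightarrow> x \<in> Z"
proof -
  assume "x \<in> OZ"
  then obtain c where "\<forall>i. c i \<in> \<int>" "x = (\<Sum>i<n. c i * eta i)" using OZ_periods by blast
  then show ?thesis using Ints_subset_Rats Rats_Z by (auto intro!: Z_sum Z_mult eta_Z)
qed

text \<open>Since \<open>n\<close> is prime, it would otherwise divide the exponent; then
  \<open>gal 1\<close> would fix \<open>eta 0\<close>, and two distinct periods would agree.\<close>

lemma coprime_gal_1_exp: "coprime gal_1_exp n"
proof (rule ccontr)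
  assume "\<not> coprime gal_1_exp n"
  then have "n dvd gal_1_exp"
    using prime_imp_coprime_nat[OF prime_n, of gal_1_exp] algebraic_semidom_class.coprime_commute by blast
  then have "[gal_1_exp = 0] (mod n)" by (simp add: cong_0_iff)
  then have "gal 1 (eta 0) = eta 0" using S_pow_cong[OF eta_Z, of gal_1_exp 0] gal_1_eq[OF eta_Z] by simp
  then show False using eta_0_neq_1[OF n_gt_1] gal_eta[of 1 0] by simp
qed

lemma ex_S_eq_gal: "\<exists>m. \<forall>z\<in>Z. S z = gal m z"
proof -
  obtain m where m: "[gal_1_exp * m = 1] (mod n)" using cong_solve_coprime_nat[OF coprime_gal_1_exp] by (auto simp: cong_def)
  have "S z = gal m z" if "z \<in> Z" for z
    using S_pow_cong[OF that m] gal_eq_S_pow[OF that] by simp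
  then show ?thesis by blast
qed

lemma S_pow_eq_gal: "\<exists>m. \<forall>z\<in>Z. (S ^^ i) z = gal m z"
proof (induction i)
  case 0
  then show ?case using gal_0 Z_K by (intro exI[of _ 0]) simp
next
  case (Suc i)
  then obtain m where m: "\<forall>z\<in>Z. (S ^^ i) z = gal m z" by blast
  obtain m' where "\<forall>z\<in>Z. S z = gal m' z" using ex_S_eq_gal by blast
  then have "\<forall>z\<in>Z. (S ^^ Suc i) z = gal (m' + m) z" using m gal_Z gal_gal[OF Z_K] by simp
  then show ?case by blast
qed

lemma S_pow_OZ: "x \<in> OZ \<Longrightarrow> (S ^^ i) x \<in> OZ"
  using S_pow_eq_gal[of i] gal_OZ OZ_Z by metis

lemma S_OZ: "x \<in> OZ \<Longrightarrow> S x \<in> OZ" using S_pow_OZ[of x 1] by simp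

lemma pi_dvd_gal: "x \<in> ZX \<Longrightarrow> pi_dvd x \<Longrightarrow> pi_dvd (gal k x)"
  using pi_dvd_add[OF _ pi_dvd_mult[OF pi_dvd_diff_gal int_ZX[of "-1"]], of x x k] by simp

lemma pi_dvd_S_pow: "x \<in> OZ \<Longrightarrow> pi_dvd x \<Longrightarrow> pi_dvd ((S ^^ i) x)"
  using S_pow_eq_gal[of i] pi_dvd_gal OZ_Z OZ_ZX by metis

lemma pi_dvd_diff_S: "x \<in> OZ \<Longrightarrow> pi_dvd (x - S x)"
  using ex_S_eq_gal pi_dvd_diff_gal OZ_Z OZ_ZX by metis

lemma S_fixed_Ints: assumes "x \<in> OZ" "S x = x" shows "x \<in> \<int>"
proof -
  have "(S ^^ k) x = x" for k by (induction k) (use assms in auto)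
  then have "gal 1 x = x" using gal_1_eq[OF OZ_Z[OF assms(1)]] by simp
  then show ?thesis using gal_1_fixed_Ints OZ_ZX[OF assms(1)] by blast
qed

lemma gal_eq_S_pow_mod: "z \<in> Z \<Longrightarrow> gal j z = (S ^^ (gal_1_exp * j mod n)) z"
  using gal_eq_S_pow S_pow_cong[of z "gal_1_exp * j mod n" "gal_1_exp * j"] by (simp add: cong_def)

text \<open>Multiplication by \<open>gal_1_exp\<close> modulo \<open>n\<close> permutes the indices,
  so the conjugates of \<open>eta 0\<close> under powers of \<open>S\<close> are the periods in
  another order.\<close>

lemma OZ_eq_span: "OZ = {\<Sum>k<n. of_int (c k) * (S ^^ k) (eta 0) | c. True}"
proof (intro equalityI subsetI)
  fix x assume "x \<in> OZ"
  then obtain c where c: "\<forall>i. c i \<in> \<int>" "x = (\<Sum>i<n. c i * eta i)" using OZ_periods by blast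
  have bij: "bij_betw (\<lambda>i. gal_1_exp * i mod n) {..<n} {..<n}" using mult_mod_bij coprime_gal_1_exp nh_pos by blast
  \<comment> \<open>Real part and floor only read off an integer given as a complex number; the
    inverse of the index permutation reorders the coefficients.\<close>
  define c' where "c' k = \<lfloor>Re (c (the_inv_into {..<n} (\<lambda>i. gal_1_exp * i mod n) k))\<rfloor>" for k
  have "of_int (c' (gal_1_exp * i mod n)) = c i" if "i < n" for i
  proof -
    obtain a where "c i = of_int a" using c(1) Ints_cases by metis
    moreover have "the_inv_into {..<n} (\<lambda>i. gal_1_exp * i mod n) (gal_1_exp * i mod n) = i"
      using the_inv_into_f_f[of "\<lambda>i. gal_1_exp * i mod n" "{..<n}" i] bij that by (simp add: bij_betw_def)
    ultimately show ?thesis unfolding c'_def by simp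
  qed
  moreover have "eta i = (S ^^ (gal_1_exp * i mod n)) (eta 0)" for i
    using gal_eta[of i 0] gal_eq_S_pow_mod[OF eta_Z] by simp
  ultimately have "x = (\<Sum>i<n. of_int (c' (gal_1_exp * i mod n)) * (S ^^ (gal_1_exp * i mod n)) (eta 0))"
    unfolding c(2) by (intro sum.cong refl) (metis lessThan_iff)
  also have "\<dots> = (\<Sum>k<n. of_int (c' k) * (S ^^ k) (eta 0))"
    using bij by (rule sum.reindex_bij_betw)
  finally show "x \<in> {\<Sum>k<n. of_int (c k) * (S ^^ k) (eta 0) | c. True}" by blast
next
  fix x assume "x \<in> {\<Sum>k<n. of_int (c k) * (S ^^ k) (eta 0) | c. True}"
  then show "x \<in> OZ" by (auto intro!: OZ_sum OZ_mult OZ_int S_pow_OZ eta_OZ)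
qed

section \<open>Norms of \<open>beta 0\<close> and \<open>beta'\<close>\<close>

lemma beta_Z: "beta j \<in> Z" by (rule OZ_Z[OF beta_OZ])

lemma prod_S_pow_beta: "(\<Prod>i<n. (S ^^ i) (beta 0)) = of_nat p"
proof -
  have bij: "bij_betw (\<lambda>i. gal_1_exp * i mod n) {..<n} {..<n}" using mult_mod_bij coprime_gal_1_exp nh_pos by blast
  have "(\<Prod>i<n. (S ^^ i) (beta 0)) = (\<Prod>i<n. (S ^^ (gal_1_exp * i mod n)) (beta 0))"
    using bij by (rule prod.reindex_bij_betw[symmetric])
  also have "\<dots> = (\<Prod>i<n. beta i)"
    by (simp only: gal_eq_S_pow_mod[OF beta_Z, symmetric] gal_beta add_0_right)
  finally show ?thesis unfolding prod_beta .
qed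

text \<open>Hull's \<open>y\<close> is \<open>(l - u) / beta'\<close>.\<close>

definition beta' :: complex where "beta' = of_nat p / beta 0 ^ (n - 1)"

lemma beta'_eq: "beta' * beta 0 ^ (n - 1) = of_nat p"
  unfolding beta'_def using beta_neq_0 by simp

lemma beta'_neq_0: "beta' \<noteq> 0" unfolding beta'_def using beta_neq_0 p_gt_1 by simp

text \<open>All \<open>beta j\<close> are associates in \<open>OZ\<close>, since each generates the
  prime above \<open>p\<close>. Their product \<open>p\<close> is therefore associated to
  \<open>beta 0 ^ n\<close>, and dividing by \<open>beta 0 ^ (n - 1)\<close> leaves an associate of
  \<open>beta 0\<close>.\<close>

lemma beta'_div_beta: "\<exists>w\<in>OZ. beta' = beta 0 * w" and beta_div_beta': "\<exists>w\<in>OZ. beta 0 = beta' * w"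
proof -
  have pow: "beta 0 ^ n = beta 0 * beta 0 ^ (n - 1)" using n_gt_1 by (simp flip: power_Suc)
  have "\<forall>j. \<exists>w. w \<in> OZ \<and> beta j = beta 0 * w" using OZ_div_beta[OF beta_OZ pi_dvd_beta] by blast
  from choice[OF this] obtain w where w: "\<And>j. w j \<in> OZ" "\<And>j. beta j = beta 0 * w j" by blast
  have "of_nat p = (\<Prod>j<n. beta 0 * w j)" unfolding prod_beta[symmetric] by (intro prod.cong refl w(2))
  also have "\<dots> = beta 0 ^ (n - 1) * (beta 0 * (\<Prod>j<n. w j))"
    by (simp add: prod.distrib pow mult_ac)
  finally have "beta' = beta 0 * (\<Prod>j<n. w j)" unfolding beta'_def using beta_neq_0 by simp
  then show "\<exists>w\<in>OZ. beta' = beta 0 * w" using OZ_prod[of "{..<n}" w] w(1) by blast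
  have "\<forall>j. \<exists>w. w \<in> OZ \<and> beta 0 = beta j * w" using OZ_div_beta[OF beta_OZ pi_dvd_beta] by blast
  from choice[OF this] obtain v where v: "\<And>j. v j \<in> OZ" "\<And>j. beta 0 = beta j * v j" by blast
  have "beta 0 ^ n = (\<Prod>j<n. beta 0)" by simp
  also have "\<dots> = (\<Prod>j<n. beta j * v j)" by (intro prod.cong refl v(2))
  also have "\<dots> = of_nat p * (\<Prod>j<n. v j)" by (simp add: prod.distrib prod_beta)
  also have "\<dots> = beta 0 ^ (n - 1) * (beta' * (\<Prod>j<n. v j))" unfolding beta'_eq[symmetric] by simp
  finally have "beta 0 = beta' * (\<Prod>j<n. v j)" unfolding pow using beta_neq_0[of 0] by simp
  then show "\<exists>w\<in>OZ. beta 0 = beta' * w" using OZ_prod[of "{..<n}" v] v(1) by blast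
qed

lemma beta'_OZ: "beta' \<in> OZ" using beta'_div_beta OZ_mult beta_OZ by auto

lemma pi_dvd_beta': "pi_dvd beta'" using beta'_div_beta pi_dvd_mult[OF pi_dvd_beta] OZ_ZX by auto

text \<open>Total ramification puts \<open>z - S z\<close> into the prime above \<open>p\<close>,
  which \<open>beta'\<close> generates. This gives the integrality of the correction term in
  \<open>emb_y\<close>.\<close>

lemma diff_S_div_beta': assumes "z \<in> OZ" shows "(z - S z) / beta' \<in> OZ"
proof -
  obtain v where v: "v \<in> OZ" "z - S z = beta 0 * v"
    using OZ_div_beta[OF OZ_diff[OF assms S_OZ[OF assms]] pi_dvd_diff_S[OF assms]] by blast
  obtain w where w: "w \<in> OZ" "beta 0 = beta' * w" using beta_div_beta' by blast
  have "(z - S z) / beta' = w * v" unfolding v(2) w(2) using beta'_neq_0 by simp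
  then show ?thesis using OZ_mult v(1) w(1) by simp
qed

lemma prod_S_pow_beta': "(\<Prod>i<n. (S ^^ i) beta') = of_nat p"
proof -
  have S_power: "(S ^^ i) (beta 0 ^ k) = (S ^^ i) (beta 0) ^ k" for i k
  proof (induction k)
    case (Suc k)
    then show ?case by (simp add: S_pow_mult beta_Z Z_power)
  qed (simp add: S_pow_Rats)
  have "(S ^^ i) beta' * (S ^^ i) (beta 0) ^ (n - 1) = of_nat p" for i
    using S_pow_mult[OF OZ_Z[OF beta'_OZ] Z_power[OF beta_Z], of i 0 "n - 1"]
    unfolding beta'_eq S_power by (simp add: S_pow_Rats)
  then have "(\<Prod>i<n. (S ^^ i) beta' * (S ^^ i) (beta 0) ^ (n - 1)) = of_nat p ^ n" by simp
  then have "(\<Prod>i<n. (S ^^ i) beta') * of_nat p ^ (n - 1) = of_nat p ^ n"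
    unfolding prod.distrib by (simp flip: prod_power_distrib add: prod_S_pow_beta)
  moreover have "of_nat p ^ n = (of_nat p :: complex) * of_nat p ^ (n - 1)"
    using n_gt_1 by (simp flip: power_Suc)
  ultimately show ?thesis using p_gt_1 by simp
qed

text \<open>Each coefficient is fixed by \<open>S\<close> and lies in \<open>OZ\<close>, so it is an
  integer. Above degree 0 every term contains a conjugate of \<open>beta'\<close>, which forces
  divisibility by \<open>p\<close>; the coefficient at \<open>n\<close> is the norm \<open>p\<close>
  of \<open>beta'\<close>, hence \<open>f n = 1\<close>.\<close>

lemma norm_poly_beta':
  fixes l :: int
  defines "F \<equiv> \<Prod>i<n. [:- of_int l, (S ^^ i) beta':]"
  shows "\<exists>f::nat \<Rightarrow> int. f n = 1 \<and> coeff F 0 = of_int ((- l) ^ n) \<and>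
    (\<forall>i\<ge>1. coeff F i = of_nat p * of_int (f i))" and "degree F \<le> n"
proof -
  have L: "S_poly [:- of_int l, w:] [:- of_int l, S w:]" if "w \<in> Z" for w
  proof -
    have "- of_int l \<in> \<rat>" by simp
    from S_poly_linear[OF Rats_Z[OF this] that] S_Rats[OF this] show ?thesis by simp
  qed
  have inv: "S (coeff F i) = coeff F i" for i
    unfolding F_def using norm_poly_invariant(2)[of "\<lambda>w. [:- of_int l, w:]", OF L OZ_Z[OF beta'_OZ]] .
  \<comment> \<open>Partial products need not be invariant under \<open>S\<close>, so the induction
    speaks of \<open>OZ\<close> and of divisibility by \<open>1 - \<xi>\<close>; integers and
    \<open>p\<close> enter with the full product.\<close>
  have part: "coeff (\<Prod>i<k. [:- of_int l, (S ^^ i) beta':]) 0 = of_int ((- l) ^ k) \<and>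
    (\<forall>j. coeff (\<Prod>i<k. [:- of_int l, (S ^^ i) beta':]) j \<in> OZ) \<and>
    (\<forall>j\<ge>1. pi_dvd (coeff (\<Prod>i<k. [:- of_int l, (S ^^ i) beta':]) j)) \<and>
    degree (\<Prod>i<k. [:- of_int l, (S ^^ i) beta':]) \<le> k \<and>
    coeff (\<Prod>i<k. [:- of_int l, (S ^^ i) beta':]) k = (\<Prod>i<k. (S ^^ i) beta')" for k
  proof (induction k)
    case 0
    have "pi_dvd 0" unfolding pi_dvd_def using ZX_0 by (intro bexI[of _ 0]) auto
    then show ?case by (auto simp: coeff_1 OZ_0 OZ_1)
  next
    case (Suc k)
    define G where "G = (\<Prod>i<k. [:- of_int l, (S ^^ i) beta':])"
    define b where "b = (S ^^ k) beta'"
    have b: "b \<in> OZ" "pi_dvd b" unfolding b_def using S_pow_OZ pi_dvd_S_pow beta'_OZ pi_dvd_beta' by auto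
    have G: "coeff G 0 = of_int ((- l) ^ k)" "\<And>j. coeff G j \<in> OZ" "\<And>j. j \<ge> 1 \<Longrightarrow> pi_dvd (coeff G j)"
      "degree G \<le> k" "coeff G k = (\<Prod>i<k. (S ^^ i) beta')"
      using Suc unfolding G_def by auto
    have prod: "(\<Prod>i<Suc k. [:- of_int l, (S ^^ i) beta':]) = G * [:- of_int l, b:]"
      unfolding G_def b_def by simp
    have c0: "coeff (G * [:- of_int l, b:]) 0 = - of_int l * coeff G 0"
      by (simp add: mult.commute[of G])
    have cS: "coeff (G * [:- of_int l, b:]) (Suc j) = of_int (- l) * coeff G (Suc j) + b * coeff G j" for j
      by (simp add: mult.commute[of G])
    have "coeff (G * [:- of_int l, b:]) j \<in> OZ" for j
    proof (cases j)
      case 0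
      then show ?thesis using OZ_mult[OF OZ_int[of "- l"] G(2)[of 0]] c0 by simp
    next
      case (Suc i)
      then show ?thesis unfolding Suc cS by (intro OZ_add OZ_mult OZ_int b G)
    qed
    moreover have "pi_dvd (coeff (G * [:- of_int l, b:]) j)" if j1: "j \<ge> 1" for j
    proof -
      obtain i where i: "j = Suc i" using j1 by (cases j) auto
      have "pi_dvd (coeff G (Suc i) * of_int (- l))" by (intro pi_dvd_mult G int_ZX) simp
      moreover have "pi_dvd (b * coeff G i)" by (intro pi_dvd_mult b OZ_ZX G)
      ultimately show ?thesis unfolding i cS by (metis pi_dvd_add mult.commute)
    qed
    moreover have "degree (G * [:- of_int l, b:]) \<le> Suc k"
      using degree_mult_le[of G "[:- of_int l, b:]"] G(4) degree_pCons_le[of "- of_int l" "[:b:]"] by simp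
    moreover have "coeff G (Suc k) = 0" using G(4) by (intro coeff_eq_0) simp
    then have "coeff (G * [:- of_int l, b:]) (Suc k) = (\<Prod>i<Suc k. (S ^^ i) beta')"
      using G(5) unfolding cS by (simp add: b_def)
    ultimately show ?case unfolding prod by (simp only: c0 G(1)) simp
  qed
  have F: "coeff F 0 = of_int ((- l) ^ n)" "\<And>j. coeff F j \<in> OZ" "\<And>j. j \<ge> 1 \<Longrightarrow> pi_dvd (coeff F j)"
      "degree F \<le> n" "coeff F n = of_nat p"
    using part[of n] unfolding F_def prod_S_pow_beta' by auto
  have "\<exists>a. coeff F i = of_nat p * of_int a" if i1: "i \<ge> 1" for i
  proof -
    obtain a where a: "coeff F i = of_int a" using S_fixed_Ints[OF F(2) inv] by (rule Ints_cases)
    then have "int p dvd a" using F(3)[OF i1] pi_dvd_int by simp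
    then obtain b where "a = int p * b" unfolding dvd_def by blast
    then show ?thesis using a by (intro exI[of _ b]) simp
  qed
  then have "\<forall>i. \<exists>a. i \<ge> 1 \<longrightarrow> coeff F i = of_nat p * of_int a" by blast
  from choice[OF this] obtain f where f: "\<And>i. i \<ge> 1 \<Longrightarrow> coeff F i = of_nat p * of_int (f i)" by blast
  have "of_nat p * (of_int (f n) :: complex) = of_nat p" using f[of n] F(5) n_gt_1 by simp
  then have "(of_int (f n) :: complex) = 1" using p_gt_1 by simp
  then have "f n = 1" using of_int_eq_1_iff by blast
  then show "\<exists>f::nat \<Rightarrow> int. f n = 1 \<and> coeff F 0 = of_int ((- l) ^ n) \<and>
    (\<forall>i\<ge>1. coeff F i = of_nat p * of_int (f i))" using f F(1) by blast
  show "degree F \<le> n" by (rule F(4))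
qed

end

section \<open>Hull's order\<close>

locale hull_order = period_field p g n \<xi> Z S
  for p g n :: nat and \<xi> :: complex and Z :: "complex set" and S :: "complex \<Rightarrow> complex" +
  fixes emb :: "complex \<Rightarrow> 'a::{division_ring, ring_char_0}" and u y :: 'a and \<sigma> l :: int
  assumes emb_1: "emb 1 = 1"
    and emb_add: "\<And>x y. x \<in> Z \<Longrightarrow> y \<in> Z \<Longrightarrow> emb (x + y) = emb x + emb y"
    and emb_mult: "\<And>x y. x \<in> Z \<Longrightarrow> y \<in> Z \<Longrightarrow> emb (x * y) = emb x * emb y"
    and emb_u: "\<And>z. z \<in> Z \<Longrightarrow> emb z * u = u * emb (S z)"
    and u_n: "u ^ n = of_int \<sigma>"
    and l_n: "[l ^ n = \<sigma>] (mod int p)"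
    and y_def: "of_nat p * y = (of_int l - u) * emb (beta 0 ^ (n - 1))"
begin

section \<open>The embedding of \<open>Z\<close> and commutation rules\<close>

lemma emb_0: "emb 0 = 0" using emb_add[OF Z_0 Z_0] by simp

lemma emb_diff: "x \<in> Z \<Longrightarrow> z \<in> Z \<Longrightarrow> emb (x - z) = emb x - emb z"
  using emb_add[of "x - z" z] Z_diff by (simp add: algebra_simps)

lemma emb_uminus: "x \<in> Z \<Longrightarrow> emb (- x) = - emb x"
  using emb_diff[OF Z_0, of x] emb_0 by simp

lemma emb_of_nat: "emb (of_nat k) = of_nat k"
proof (induction k)
  case (Suc k)
  then show ?case using emb_add[OF Z_1 Rats_Z[of "of_nat k"]] emb_1 by simp
qed (simp add: emb_0)

lemma emb_of_int: "emb (of_int k) = of_int k"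
  using emb_of_nat emb_uminus[OF Rats_Z[of "of_nat _"]] by (cases k rule: int_cases2) auto

lemma int_Z: "of_int k \<in> Z" by (rule Rats_Z) simp

lemma emb_sum: "(\<And>i. i \<in> A \<Longrightarrow> f i \<in> Z) \<Longrightarrow> emb (sum f A) = (\<Sum>i\<in>A. emb (f i))"
  by (induction A rule: infinite_finite_induct) (auto simp: emb_0 emb_add Z_sum)

lemma emb_neq_0: assumes "x \<in> Z" "x \<noteq> 0" shows "emb x \<noteq> 0"
proof
  assume "emb x = 0"
  moreover have "emb (x * inverse x) = emb x * emb (inverse x)" using assms(1) Z_inverse emb_mult by blast
  ultimately show False using assms(2) emb_1 by simp
qed

lemma emb_comm: "x \<in> Z \<Longrightarrow> z \<in> Z \<Longrightarrow> emb x * emb z = emb z * emb x"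
  using emb_mult[of x z] emb_mult[of z x] by (simp add: mult.commute)

lemma emb_u_pow: "z \<in> Z \<Longrightarrow> emb z * u ^ k = u ^ k * emb ((S ^^ k) z)"
proof (induction k)
  case (Suc k)
  have "emb z * u ^ Suc k = (emb z * u ^ k) * u" by (simp only: power_Suc2 mult.assoc)
  also have "\<dots> = u ^ k * (emb ((S ^^ k) z) * u)" using Suc by (simp only: mult.assoc)
  also have "\<dots> = u ^ k * (u * emb (S ((S ^^ k) z)))" using emb_u[OF S_pow_Z[OF Suc.prems]] by simp
  finally show ?case by (simp only: power_Suc2 mult.assoc funpow.simps o_apply)
qed simp

lemma of_nat_p_neq_0: "(of_nat p :: 'a) \<noteq> 0" using p_gt_1 by simp

lemma beta'_Z: "beta' \<in> Z" by (rule OZ_Z[OF beta'_OZ])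

lemma y_beta': "y * emb beta' = of_int l - u"
proof -
  have "of_nat p * (y * emb beta') = (of_int l - u) * (emb (beta 0 ^ (n - 1)) * emb beta')"
    using y_def by (metis mult.assoc)
  also have "emb (beta 0 ^ (n - 1)) * emb beta' = emb (beta' * beta 0 ^ (n - 1))"
    using emb_mult[OF Z_power[OF beta_Z] beta'_Z, of 0 "n - 1"] by (simp add: mult.commute)
  also have "\<dots> = of_nat p" unfolding beta'_eq emb_of_nat ..
  also have "(of_int l - u) * of_nat p = of_nat p * (of_int l - u)" by (rule mult_of_nat_commute[symmetric])
  finally show ?thesis using of_nat_p_neq_0 by simp
qed

text \<open>Both sides agree after right multiplication by \<open>emb beta'\<close>, because
  \<open>y * emb beta'\<close> is \<open>l - u\<close> and the rule for \<open>u\<close> is known.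
  The last term is a twisted derivation, as in a skew polynomial ring.\<close>

lemma emb_y:
  assumes z: "z \<in> Z"
  shows "emb z * y = y * emb (S z) + emb (of_int l * ((z - S z) / beta'))"
proof -
  let ?d = "of_int l * ((z - S z) / beta')"
  have dZ: "?d \<in> Z" by (intro Z_mult Z_divide Z_diff z S_Z beta'_Z int_Z)
  have "emb ?d * emb beta' = emb (?d * beta')" by (rule emb_mult[OF dZ beta'_Z, symmetric])
  also have "?d * beta' = of_int l * (z - S z)" using beta'_neq_0 by simp
  also have "emb \<dots> = of_int l * (emb z - emb (S z))"
    by (subst emb_mult) (auto simp: emb_of_int emb_diff z S_Z int_Z Z_diff)
  finally have d: "emb ?d * emb beta' = of_int l * (emb z - emb (S z))" .
  have "(emb z * y) * emb beta' = emb z * (of_int l - u)" by (simp only: mult.assoc y_beta')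
  also have "\<dots> = of_int l * emb z - u * emb (S z)"
    using emb_u[OF z] by (simp add: right_diff_distrib mult_of_int_commute)
  also have "\<dots> = (of_int l - u) * emb (S z) + of_int l * (emb z - emb (S z))"
    by (simp add: algebra_simps)
  also have "\<dots> = y * emb beta' * emb (S z) + emb ?d * emb beta'" by (simp only: y_beta' d)
  also have "\<dots> = (y * emb (S z) + emb ?d) * emb beta'"
    using emb_comm[OF beta'_Z S_Z[OF z]] by (simp add: distrib_right mult.assoc)
  finally show ?thesis using emb_neq_0[OF beta'_Z beta'_neq_0] by simp
qed

text \<open>A right \<open>OZ\<close>-module, used for \<open>x = u\<close> and for
  \<open>x = y\<close>; the latter gives Hull's order.\<close>

definition power_span :: "'a \<Rightarrow> 'a set" where
  "power_span x = {\<Sum>i<n. x ^ i * emb (c i) | c. \<forall>i. c i \<in> OZ}"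

lemma power_span_0: "0 \<in> power_span x"
  unfolding power_span_def using OZ_0 emb_0 by (intro CollectI exI[of _ "\<lambda>_. 0"]) simp

lemma power_span_add: assumes "a \<in> power_span x" "b \<in> power_span x" shows "a + b \<in> power_span x"
proof -
  obtain c d where "a = (\<Sum>i<n. x ^ i * emb (c i))" "\<forall>i. c i \<in> OZ"
    "b = (\<Sum>i<n. x ^ i * emb (d i))" "\<forall>i. d i \<in> OZ"
    using assms unfolding power_span_def by blast
  then show ?thesis unfolding power_span_def
    by (intro CollectI exI[of _ "\<lambda>i. c i + d i"]) (simp add: emb_add OZ_Z OZ_add sum.distrib distrib_left)
qed

lemma power_span_sum: "(\<And>i. i \<in> A \<Longrightarrow> f i \<in> power_span x) \<Longrightarrow> sum f A \<in> power_span x"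
  by (induction A rule: infinite_finite_induct) (auto intro: power_span_0 power_span_add)

lemma power_span_mult_emb: assumes "a \<in> power_span x" "z \<in> OZ" shows "a * emb z \<in> power_span x"
proof -
  obtain c where "a = (\<Sum>i<n. x ^ i * emb (c i))" "\<forall>i. c i \<in> OZ"
    using assms unfolding power_span_def by blast
  then show ?thesis unfolding power_span_def using assms(2)
    by (intro CollectI exI[of _ "\<lambda>i. c i * z"])
       (simp add: emb_mult OZ_Z OZ_mult sum_distrib_right mult.assoc)
qed

lemma power_span_of_int: "a \<in> power_span x \<Longrightarrow> of_int k * a \<in> power_span x"
  using power_span_mult_emb[OF _ OZ_int, of a x k] by (simp add: emb_of_int mult_of_int_commute)

lemma power_span_uminus: "a \<in> power_span x \<Longrightarrow> - a \<in> power_span x"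
  using power_span_of_int[of a x "-1"] by simp

lemma power_span_diff: "a \<in> power_span x \<Longrightarrow> b \<in> power_span x \<Longrightarrow> a - b \<in> power_span x"
  using power_span_add[OF _ power_span_uminus] by simp

lemma power_span_I: assumes "i < n" "z \<in> OZ" shows "x ^ i * emb z \<in> power_span x"
proof -
  have "(\<Sum>j<n. x ^ j * emb (if j = i then z else 0)) = (\<Sum>j<n. if j = i then x ^ j * emb z else 0)"
    by (intro sum.cong) (auto simp: emb_0)
  also have "\<dots> = x ^ i * emb z" using assms(1) by simp
  finally show ?thesis unfolding power_span_def using assms(2) OZ_0
    by (intro CollectI exI[of _ "\<lambda>j. if j = i then z else 0"]) auto
qed

lemma power_span_emb: "z \<in> OZ \<Longrightarrow> emb z \<in> power_span x"
  using power_span_I[of 0 z x] nh_pos by simp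

lemma power_span_1: "1 \<in> power_span x" using power_span_emb[OF OZ_1] emb_1 by simp

lemma power_span_mult_gen:
  assumes "x ^ n \<in> power_span x" "a \<in> power_span x" shows "x * a \<in> power_span x"
proof -
  obtain c where c: "a = (\<Sum>i<n. x ^ i * emb (c i))" "\<forall>i. c i \<in> OZ"
    using assms unfolding power_span_def by blast
  have "x ^ Suc i * emb (c i) \<in> power_span x" if "i < n" for i
  proof (cases "Suc i < n")
    case True then show ?thesis using power_span_I c(2) by blast
  next
    case False
    then have "Suc i = n" using that by simp
    then show ?thesis using power_span_mult_emb[OF assms(1)] c(2) by simp
  qed
  then have "(\<Sum>i<n. x ^ Suc i * emb (c i)) \<in> power_span x" by (intro power_span_sum) auto
  then show ?thesis unfolding c(1) by (simp add: sum_distrib_left mult.assoc)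
qed

text \<open>By \<open>ex\<close>, moving \<open>emb z\<close> past one factor \<open>x\<close> costs
  a term with one factor \<open>x\<close> less, so induction on the exponent applies. The hypothesis
  covers the rules for \<open>u\<close> and for \<open>y\<close> alike.\<close>

lemma power_span_emb_mult:
  assumes x: "x ^ n \<in> power_span x"
    and ex: "\<And>z. z \<in> OZ \<Longrightarrow> \<exists>z'\<in>OZ. \<exists>d\<in>OZ. emb z * x = x * emb z' + emb d"
    and z: "z \<in> OZ" and a: "a \<in> power_span x"
  shows "emb z * a \<in> power_span x"
proof -
  have pow: "emb z * x ^ i \<in> power_span x" if "z \<in> OZ" for z i
    using that
  proof (induction i arbitrary: z)
    case 0
    then show ?case using power_span_emb by simp
  next
    case (Suc i)
    obtain z' d where zd: "z' \<in> OZ" "d \<in> OZ" "emb z * x = x * emb z' + emb d" using ex[OF Suc.prems] by blast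
    have "emb z * x ^ Suc i = (emb z * x) * x ^ i" by (simp add: mult.assoc)
    also have "\<dots> = x * (emb z' * x ^ i) + emb d * x ^ i"
      unfolding zd(3) by (simp add: distrib_right mult.assoc)
    finally show ?case using zd(1,2) by (simp add: power_span_add power_span_mult_gen[OF x] Suc.IH)
  qed
  obtain c where c: "a = (\<Sum>i<n. x ^ i * emb (c i))" "\<forall>i. c i \<in> OZ"
    using a unfolding power_span_def by blast
  have "emb z * a = (\<Sum>i<n. (emb z * x ^ i) * emb (c i))"
    unfolding c(1) by (simp add: sum_distrib_left mult.assoc)
  also have "\<dots> \<in> power_span x" using pow[OF z] c(2) by (intro power_span_sum power_span_mult_emb) auto
  finally show ?thesis .
qed

lemma power_span_mult:
  assumes x: "x ^ n \<in> power_span x"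
    and ex: "\<And>z. z \<in> OZ \<Longrightarrow> \<exists>z'\<in>OZ. \<exists>d\<in>OZ. emb z * x = x * emb z' + emb d"
    and a: "a \<in> power_span x" and b: "b \<in> power_span x"
  shows "a * b \<in> power_span x"
proof -
  have pow: "x ^ i * b' \<in> power_span x" if "b' \<in> power_span x" for b' i
  proof (induction i)
    case (Suc i)
    then show ?case using power_span_mult_gen[OF x] by (simp add: mult.assoc)
  qed (use that in simp)
  obtain c where c: "a = (\<Sum>i<n. x ^ i * emb (c i))" "\<forall>i. c i \<in> OZ"
    using a unfolding power_span_def by blast
  have "a * b = (\<Sum>i<n. x ^ i * (emb (c i) * b))"
    unfolding c(1) by (simp add: sum_distrib_right mult.assoc)
  also have "\<dots> \<in> power_span x" using c(2) by (intro power_span_sum pow power_span_emb_mult[OF x ex _ b]) auto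
  finally show ?thesis .
qed

lemma u_n_power_span: "u ^ n \<in> power_span u"
  using power_span_emb[OF OZ_int, of \<sigma> u] unfolding u_n emb_of_int .

lemma emb_u_ex: "z \<in> OZ \<Longrightarrow> \<exists>z'\<in>OZ. \<exists>d\<in>OZ. emb z * u = u * emb z' + emb d"
  using emb_u[OF OZ_Z] S_OZ OZ_0 emb_0 by (intro bexI[of _ "S z"] bexI[of _ 0]) auto

lemma emb_y_ex: "z \<in> OZ \<Longrightarrow> \<exists>z'\<in>OZ. \<exists>d\<in>OZ. emb z * y = y * emb z' + emb d"
  using emb_y[OF OZ_Z] S_OZ OZ_mult[OF OZ_int diff_S_div_beta', of z l] by blast

text \<open>Left multiplication by \<open>y\<close> commutes with right multiplication by \<open>Z\<close>, and \<open>(-u)\<^sup>j\<close> is mapped to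
  \<open>(-u)\<^sup>j\<^sup>+\<^sup>1\<close> by \<open>w \<mapsto> y w S\<^sup>j(beta') - l w\<close>.\<close>

lemma eval_norm_poly:
  "(\<Sum>i\<le>k. y ^ i * (- u) ^ j * emb (coeff (\<Prod>i<k. [:- of_int l, (S ^^ (j + i)) beta':]) i)) = (- u) ^ (j + k)"
proof (induction k arbitrary: j)
  case 0
  then show ?case by (simp add: emb_1)
next
  case (Suc k)
  \<comment> \<open>The first factor is split off and the remaining ones start at the power
    \<open>Suc j\<close> of \<open>S\<close>; this is why \<open>j\<close> is generalised in the
    induction.\<close>
  define G where "G = (\<Prod>i<k. [:- of_int l, (S ^^ (Suc j + i)) beta':])"
  define b where "b = (S ^^ j) beta'"
  define w where "w = (- u) ^ j"
  have bZ: "b \<in> Z" unfolding b_def using S_pow_Z[OF beta'_Z] .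
  have lZ: "- of_int l \<in> Z" using int_Z[of "- l"] by simp
  have G0: "coeff (\<Prod>i<k. [:- of_int l, (S ^^ (j' + i)) beta':]) i \<in> Z \<and>
      degree (\<Prod>i<k. [:- of_int l, (S ^^ (j' + i)) beta':]) \<le> k" for i j' k
  proof (induction k arbitrary: i)
    case 0
    then show ?case by (auto simp: coeff_1 Z_0 Z_1)
  next
    case (Suc k)
    let ?G = "\<Prod>i<k. [:- of_int l, (S ^^ (j' + i)) beta':]"
    let ?L = "[:- of_int l, (S ^^ (j' + k)) beta':]"
    have "coeff (?G * ?L) i \<in> Z"
    proof (cases i)
      case 0
      then show ?thesis using Suc[of 0] lZ Z_mult[OF lZ] by (simp add: mult.commute[of ?G])
    next
      case i: (Suc i')
      have "coeff (?G * ?L) i = - of_int l * coeff ?G i + (S ^^ (j' + k)) beta' * coeff ?G i'"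
        unfolding i by (simp add: mult.commute[of ?G])
      also have "\<dots> \<in> Z" using Suc[of i] Suc[of i'] by (intro Z_add Z_mult lZ S_pow_Z beta'_Z) auto
      finally show ?thesis .
    qed
    moreover have "degree (?G * ?L) \<le> Suc k"
      using degree_mult_le[of ?G ?L] Suc[of 0] degree_pCons_le[of "- of_int l" "[:(S ^^ (j' + k)) beta':]"] by simp
    ultimately show ?case by simp
  qed
  have GZ: "coeff G i \<in> Z" and degG: "degree G \<le> k" for i
    unfolding G_def using G0[where k = k and j' = "Suc j" and i = i] by auto
  have prod: "(\<Prod>i<Suc k. [:- of_int l, (S ^^ (j + i)) beta':]) = [:- of_int l, b:] * G"
    unfolding prod.lessThan_Suc_shift G_def b_def by simp
  have c: "coeff ([:- of_int l, b:] * G) i = - of_int l * coeff G i + (case i of 0 \<Rightarrow> 0 | Suc i' \<Rightarrow> b * coeff G i')" for i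
    by (cases i) auto
  have "(\<Sum>i\<le>Suc k. y ^ i * w * emb (coeff ([:- of_int l, b:] * G) i)) =
      (\<Sum>i\<le>Suc k. y ^ i * w * emb (- of_int l * coeff G i)) +
      (\<Sum>i\<le>Suc k. y ^ i * w * emb (case i of 0 \<Rightarrow> 0 | Suc i' \<Rightarrow> b * coeff G i'))"
  proof -
    have "emb (coeff ([:- of_int l, b:] * G) i) =
      emb (- of_int l * coeff G i) + emb (case i of 0 \<Rightarrow> 0 | Suc i' \<Rightarrow> b * coeff G i')" for i
      unfolding c
    proof (rule emb_add)
      show "- of_int l * coeff G i \<in> Z" by (intro Z_mult lZ GZ)
    qed (auto intro!: Z_mult bZ GZ Z_0 split: nat.split)
    then show ?thesis by (simp only: distrib_left sum.distrib)
  qed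
  also have "(\<Sum>i\<le>Suc k. y ^ i * w * emb (case i of 0 \<Rightarrow> 0 | Suc i' \<Rightarrow> b * coeff G i')) =
      (\<Sum>i\<le>k. y ^ Suc i * w * emb (b * coeff G i))"
    unfolding sum.atMost_Suc_shift by (simp add: emb_0)
  also have "(\<Sum>i\<le>Suc k. y ^ i * w * emb (- of_int l * coeff G i)) =
      (\<Sum>i\<le>k. y ^ i * w * emb (- of_int l * coeff G i))"
    using coeff_eq_0[of G "Suc k"] degG by (simp add: emb_0)
  also have "\<dots> + (\<Sum>i\<le>k. y ^ Suc i * w * emb (b * coeff G i)) =
      (\<Sum>i\<le>k. y ^ i * (w * emb (- of_int l) + y * w * emb b) * emb (coeff G i))"
    unfolding sum.distrib[symmetric]
    by (intro sum.cong refl)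
       (simp only: emb_mult[OF lZ GZ] emb_mult[OF bZ GZ] power_Suc2 distrib_left distrib_right mult.assoc)
  also have "w * emb (- of_int l) + y * w * emb b = (- u) ^ Suc j"
  proof -
    \<comment> \<open>Moving \<open>b\<close> to the left across \<open>(- u) ^ j\<close> undoes the
      power of \<open>S\<close> and puts \<open>beta'\<close> next to \<open>y\<close>, where
      \<open>y_beta'\<close> applies.\<close>
    have "w * emb b = emb beta' * w"
      unfolding w_def b_def using emb_u_pow[OF beta'_Z, of j] by (cases "even j") simp_all
    then have "y * w * emb b = (of_int l - u) * w" unfolding y_beta'[symmetric] by (simp only: mult.assoc)
    moreover have "w * emb (- of_int l) = - of_int l * w"
      using emb_of_int[of "- l"] by (simp add: mult_of_int_commute)
    ultimately show ?thesis unfolding w_def by (simp add: algebra_simps)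
  qed
  also have "(\<Sum>i\<le>k. y ^ i * (- u) ^ Suc j * emb (coeff G i)) = (- u) ^ (Suc j + k)"
    unfolding G_def by (rule Suc)
  finally show ?case unfolding prod w_def by simp
qed

text \<open>As \<open>n\<close> is odd, the norm polynomial evaluates to
  \<open>(- u) ^ n = - \<sigma>\<close> and has constant term \<open>- l ^ n\<close>. Dividing by
  \<open>p\<close> leaves a monic equation of degree \<open>n\<close> for \<open>y\<close> with
  integer coefficients, where \<open>(l ^ n - \<sigma>) / p\<close> is an integer by the choice of
  \<open>l\<close>.\<close>

lemma y_n_power_span: "y ^ n \<in> power_span y"
proof -
  define F where "F = (\<Prod>i<n. [:- of_int l, (S ^^ i) beta':])"
  obtain f :: "nat \<Rightarrow> int" where f: "f n = 1" "coeff F 0 = of_int ((- l) ^ n)"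
    "\<And>i. i \<ge> 1 \<Longrightarrow> coeff F i = of_nat p * of_int (f i)"
    using norm_poly_beta'(1)[of l] unfolding F_def by blast
  obtain t where t: "l ^ n - \<sigma> = int p * t" using l_n unfolding cong_iff_dvd_diff dvd_def by blast
  have split: "{..n} = insert 0 {1..n}" "{1..n} = insert n {1..<n}" using n_gt_1 by auto
  have "(\<Sum>i\<le>n. y ^ i * emb (coeff F i)) = (- u) ^ n"
    using eval_norm_poly[of 0 n] unfolding F_def by simp
  then have "emb (coeff F 0) + (\<Sum>i\<in>{1..n}. y ^ i * emb (coeff F i)) = - of_int \<sigma>"
    using odd_n u_n unfolding split(1) by simp
  moreover have "(\<Sum>i\<in>{1..n}. y ^ i * emb (coeff F i)) = of_nat p * (\<Sum>i\<in>{1..n}. of_int (f i) * y ^ i)"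
  proof -
    have "y ^ i * emb (coeff F i) = of_nat p * (of_int (f i) * y ^ i)" if "i \<ge> 1" for i
    proof -
      have "emb (coeff F i) = of_int (int p * f i)"
        unfolding f(3)[OF that] using emb_of_int[of "int p * f i"] by simp
      then have "y ^ i * emb (coeff F i) = of_int (int p * f i) * y ^ i" by (simp only: mult_of_int_commute)
      then show ?thesis by (simp add: mult.assoc)
    qed
    then show ?thesis unfolding sum_distrib_left by (intro sum.cong) auto
  qed
  moreover have "emb (coeff F 0) = - of_int (l ^ n)"
    unfolding f(2) emb_of_int using odd_n by simp
  ultimately have "of_nat p * (\<Sum>i\<in>{1..n}. of_int (f i) * y ^ i) = of_int (l ^ n - \<sigma>)"
    by (simp add: algebra_simps eq_neg_iff_add_eq_0)
  also have "\<dots> = of_nat p * of_int t" unfolding t by simp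
  finally have "(\<Sum>i\<in>{1..n}. of_int (f i) * y ^ i) = of_int t" using of_nat_p_neq_0 by simp
  then have "y ^ n + (\<Sum>i\<in>{1..<n}. of_int (f i) * y ^ i) = of_int t" unfolding split(2) using f(1) by simp
  then have "y ^ n = of_int t - (\<Sum>i\<in>{1..<n}. of_int (f i) * y ^ i)" by (simp add: algebra_simps)
  moreover have "y ^ i \<in> power_span y" if "i < n" for i using power_span_I[OF that OZ_1, of y] emb_1 by simp
  moreover have "of_int t \<in> power_span y" using power_span_emb[OF OZ_int, of t y] by (simp only: emb_of_int)
  ultimately show ?thesis by (auto intro!: power_span_diff power_span_sum power_span_of_int)
qed

section \<open>Hull's order as a ring and its generation by squares\<close>

definition M :: "'a set" where "M = power_span y"

lemma M_mult: "a \<in> M \<Longrightarrow> b \<in> M \<Longrightarrow> a * b \<in> M"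
  unfolding M_def by (rule power_span_mult[OF y_n_power_span emb_y_ex])

lemma M_add: "a \<in> M \<Longrightarrow> b \<in> M \<Longrightarrow> a + b \<in> M"
  and M_diff: "a \<in> M \<Longrightarrow> b \<in> M \<Longrightarrow> a - b \<in> M"
  and M_of_int: "a \<in> M \<Longrightarrow> of_int k * a \<in> M"
  and M_emb: "z \<in> OZ \<Longrightarrow> emb z \<in> M"
  and M_1: "1 \<in> M" and M_0: "0 \<in> M"
  unfolding M_def by (rule power_span_add power_span_diff power_span_of_int power_span_emb power_span_1 power_span_0; assumption)+

lemma y_M: "y \<in> M"
  unfolding M_def using power_span_I[of 1 1 y] n_gt_1 OZ_1 emb_1 by simp

lemma u_M: "u \<in> M"
proof -
  have "u = of_int l * 1 - y * emb beta'" unfolding y_beta' by simp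
  then show ?thesis using M_diff M_mult[OF y_M M_emb[OF beta'_OZ]] M_of_int[OF M_1] by metis
qed

lemma M_power: "a \<in> M \<Longrightarrow> a ^ k \<in> M"
  by (induction k) (auto intro: M_1 M_mult)

text \<open>One factor \<open>p\<close> per factor \<open>y\<close> clears the denominators:
  \<open>p y\<close> is \<open>l - u\<close> times an element of \<open>OZ\<close>, and left
  multiplication by it preserves the span of the powers of \<open>u\<close>.\<close>

lemma p_power_M_power_span_u:
  assumes "z \<in> OZ" shows "of_nat p ^ i * (y ^ i * emb z) \<in> power_span u"
proof (induction i)
  case 0
  then show ?case using power_span_emb[OF assms] by simp
next
  case (Suc i)
  let ?a = "of_nat p ^ i * (y ^ i * emb z)"
  have comm: "of_nat p ^ i * y = y * of_nat p ^ i"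
    using mult_of_nat_commute[of "p ^ i" y] by simp
  have "of_nat p ^ Suc i * (y ^ Suc i * emb z) = of_nat p * ((of_nat p ^ i * y) * (y ^ i * emb z))"
    by (simp add: mult.assoc)
  also have "\<dots> = (of_nat p * y) * ?a" unfolding comm by (simp only: mult.assoc)
  also have "\<dots> = of_int l * (emb (beta 0 ^ (n - 1)) * ?a) - u * (emb (beta 0 ^ (n - 1)) * ?a)"
    unfolding y_def by (simp add: left_diff_distrib mult.assoc)
  also have "\<dots> \<in> power_span u"
    using Suc by (intro power_span_diff power_span_of_int power_span_mult_gen[OF u_n_power_span] power_span_emb_mult[OF u_n_power_span emb_u_ex] OZ_power beta_OZ)
  finally show ?case .
qed

text \<open>Modulo \<open>J\<close> all periods equal \<open>t = eta 0\<close>. Their sum gives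
  \<open>n t = -1\<close>, and the product of two periods gives \<open>t^2 = h t\<close>.
  Multiplying by \<open>n\<close> yields \<open>(n h + 1) t = 0\<close>, that is
  \<open>p t = 0\<close>, and then \<open>p = - n p t = 0\<close>.\<close>

lemma p_in_ideal:
  assumes add: "\<And>a b. a \<in> J \<Longrightarrow> b \<in> J \<Longrightarrow> a + b \<in> J"
    and mult: "\<And>a z. a \<in> J \<Longrightarrow> z \<in> OZ \<Longrightarrow> a * z \<in> J"
    and gal: "\<And>z. z \<in> OZ \<Longrightarrow> z - gal 1 z \<in> J"
  shows "of_nat p \<in> J"
proof -
  have J0: "0 \<in> J" using gal[OF OZ_0] mult[OF _ OZ_0] by fastforce
  have uminus: "- a \<in> J" if "a \<in> J" for a using mult[OF that OZ_int[of "-1"]] by simp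
  have sum: "sum f A \<in> J" if "\<And>i. i \<in> A \<Longrightarrow> f i \<in> J" for f and A :: "nat set"
    using that by (induction A rule: infinite_finite_induct) (auto intro: J0 add)
  have eta: "eta 0 - eta i \<in> J" for i
  proof (induction i)
    case (Suc i)
    have "eta i - eta (Suc i) \<in> J" using gal[OF eta_OZ, of i] gal_eta[of 1 i] by simp
    from add[OF Suc this] show ?case by simp
  qed (simp add: J0)
  have n_eta: "of_nat n * eta 0 + 1 \<in> J"
  proof -
    have "(\<Sum>i<n. eta 0 - eta i) \<in> J" by (rule sum) (rule eta)
    then show ?thesis by (simp add: sum_subtractf sum_eta)
  qed
  obtain k where k: "eta 0 * eta 1 = (\<Sum>r<h. eta (k r))" using eta_0_mult_eta_1[OF odd_n n_gt_1] by blast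
  have "(\<Sum>r<h. eta 0 - eta (k r)) \<in> J" by (rule sum) (rule eta)
  then have A: "of_nat h * eta 0 - eta 0 * eta 1 \<in> J" unfolding k by (simp add: sum_subtractf)
  have "(eta 0 - eta 1) * eta 0 \<in> J" using mult[OF eta eta_OZ] .
  from add[OF A uminus[OF this]] have B: "of_nat h * eta 0 - eta 0 * eta 0 \<in> J"
    by (simp add: algebra_simps)
  have intOZ: "of_nat i \<in> OZ" for i using OZ_int[of "int i"] by simp
  have "(of_nat h * eta 0 - eta 0 * eta 0) * of_nat n + (of_nat n * eta 0 + 1) * eta 0 \<in> J"
    by (intro add mult B n_eta intOZ eta_OZ)
  moreover have np: "of_nat n * of_nat h + (1::complex) = of_nat p"
    using nh p_gt_1 by (simp flip: of_nat_mult of_nat_Suc)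
  ultimately have C: "of_nat p * eta 0 \<in> J" unfolding np[symmetric] by (simp add: algebra_simps)
  have "(of_nat n * eta 0 + 1) * of_nat p + - (of_nat p * eta 0 * of_nat n) \<in> J"
    by (intro add uminus mult n_eta C intOZ)
  then show ?thesis by (simp add: algebra_simps)
qed

text \<open>\<open>P\<close> contains \<open>2 M\<close> and all commutators. Hence it suffices to treat \<open>u\<^sup>j z\<close> with \<open>z \<in> OZ\<close>, because \<open>p\<close> is
  odd. For \<open>j = 0\<close> this is \<open>eta_square\<close>; for \<open>j > 0\<close> the commutators \<open>[u\<^sup>j z, w]\<close> yield \<open>u\<^sup>j\<close> times the
  ideal generated by all \<open>w - S\<^sup>j w\<close>, which contains \<open>p\<close>.\<close>

lemma M_generated_by_squares:
  assumes P0: "0 \<in> P" and Padd: "\<And>a b. a \<in> P \<Longrightarrow> b \<in> P \<Longrightarrow> a + b \<in> P"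
    and Pdiff: "\<And>a b. a \<in> P \<Longrightarrow> b \<in> P \<Longrightarrow> a - b \<in> P"
    and Psq: "\<And>a. a \<in> M \<Longrightarrow> a * a \<in> P"
  shows "M \<subseteq> P"
proof -
  have Puminus: "- a \<in> P" if "a \<in> P" for a using Pdiff[OF P0 that] by simp
  have Pnat: "of_nat k * a \<in> P" if "a \<in> P" for k a
    by (induction k) (auto simp: P0 distrib_right intro: Padd that)
  have Pint: "of_int k * a \<in> P" if "a \<in> P" for k a
    using Pnat[OF that] Puminus[OF Pnat[OF that]] by (cases k rule: int_cases2) auto
  have P2: "2 * a \<in> P" if "a \<in> M" for a
  proof -
    have "(a + 1) * (a + 1) - a * a - 1 * 1 \<in> P" by (intro Pdiff Psq M_add M_1 that)
    then show ?thesis by (simp add: algebra_simps mult_2)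
  qed
  have Pcomm: "a * b - b * a \<in> P" if "a \<in> M" "b \<in> M" for a b
  proof -
    have "(a + b) * (a + b) - a * a - b * b - 2 * (b * a) \<in> P"
      by (intro Pdiff Psq P2 M_add M_mult that)
    moreover have "(a + b) * (a + b) - a * a - b * b - 2 * (b * a) = a * b - b * a"
      by (simp add: algebra_simps mult_2)
    ultimately show ?thesis by simp
  qed
  have "odd p" using prime_p p_neq_2 p_gt_1 by (simp add: prime_odd_nat)
  then obtain t where t: "p = 2 * t + 1" by (rule oddE)
  have Pp: "a \<in> P" if a: "a \<in> M" "of_nat p * a \<in> P" for a
  proof -
    \<comment> \<open>With \<open>p = 2 * t + 1\<close>, the element \<open>a\<close> is
      \<open>p a\<close> minus twice \<open>t a\<close>.\<close>
    have "of_nat t * a \<in> M" using M_of_int[OF a(1), of "int t"] by simp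
    from Pdiff[OF a(2) P2[OF this]] show ?thesis unfolding t
      by (simp add: distrib_right mult.assoc)
  qed
  have Pp_power: "a \<in> P" if a: "a \<in> M" "of_nat p ^ i * a \<in> P" for a i
    using a(2)
  proof (induction i)
    case (Suc i)
    have "of_nat p ^ i * a \<in> M" using M_of_int[OF a(1), of "int p ^ i"] by simp
    moreover have "of_nat p * (of_nat p ^ i * a) \<in> P" using Suc.prems by (simp add: mult.assoc)
    ultimately show ?case using Suc.IH Pp by blast
  qed simp
  have Pemb: "emb z \<in> P" if z: "z \<in> OZ" for z
  proof -
    have P_eta: "emb (eta k) \<in> P" for k
    proof -
      obtain j w where w: "w \<in> OZ" "eta k = (eta j)\<^sup>2 - 2 * w" using eta_square[OF p_neq_2] by blast
      have "emb (eta k) = emb (eta j) * emb (eta j) - 2 * emb w"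
      proof -
        have Z: "eta j * eta j \<in> Z" "of_int 2 * w \<in> Z" using eta_Z OZ_Z[OF w(1)] int_Z Z_mult by blast+
        have "eta k = eta j * eta j - of_int 2 * w" unfolding w(2) by (simp add: power2_eq_square)
        then have "emb (eta k) = emb (eta j * eta j) - emb (of_int 2 * w)" using emb_diff[OF Z] by simp
        also have "\<dots> = emb (eta j) * emb (eta j) - of_int 2 * emb w"
          by (simp only: emb_mult[OF eta_Z eta_Z] emb_mult[OF int_Z OZ_Z[OF w(1)]] emb_of_int)
        finally show ?thesis by simp
      qed
      also have "\<dots> \<in> P" by (intro Pdiff Psq P2 M_emb eta_OZ w(1))
      finally show ?thesis .
    qed
    obtain c where c: "\<forall>i. c i \<in> \<int>" "z = (\<Sum>i<n. c i * eta i)" using OZ_periods[OF z] by blast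
    have summand: "emb (c i * eta i) \<in> P \<and> c i * eta i \<in> Z" for i
    proof -
      have "c i \<in> \<int>" using c(1) by blast
      then obtain k where k: "c i = of_int k" by (rule Ints_cases)
      show ?thesis unfolding k emb_mult[OF int_Z eta_Z] emb_of_int
        using Pint[OF P_eta] Z_mult[OF int_Z eta_Z] by blast
    qed
    have Psum: "(\<Sum>i\<in>A. emb (c i * eta i)) \<in> P" for A
      by (induction A rule: infinite_finite_induct) (use P0 Padd summand in auto)
    have "emb z = (\<Sum>i<n. emb (c i * eta i))" unfolding c(2) using summand by (intro emb_sum) blast
    then show ?thesis using Psum by simp
  qed
  have Pu: "u ^ j * emb z \<in> P" if jz: "j < n" "z \<in> OZ" for j z
  proof (cases "j = 0")
    case True
    then show ?thesis using Pemb[OF jz(2)] by simp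
  next
    case False
    \<comment> \<open>Quantifying over all \<open>z\<close> makes \<open>J\<close> an ideal of
      \<open>OZ\<close>.\<close>
    define J where "J = {x \<in> OZ. \<forall>z\<in>OZ. u ^ j * emb (z * x) \<in> P}"
    have J_add: "a + b \<in> J" if ab: "a \<in> J" "b \<in> J" for a b
    proof -
      have "u ^ j * emb (z * (a + b)) \<in> P" if "z \<in> OZ" for z
      proof -
        have "u ^ j * emb (z * (a + b)) = u ^ j * emb (z * a) + u ^ j * emb (z * b)"
          using ab that unfolding J_def
          by (simp add: distrib_left[of z] emb_add OZ_Z OZ_mult distrib_left)
        then show ?thesis using ab that Padd unfolding J_def by auto
      qed
      then show ?thesis using ab OZ_add unfolding J_def by blast
    qed
    have "of_nat p \<in> J"
    proof (rule p_in_ideal)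
      show "a + b \<in> J" if "a \<in> J" "b \<in> J" for a b by (rule J_add[OF that])
    next
      fix a z assume "a \<in> J" "z \<in> OZ"
      then show "a * z \<in> J" unfolding J_def
        using OZ_mult by (auto simp: mult.assoc mult.left_commute[of _ a z] simp flip: mult.assoc)
           (metis OZ_mult mult.assoc mult.commute)
    next
      have J_S: "w - (S ^^ j) w \<in> J" if w: "w \<in> OZ" for w
      proof -
        have "u ^ j * emb (z * (w - (S ^^ j) w)) \<in> P" if z: "z \<in> OZ" for z
        proof -
          have Z: "w \<in> Z" "z \<in> Z" "(S ^^ j) w \<in> Z" using w z OZ_Z S_pow_Z by auto
          have "emb (z * (w - (S ^^ j) w)) = emb z * emb w - emb ((S ^^ j) w) * emb z"
            unfolding emb_mult[OF Z(2) Z_diff[OF Z(1,3)]] emb_diff[OF Z(1,3)] emb_comm[OF Z(3,2)]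
            by (rule right_diff_distrib)
          then have "u ^ j * emb (z * (w - (S ^^ j) w)) = u ^ j * (emb z * emb w) - u ^ j * (emb ((S ^^ j) w) * emb z)"
            by (simp only: right_diff_distrib)
          also have "\<dots> = (u ^ j * emb z) * emb w - emb w * (u ^ j * emb z)"
            using emb_u_pow[OF Z(1), of j] by (metis mult.assoc)
          also have "\<dots> \<in> P" by (intro Pcomm M_mult M_power u_M M_emb w z)
          finally show ?thesis .
        qed
        then show ?thesis unfolding J_def using OZ_diff[OF w S_pow_OZ[OF w]] by blast
      qed
      \<comment> \<open>The differences telescope along the powers of \<open>S ^^ j\<close>.\<close>
      have J_S_pow: "w - (S ^^ (j * i)) w \<in> J" if "w \<in> OZ" for w i
      proof (induction i)
        case 0
        have "0 \<in> J" unfolding J_def using OZ_0 P0 by (simp add: emb_0)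
        then show ?case by simp
      next
        case (Suc i)
        from J_add[OF Suc J_S[OF S_pow_OZ[OF that, of "j * i"]]]
        have "w - (S ^^ j) ((S ^^ (j * i)) w) \<in> J" by simp
        also have "(S ^^ j) ((S ^^ (j * i)) w) = (S ^^ (j * Suc i)) w" by (simp add: funpow_add)
        finally show ?case .
      qed
      \<comment> \<open>\<open>j\<close> is invertible modulo \<open>n\<close>, so some multiple of
        it is congruent to \<open>gal_1_exp\<close>, and the differences for \<open>gal 1\<close>
        are among those already found.\<close>
      have "coprime j n" using False jz(1) prime_n coprime_prime_less by simp
      from cong_solve_coprime_nat[OF this] obtain k where k: "[j * k = 1] (mod n)" by (auto simp: cong_def)
      then have "[j * (k * gal_1_exp) = gal_1_exp] (mod n)" using cong_scalar_right[OF k, of gal_1_exp] by (simp add: mult.assoc)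
      then have "gal 1 w = (S ^^ (j * (k * gal_1_exp))) w" if "w \<in> OZ" for w
        using gal_1_eq[OF OZ_Z[OF that]] S_pow_cong[OF OZ_Z[OF that]] by metis
      then show "w - gal 1 w \<in> J" if "w \<in> OZ" for w using J_S_pow[OF that] that by simp
    qed
    then have "u ^ j * emb (z * of_nat p) \<in> P" using jz(2) unfolding J_def by blast
    moreover have "emb (z * of_nat p) = of_nat p * emb z"
      using emb_mult[OF OZ_Z[OF jz(2)], of "of_nat p"] Rats_Z[of "of_nat p"] emb_of_nat[of p]
        mult_of_nat_commute[of p "emb z"] by simp
    ultimately have "of_nat p * (u ^ j * emb z) \<in> P"
      using mult_of_nat_commute[of p "u ^ j"] by (metis mult.assoc)
    moreover have "u ^ j * emb z \<in> M" by (intro M_mult M_power u_M M_emb jz(2))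
    ultimately show ?thesis using Pp by blast
  qed
  have Psum: "sum f A \<in> P" if "\<And>i. i \<in> A \<Longrightarrow> f i \<in> P" for f and A :: "nat set"
    using that by (induction A rule: infinite_finite_induct) (auto intro: P0 Padd)
  have power_span_u: "power_span u \<subseteq> P"
  proof
    fix a assume "a \<in> power_span u"
    then obtain c where "a = (\<Sum>i<n. u ^ i * emb (c i))" "\<forall>i. c i \<in> OZ" unfolding power_span_def by blast
    then show "a \<in> P" using Pu Psum[of "{..<n}" "\<lambda>i. u ^ i * emb (c i)"] by simp
  qed
  show ?thesis
  proof
    fix a assume "a \<in> M"
    then obtain c where c: "a = (\<Sum>i<n. y ^ i * emb (c i))" "\<forall>i. c i \<in> OZ" unfolding M_def power_span_def by blast
    have "y ^ i * emb (c i) \<in> P" for i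
    proof (rule Pp_power)
      show "y ^ i * emb (c i) \<in> M" using c(2) by (intro M_mult M_power y_M M_emb) blast
      show "of_nat p ^ i * (y ^ i * emb (c i)) \<in> P" using p_power_M_power_span_u c(2) power_span_u by blast
    qed
    then show "a \<in> P" unfolding c(1) by (intro Psum)
  qed
qed

text \<open>Integers are central and \<open>OZ\<close> is spanned by the conjugates of
  \<open>eta 0\<close>, so the \<open>OZ\<close>-span of the powers of \<open>y\<close> is the
  integral span that defines the associated order.\<close>

lemma M_eq:
  "M = {\<Sum>i<n. \<Sum>k<n. of_int (c i k) * (y ^ i * emb ((S ^^ k) (eta 0))) | c :: nat \<Rightarrow> nat \<Rightarrow> int. True}"
proof -
  have row: "(\<Sum>k<n. of_int (c k) * (y ^ i * emb ((S ^^ k) (eta 0)))) =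
    y ^ i * emb (\<Sum>k<n. of_int (c k) * (S ^^ k) (eta 0))" for i and c :: "nat \<Rightarrow> int"
  proof -
    have "emb (\<Sum>k<n. of_int (c k) * (S ^^ k) (eta 0)) = (\<Sum>k<n. of_int (c k) * emb ((S ^^ k) (eta 0)))"
      using int_Z S_pow_Z[OF eta_Z] by (simp add: emb_sum Z_mult emb_mult emb_of_int)
    moreover have "y ^ i * (of_int a * x) = of_int a * (y ^ i * x)" for a x
      by (metis mult.assoc mult_of_int_commute)
    ultimately show ?thesis by (simp add: sum_distrib_left)
  qed
  show ?thesis
  proof (intro equalityI subsetI)
    fix x assume "x \<in> M"
    then obtain d where d: "x = (\<Sum>i<n. y ^ i * emb (d i))" "\<forall>i. d i \<in> OZ"
      unfolding M_def power_span_def by blast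
    have "\<forall>i. \<exists>c::nat \<Rightarrow> int. d i = (\<Sum>k<n. of_int (c k) * (S ^^ k) (eta 0))"
      using d(2) unfolding OZ_eq_span by blast
    from choice[OF this] obtain c :: "nat \<Rightarrow> nat \<Rightarrow> int"
      where "\<forall>i. d i = (\<Sum>k<n. of_int (c i k) * (S ^^ k) (eta 0))" by blast
    then have "x = (\<Sum>i<n. \<Sum>k<n. of_int (c i k) * (y ^ i * emb ((S ^^ k) (eta 0))))"
      unfolding d(1) row by simp
    then show "x \<in> {\<Sum>i<n. \<Sum>k<n. of_int (c i k) * (y ^ i * emb ((S ^^ k) (eta 0))) | c :: nat \<Rightarrow> nat \<Rightarrow> int. True}"
      by blast
  next
    fix x assume "x \<in> {\<Sum>i<n. \<Sum>k<n. of_int (c i k) * (y ^ i * emb ((S ^^ k) (eta 0))) | c :: nat \<Rightarrow> nat \<Rightarrow> int. True}"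
    then obtain c :: "nat \<Rightarrow> nat \<Rightarrow> int"
      where c: "x = (\<Sum>i<n. y ^ i * emb (\<Sum>k<n. of_int (c i k) * (S ^^ k) (eta 0)))"
      unfolding row by blast
    have "(\<Sum>k<n. of_int (c i k) * (S ^^ k) (eta 0)) \<in> OZ" for i unfolding OZ_eq_span by blast
    then show "x \<in> M" unfolding M_def power_span_def c
      by (intro CollectI exI[of _ "\<lambda>i. \<Sum>k<n. of_int (c i k) * (S ^^ k) (eta 0)"]) simp
  qed
qed

end

text \<open>The power \<open>u\<^sup>n = \<sigma>\<close> is central, while conjugation by it acts on \<open>Z\<close> as \<open>S\<^sup>n\<close>.\<close>

lemma cyclic_generation_S_pow:
  fixes emb :: "complex \<Rightarrow> 'a::{division_ring, ring_char_0}" and \<sigma> :: int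
  assumes gen: "cyclic_generation n (of_int \<sigma>) Z S emb u" and z: "z \<in> Z"
  shows "(S ^^ n) z = z"
proof -
  have sub: "complex_subfield Z" and S: "S \<in> galois_group Z" and \<sigma>: "\<sigma> \<noteq> 0"
    and emb_1: "emb 1 = 1"
    and emb: "\<forall>x\<in>Z. \<forall>y\<in>Z. emb (x + y) = emb x + emb y \<and> emb (x * y) = emb x * emb y"
    and emb_u: "\<forall>z\<in>Z. emb z * u = u * emb (S z)"
    and u_n: "u ^ n = rat_emb (of_int \<sigma>)"
    using gen unfolding cyclic_generation_def cyclic_number_field_def galois_generator_def by auto
  have u_n': "u ^ n = of_int \<sigma>" using u_n unfolding rat_emb_def by simp
  have S_Z: "(S ^^ k) z \<in> Z" for k
  proof (induction k)
    case (Suc k)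
    then show ?case using S unfolding galois_group_def by (auto simp: bij_betw_def)
  qed (use z in simp)
  have "emb z * u ^ k = u ^ k * emb ((S ^^ k) z)" for k
  proof (induction k)
    case (Suc k)
    have "emb z * u ^ Suc k = (emb z * u ^ k) * u" by (simp only: power_Suc2 mult.assoc)
    also have "\<dots> = u ^ k * (emb ((S ^^ k) z) * u)" unfolding Suc by (simp only: mult.assoc)
    also have "emb ((S ^^ k) z) * u = u * emb (S ((S ^^ k) z))" using emb_u S_Z by blast
    finally show ?case by (simp only: power_Suc2 mult.assoc funpow.simps o_apply)
  qed simp
  from this[of n] have "of_int \<sigma> * emb z = of_int \<sigma> * emb ((S ^^ n) z)"
    unfolding u_n' by (simp only: mult_of_int_commute)
  then have eq: "emb z = emb ((S ^^ n) z)" using \<sigma> by simp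
  \<comment> \<open>A nonzero element of \<open>Z\<close> is invertible there and
    \<open>emb 1 = 1\<close>, so \<open>emb\<close> is injective; this is applied to the difference
    \<open>d\<close>.\<close>
  define d where "d = (S ^^ n) z - z"
  have d: "d \<in> Z" "inverse d \<in> Z" using S_Z z sub unfolding d_def complex_subfield_def by auto
  have "emb (d + z) = emb d + emb z" using emb d(1) z by blast
  then have "emb d = 0" using eq unfolding d_def by simp
  moreover have "emb (d * inverse d) = emb d * emb (inverse d)" using emb d by blast
  ultimately have "emb (d * inverse d) = 0" by simp
  then have "d = 0" using emb_1 by (cases "d = 0") auto
  then show ?thesis unfolding d_def by simp
qed

section \<open>Sums of squares of matrices\<close>

definition elem_mat :: "nat \<Rightarrow> nat \<Rightarrow> nat \<Rightarrow> 'a::zero \<Rightarrow> 'a mat" where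
  "elem_mat r i j a = mat r r (\<lambda>(k, l). if k = i \<and> l = j then a else 0)"

lemma elem_mat_carrier [simp]: "elem_mat r i j a \<in> carrier_mat r r"
  and dim_elem_mat [simp]: "dim_row (elem_mat r i j a) = r" "dim_col (elem_mat r i j a) = r"
  unfolding elem_mat_def by auto

lemma index_elem_mat [simp]:
  "k < r \<Longrightarrow> l < r \<Longrightarrow> elem_mat r i j a $$ (k, l) = (if k = i \<and> l = j then a else 0)"
  unfolding elem_mat_def by simp

lemma elem_mat_add: "elem_mat r i j a + elem_mat r i j b = elem_mat r i j (a + b :: 'a::monoid_add)"
  by (rule eq_matI) auto

lemma elem_mat_mult:
  fixes a b :: "'a::semiring_0"
  assumes "j < r"
  shows "elem_mat r i j a * elem_mat r k l b = (if j = k then elem_mat r i l (a * b) else 0\<^sub>m r r)"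
proof (rule eq_matI)
  fix s t assume "s < dim_row (if j = k then elem_mat r i l (a * b) else 0\<^sub>m r r)"
    "t < dim_col (if j = k then elem_mat r i l (a * b) else 0\<^sub>m r r)"
  then have st: "s < r" "t < r" by (auto split: if_splits)
  have "(elem_mat r i j a * elem_mat r k l b) $$ (s, t) =
      (\<Sum>q<r. elem_mat r i j a $$ (s, q) * elem_mat r k l b $$ (q, t))"
    using st by (simp add: scalar_prod_def atLeast0LessThan)
  also have "\<dots> = (\<Sum>q<r. if q = j then (if s = i \<and> j = k \<and> t = l then a * b else 0) else 0)"
    using st by (intro sum.cong) auto
  also have "\<dots> = (if s = i \<and> j = k \<and> t = l then a * b else 0)" using assms by simp
  finally show "(elem_mat r i j a * elem_mat r k l b) $$ (s, t) =
      (if j = k then elem_mat r i l (a * b) else 0\<^sub>m r r) $$ (s, t)"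
    using st by auto
qed (auto split: if_splits)

lemma square_add_elem_mat:
  fixes a b :: "'a::semiring_0"
  assumes "j < r" "l < r"
  shows "(elem_mat r i j a + elem_mat r k l b) * (elem_mat r i j a + elem_mat r k l b) =
    (elem_mat r i j a * elem_mat r i j a + elem_mat r i j a * elem_mat r k l b) +
    (elem_mat r k l b * elem_mat r i j a + elem_mat r k l b * elem_mat r k l b)"
proof -
  let ?A = "elem_mat r i j a" and ?B = "elem_mat r k l b"
  have "(?A + ?B) * (?A + ?B) = ?A * (?A + ?B) + ?B * (?A + ?B)"
    by (rule add_mult_distrib_mat[of _ r r _ _ r]) auto
  also have "?A * (?A + ?B) = ?A * ?A + ?A * ?B"
    by (rule mult_add_distrib_mat[of _ r r _ r]) auto
  also have "?B * (?A + ?B) = ?B * ?A + ?B * ?B"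
    by (rule mult_add_distrib_mat[of _ r r _ r]) auto
  finally show ?thesis .
qed

lemma mats_over_iff:
  "C \<in> mats_over r R \<longleftrightarrow> C \<in> carrier_mat r r \<and> (\<forall>i<r. \<forall>j<r. C $$ (i, j) \<in> R)"
proof
  assume C: "C \<in> mats_over r R"
  then have "C \<in> carrier_mat r r" "elements_mat C \<subseteq> R" unfolding mats_over_def by auto
  then show "C \<in> carrier_mat r r \<and> (\<forall>i<r. \<forall>j<r. C $$ (i, j) \<in> R)"
    using elements_matI[of C r r] by blast
next
  assume C: "C \<in> carrier_mat r r \<and> (\<forall>i<r. \<forall>j<r. C $$ (i, j) \<in> R)"
  then have "elements_mat C \<subseteq> R" by (auto dest!: elements_matD)
  then show "C \<in> mats_over r R" using C unfolding mats_over_def by blast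
qed

section \<open>Sums of squares with entries in an additive group\<close>

context
  fixes R :: "'a::ring_1 set" and r :: nat
  assumes R_0: "0 \<in> R" and R_1: "1 \<in> R"
    and R_add: "\<And>a b. a \<in> R \<Longrightarrow> b \<in> R \<Longrightarrow> a + b \<in> R"
    and R_uminus: "\<And>a. a \<in> R \<Longrightarrow> - a \<in> R"
begin

lemma elem_mat_mats_over: "a \<in> R \<Longrightarrow> elem_mat r i j a \<in> mats_over r R"
  unfolding mats_over_iff using R_0 by simp

lemma mats_over_add: "A \<in> mats_over r R \<Longrightarrow> B \<in> mats_over r R \<Longrightarrow> A + B \<in> mats_over r R"
  unfolding mats_over_iff using R_add by auto

text \<open>Splitting off the initial value of the fold lets concatenation of lists correspond to
  addition of sums.\<close>

lemma sum_of_squares_foldr: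
  assumes "set Xs \<subseteq> mats_over r R" "B \<in> carrier_mat r r"
  shows "foldr (\<lambda>X B. X * X + B) Xs (0\<^sub>m r r) \<in> carrier_mat r r"
    and "foldr (\<lambda>X B. X * X + B) Xs B = foldr (\<lambda>X B. X * X + B) Xs (0\<^sub>m r r) + B"
proof -
  have "foldr (\<lambda>X B. X * X + B) Xs (0\<^sub>m r r) \<in> carrier_mat r r \<and>
    foldr (\<lambda>X B. X * X + B) Xs B = foldr (\<lambda>X B. X * X + B) Xs (0\<^sub>m r r) + B"
    using assms(1)
  proof (induction Xs)
    case Nil
    then show ?case using assms(2) by simp
  next
    case (Cons X Xs)
    then have X: "X * X \<in> carrier_mat r r" unfolding mats_over_def by auto
    then show ?case using Cons assms(2) assoc_add_mat[OF X _ assms(2)] by simp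
  qed
  then show "foldr (\<lambda>X B. X * X + B) Xs (0\<^sub>m r r) \<in> carrier_mat r r"
    "foldr (\<lambda>X B. X * X + B) Xs B = foldr (\<lambda>X B. X * X + B) Xs (0\<^sub>m r r) + B" by auto
qed

lemma sum_of_squares_mat_carrier: "sum_of_squares_mat r R C \<Longrightarrow> C \<in> carrier_mat r r"
  unfolding sum_of_squares_mat_def using sum_of_squares_foldr(1)[OF _ zero_carrier_mat] by blast

lemma sum_of_squares_mat_0: "sum_of_squares_mat r R (0\<^sub>m r r)"
  unfolding sum_of_squares_mat_def by (rule exI[of _ "[]"]) simp

lemma sum_of_squares_mat_square: "X \<in> mats_over r R \<Longrightarrow> sum_of_squares_mat r R (X * X)"
  unfolding sum_of_squares_mat_def
  by (rule exI[of _ "[X]"]) (auto simp: mats_over_def)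

lemma sum_of_squares_mat_add:
  assumes "sum_of_squares_mat r R A" "sum_of_squares_mat r R B"
  shows "sum_of_squares_mat r R (A + B)"
proof -
  obtain Xs Ys where Xs: "set Xs \<subseteq> mats_over r R" "A = foldr (\<lambda>X B. X * X + B) Xs (0\<^sub>m r r)"
    and Ys: "set Ys \<subseteq> mats_over r R" "B = foldr (\<lambda>X B. X * X + B) Ys (0\<^sub>m r r)"
    using assms unfolding sum_of_squares_mat_def by blast
  have B: "B \<in> carrier_mat r r" using sum_of_squares_mat_carrier[OF assms(2)] .
  have "foldr (\<lambda>X B. X * X + B) (Xs @ Ys) (0\<^sub>m r r) = A + B"
    unfolding foldr_append o_apply Ys(2)[symmetric] Xs(2) by (rule sum_of_squares_foldr(2)[OF Xs(1) B])
  then show ?thesis unfolding sum_of_squares_mat_def using Xs(1) Ys(1)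
    by (intro exI[of _ "Xs @ Ys"]) simp
qed

lemma sum_of_squares_diagonal_square:
  assumes "i < r" "x \<in> R" shows "sum_of_squares_mat r R (elem_mat r i i (x * x))"
  using sum_of_squares_mat_square[OF elem_mat_mats_over[OF assms(2), of i i]] assms(1)
  by (simp add: elem_mat_mult)

text \<open>The matrix squared is \<open>x E_ij + y E_ji\<close>, whose summands have square 0. With
  \<open>y = - x\<close> it supplies negatives of squares on the diagonal.\<close>

lemma sum_of_squares_diagonal_pair:
  assumes "i < r" "j < r" "i \<noteq> j" "x \<in> R" "y \<in> R"
  shows "sum_of_squares_mat r R (elem_mat r i i (x * y) + elem_mat r j j (y * x))"
proof -
  have "elem_mat r i j x + elem_mat r j i y \<in> mats_over r R"
    by (intro mats_over_add elem_mat_mats_over assms)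
  from sum_of_squares_mat_square[OF this] show ?thesis
    using assms unfolding square_add_elem_mat[OF assms(2,1)] by (simp add: elem_mat_mult)
qed

lemma elem_mat_cancel:
  fixes a b :: 'a
  shows "elem_mat r i i a + elem_mat r j j b + elem_mat r j j (- b) = elem_mat r i i a"
  by (rule eq_matI) auto

text \<open>The matrix \<open>E_ii + a E_ij\<close> is its own square; adding
  \<open>- E_ii - E_jj\<close> removes the surplus \<open>E_ii\<close>, and adding the square
  \<open>E_jj\<close> restores 0 at the other position.\<close>

lemma sum_of_squares_off_diagonal:
  assumes "i < r" "j < r" "i \<noteq> j" "a \<in> R"
  shows "sum_of_squares_mat r R (elem_mat r i j a)"
proof -
  have "elem_mat r i i 1 + elem_mat r i j a \<in> mats_over r R"
    by (intro mats_over_add elem_mat_mats_over assms R_1)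
  from sum_of_squares_mat_square[OF this] have 1: "sum_of_squares_mat r R (elem_mat r i i 1 + elem_mat r i j a)"
    using assms unfolding square_add_elem_mat[OF assms(1,2)] by (simp add: elem_mat_mult)
  have 2: "sum_of_squares_mat r R (elem_mat r i i (-1) + elem_mat r j j (-1))"
    using sum_of_squares_diagonal_pair[OF assms(1-3) R_1 R_uminus[OF R_1]] by simp
  have 3: "sum_of_squares_mat r R (elem_mat r j j 1)"
    using sum_of_squares_diagonal_square[OF assms(2) R_1] by simp
  have "(elem_mat r i i 1 + elem_mat r i j a) + (elem_mat r i i (-1) + elem_mat r j j (-1)) + elem_mat r j j 1
      = elem_mat r i j a"
    by (rule eq_matI) auto
  then show ?thesis using sum_of_squares_mat_add[OF sum_of_squares_mat_add[OF 1 2] 3] by simp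
qed

text \<open>The assumption \<open>gen\<close> says that \<open>R\<close> lies in the additive group
  generated by its squares, phrased through all groups \<open>P\<close> containing them. Diagonal
  entries come from \<open>gen\<close>, the others from
  \<open>sum_of_squares_off_diagonal\<close>.\<close>

lemma sum_of_squares_mat_if_generated:
  assumes gen: "\<And>P. 0 \<in> P \<Longrightarrow> (\<And>a b. a \<in> P \<Longrightarrow> b \<in> P \<Longrightarrow> a + b \<in> P) \<Longrightarrow>
      (\<And>a b. a \<in> P \<Longrightarrow> b \<in> P \<Longrightarrow> a - b \<in> P) \<Longrightarrow> (\<And>a. a \<in> R \<Longrightarrow> a * a \<in> P) \<Longrightarrow> R \<subseteq> P"
    and r: "r \<ge> 2" and C: "C \<in> mats_over r R"
  shows "sum_of_squares_mat r R C"
proof -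
  have diagonal: "sum_of_squares_mat r R (elem_mat r i i a)" if i: "i < r" and a: "a \<in> R" for i a
  proof -
    have "(if i = 0 then 1 else 0) < r" "i \<noteq> (if i = 0 then 1 else 0)" using r by auto
    then obtain j where j: "j < r" "i \<noteq> j" by blast
    \<comment> \<open>Both signs are required so that \<open>P\<close> is closed under
      subtraction.\<close>
    define P where "P = {a. sum_of_squares_mat r R (elem_mat r i i a) \<and> sum_of_squares_mat r R (elem_mat r i i (- a))}"
    have P_add: "a + b \<in> P" if "a \<in> P" "b \<in> P" for a b
      using sum_of_squares_mat_add[of "elem_mat r i i a" "elem_mat r i i b"]
        sum_of_squares_mat_add[of "elem_mat r i i (- a)" "elem_mat r i i (- b)"] that
      unfolding P_def elem_mat_add by simp
    have P_uminus: "- a \<in> P" if "a \<in> P" for a using that unfolding P_def by simp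
    have "R \<subseteq> P"
    proof (rule gen)
      have "elem_mat r i i (0::'a) = 0\<^sub>m r r" by (rule eq_matI) auto
      then show "0 \<in> P" unfolding P_def using sum_of_squares_mat_0 by simp
      show "a - b \<in> P" if "a \<in> P" "b \<in> P" for a b using P_add[OF that(1) P_uminus[OF that(2)]] by simp
      show "x * x \<in> P" if x: "x \<in> R" for x
      proof -
        \<comment> \<open>The pair built from \<open>x\<close> and \<open>- x\<close> gives minus
          the square of \<open>x\<close> at \<open>i\<close> and at \<open>j\<close>; the square of
          \<open>x\<close> added at \<open>j\<close> clears the second position.\<close>
        have "sum_of_squares_mat r R (elem_mat r i i (- (x * x)) + elem_mat r j j (- (x * x)))"
          using sum_of_squares_diagonal_pair[OF i j x R_uminus[OF x]] by simp
        from sum_of_squares_mat_add[OF this sum_of_squares_diagonal_square[OF j(1) x]]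
        have "sum_of_squares_mat r R (elem_mat r i i (- (x * x)))"
          using elem_mat_cancel[of i "- (x * x)" j "- (x * x)"] by simp
        then show ?thesis unfolding P_def using sum_of_squares_diagonal_square[OF i x] by simp
      qed
    qed (rule P_add)
    then show ?thesis using a unfolding P_def by blast
  qed
  have C_carrier: "C \<in> carrier_mat r r" and C_R: "\<And>i j. i < r \<Longrightarrow> j < r \<Longrightarrow> C $$ (i, j) \<in> R"
    using C unfolding mats_over_iff by auto
  define part where "part A = mat r r (\<lambda>(i, j). if (i, j) \<in> A then C $$ (i, j) else 0)" for A
  have all: "sum_of_squares_mat r R (part A)" if "finite A" "A \<subseteq> {..<r} \<times> {..<r}" for A
    using that
  proof (induction A rule: finite_induct)
    case empty
    have "part {} = 0\<^sub>m r r" unfolding part_def by (rule eq_matI) auto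
    then show ?case using sum_of_squares_mat_0 by simp
  next
    case (insert ij A)
    obtain i j where ij: "ij = (i, j)" by (cases ij)
    have "i < r" "j < r" using insert.prems unfolding ij by auto
    then have 1: "sum_of_squares_mat r R (elem_mat r i j (C $$ (i, j)))"
      using diagonal sum_of_squares_off_diagonal C_R by (cases "i = j") auto
    have 2: "sum_of_squares_mat r R (part A)" using insert by blast
    have "part (insert ij A) = elem_mat r i j (C $$ (i, j)) + part A"
      unfolding part_def using insert.hyps ij by (intro eq_matI) auto
    then show ?case using sum_of_squares_mat_add[OF 1 2] by (simp only:)
  qed
  have "sum_of_squares_mat r R (part ({..<r} \<times> {..<r}))" by (rule all) auto
  moreover have "part ({..<r} \<times> {..<r}) = C"
    unfolding part_def using C_carrier by (intro eq_matI) auto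
  ultimately show ?thesis by simp
qed

end

section \<open>Matrices over Hull's order\<close>

theorem theorem4:
  fixes n p g :: nat and \<sigma> :: int and Z :: "complex set" and S :: "complex \<Rightarrow> complex"
    and emb :: "complex \<Rightarrow> 'a::{division_ring, ring_char_0}" and u :: 'a
    and \<xi> :: complex and m :: "'a set"
  assumes "Factorial_Ring.prime n" and "odd n"
    and "canonical_generation n p \<sigma> Z S emb u"
    and "residue_primroot p g"
    and "is_primitive_root_of_unity p \<xi>"
    and "associated_maximal_order n p \<sigma> S emb u g \<xi> m"
    and "[\<sigma> = 1] (mod 2)"
    and "\<exists>N::int. galois_norm Z (gaussian_period n p g \<xi>) = of_int N \<and> [N = 1] (mod 2)"
  shows "\<forall>r\<ge>2. \<forall>C\<in>mats_over r m. sum_of_squares_mat r m C"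
proof -
  have gen: "cyclic_generation n (of_int \<sigma>) Z S emb u" and p: "Factorial_Ring.prime p" "[p = 1] (mod n)"
    and Z_p: "Z \<subseteq> cyclotomic_subfield p"
    using assms(3) unfolding canonical_generation_def has_conductor_def by auto
  have Z: "complex_subfield Z" "rat_degree Z = n" "{z \<in> Z. \<forall>\<tau>\<in>galois_group Z. \<tau> z = z} = \<rat>"
    and S: "galois_generator Z S" and emb_1: "emb 1 = 1"
    and emb: "\<forall>x\<in>Z. \<forall>y\<in>Z. emb (x + y) = emb x + emb y \<and> emb (x * y) = emb x * emb y"
    and emb_u: "\<forall>z\<in>Z. emb z * u = u * emb (S z)"
    and u_n: "u ^ n = rat_emb (of_int \<sigma>)"
    using gen unfolding cyclic_generation_def cyclic_number_field_def by auto
  have u_n': "u ^ n = of_int \<sigma>" using u_n unfolding rat_emb_def by simp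
  have n_dvd: "n dvd p - 1" using p cong_altdef_nat[of 1 p n] prime_ge_1_nat[OF p(1)] by simp
  interpret gaussian_periods p g n \<xi>
    using p(1) assms(5) assms(4) n_dvd by unfold_locales
  have eta_0: "gaussian_period n p g \<xi> = eta 0"
    unfolding gaussian_period_def eta_def h_def e_def by simp
  have beta_0: "period_product n p g \<xi> = beta 0"
    unfolding period_product_def beta_def h_def e_def by simp
  obtain l :: int and y where l: "[l ^ n = \<sigma>] (mod int p)"
    and y: "of_nat p * y = (of_int l - u) * emb (beta 0 ^ (n - 1))"
    and m: "m = {\<Sum>i<n. \<Sum>k<n. of_int (c i k) * (y ^ i * emb ((S ^^ k) (eta 0)))
             | c :: nat \<Rightarrow> nat \<Rightarrow> int. True}"
    using assms(6) unfolding associated_maximal_order_def eta_0 beta_0 by blast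
  interpret period_field p g n \<xi> Z S
    using Z S Z_p cyclic_generation_S_pow[OF gen] assms(1,2) by unfold_locales
  interpret hull_order p g n \<xi> Z S emb u y \<sigma> l
    using emb_1 emb emb_u u_n' l y by unfold_locales auto
  have m_M: "m = M" unfolding m M_eq ..
  show ?thesis
  proof (intro allI impI ballI)
    fix r :: nat and C assume r: "r \<ge> 2" and C: "C \<in> mats_over r m"
    have "sum_of_squares_mat r M C"
    proof (rule sum_of_squares_mat_if_generated[OF M_0 M_1 M_add _ M_generated_by_squares r])
      show "- a \<in> M" if "a \<in> M" for a using M_diff[OF M_0 that] by simp
    qed (use C m_M in auto)
    then show "sum_of_squares_mat r m C" unfolding m_M .
  qed
qed

end
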